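(* There exists a planar almost hypohamiltonian graph of order $n$ whose exceptional vertex is cubic (has degree $3$) for (i) every $n = 36 + 4k$ with $k \ge 0$ an integer, and (ii) every $n \ge 73$.
   Context: All graphs are finite, undirected, connected, without loops or multiple edges. A graph is hamiltonian if it has a cycle through all its vertices. A non-hamiltonian graph $G$ is almost hypohamiltonian if there exists a vertex $w$ (the exceptional vertex) such that $G - w$ is non-hamiltonian and $G - v$ is hamiltonian for every vertex $v \neq w$. *)

theory Defs
  imports "HOL-Analysis.Analysis"
begin

definition simple_graph :: "nat set \<Rightarrow> (nat \<Rightarrow> nat \<Rightarrow> bool) \<Rightarrow> bool" where
  "simple_graph V E \<longleftrightarrow> finite V \<and>
     (\<forall>u v. E u v \<longrightarrow> u \<in> V \<and> v \<in> V) \<and>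
     (\<forall>u v. E u v \<longrightarrow> E v u) \<and> (\<forall>u. \<not> E u u)"

definition connected_graph :: "nat set \<Rightarrow> (nat \<Rightarrow> nat \<Rightarrow> bool) \<Rightarrow> bool" where
  "connected_graph V E \<longleftrightarrow> V \<noteq> {} \<and>
     (\<forall>u\<in>V. \<forall>v\<in>V. (\<lambda>x y. x \<in> V \<and> y \<in> V \<and> E x y)\<^sup>*\<^sup>* u v)"

definition degree :: "nat set \<Rightarrow> (nat \<Rightarrow> nat \<Rightarrow> bool) \<Rightarrow> nat \<Rightarrow> nat" where
  "degree V E w = card {u \<in> V. E w u}"

definition ham_cycle :: "nat set \<Rightarrow> (nat \<Rightarrow> nat \<Rightarrow> bool) \<Rightarrow> nat list \<Rightarrow> bool" where
  "ham_cycle V E xs \<longleftrightarrow> distinct xs \<and> set xs = V \<and> 3 \<le> length xs \<and>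
     (\<forall>i < length xs. E (xs ! i) (xs ! ((i + 1) mod length xs)))"

definition hamiltonian :: "nat set \<Rightarrow> (nat \<Rightarrow> nat \<Rightarrow> bool) \<Rightarrow> bool" where
  "hamiltonian V E \<longleftrightarrow> (\<exists>xs. ham_cycle V E xs)"

text \<open>G - v is the subgraph induced by V - {v}; since ham_cycle only uses vertices
of the given set, hamiltonicity of G - v is hamiltonian (V - {v}) E.\<close>

definition almost_hypohamiltonian_exc ::
  "nat set \<Rightarrow> (nat \<Rightarrow> nat \<Rightarrow> bool) \<Rightarrow> nat \<Rightarrow> bool" where
  "almost_hypohamiltonian_exc V E w \<longleftrightarrow>
     \<not> hamiltonian V E \<and> w \<in> V \<and> \<not> hamiltonian (V - {w}) E \<and>
     (\<forall>v\<in>V. v \<noteq> w \<longrightarrow> hamiltonian (V - {v}) E)"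

definition planar :: "nat set \<Rightarrow> (nat \<Rightarrow> nat \<Rightarrow> bool) \<Rightarrow> bool" where
  "planar V E \<longleftrightarrow> (\<exists>(p :: nat \<Rightarrow> complex) (a :: nat \<Rightarrow> nat \<Rightarrow> real \<Rightarrow> complex).
     inj_on p V \<and>
     (\<forall>u v. E u v \<longrightarrow> arc (a u v) \<and> pathstart (a u v) = p u \<and> pathfinish (a u v) = p v \<and>
        path_image (a u v) \<inter> p ` V = {p u, p v}) \<and>
     (\<forall>u v x y. E u v \<longrightarrow> E x y \<longrightarrow> {u, v} \<noteq> {x, y} \<longrightarrow>
        path_image (a u v) \<inter> path_image (a x y) \<subseteq> p ` ({u, v} \<inter> {x, y})))"

end

theory Submission
  imports Defs "HOL-Library.Code_Binary_Nat"
begin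

text \<open>Take a plane graph all of whose faces are pentagons except for one quadrilateral, on which
  exactly one vertex \<open>u\<close> is cubic, and let \<open>w\<close> be the neighbour of \<open>u\<close> off the quadrilateral, also cubic.
  Grinberg's criterion modulo 3 forbids Hamiltonian cycles in \<open>G\<close>. In \<open>G - w\<close> the vertex \<open>u\<close>
  has degree 2, so the quadrilateral and the face containing \<open>w\<close> lie on different sides of any
  Hamiltonian cycle, and the criterion forbids it again. Computer search yields such graphs of orders
  36, 39, 42 and 45 in which every other vertex-deleted subgraph is Hamiltonian.

  Subdividing two opposite sides of the quadrilateral and joining the new vertices by \<open>2 * k\<close> rungs adds
  \<open>4 * k\<close> vertices. Two consecutive rungs can be contracted out of a Hamiltonian cycle, and conversely two
  rungs can be inserted into any cycle that uses a side of the quadrilateral, so the property survives.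
  The orders 36, 39, 42, 45 represent all residues modulo 4. The
  non-hamiltonicity of the four start graphs is decided by eliminating their vertices one by one
  rather than by Grinberg's criterion.\<close>

section \<open>Cycles as edge relations\<close>

text \<open>Grinberg: for a Hamiltonian cycle in a plane graph, the sum of (length - 2) over the
  inner faces equals that over the outer faces. Modulo 3 pentagons vanish and the quadrilateral
  leaves 2. Deleting a vertex of degree d off the quadrilateral merges d pentagons into a face of
  length 3d, of weight 1 modulo 3, which on the opposite side cannot balance the 2. As d is
  arbitrary, a second cubic vertex on the quadrilateral would make its neighbour exceptional too. By
  Euler's formula such a graph has 3m vertices and 2m - 1 faces, so the start orders are multiples
  of 3; steps of 3 meet every class modulo 4. Rungs come in pairs because a path crossing one rung
  changes rails, and contracting that rung alone would produce a diagonal of the quadrilateral.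
  Longer ladders bring further quadrilaterals and lengthen the faces beyond the rails, so the count
  modulo 3 is lost; hence the induction is on the cycles themselves. Planarity needs no induction:
  one drawing leaves the quadrilateral as an empty square, inside which the ladder is drawn for
  every length.\<close>

definition edge :: "nat \<Rightarrow> nat \<Rightarrow> nat \<Rightarrow> nat \<Rightarrow> bool" where
  "edge x y u v \<longleftrightarrow> u = x \<and> v = y \<or> u = y \<and> v = x"

definition linked :: "(nat \<times> nat) set \<Rightarrow> nat \<Rightarrow> nat \<Rightarrow> bool" where
  "linked S u v \<longleftrightarrow> (u, v) \<in> S \<or> (v, u) \<in> S"

fun steps :: "nat list \<Rightarrow> (nat \<times> nat) list" where
  "steps (x # y # zs) = (x, y) # steps (y # zs)"
| "steps _ = []"

definition round_trip :: "nat list \<Rightarrow> (nat \<times> nat) set" where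
  "round_trip zs = insert (last zs, hd zs) (set (steps zs))"

text \<open>A cycle is identified with its symmetric edge relation, which forgets starting point and
  direction. Surgery then becomes union and difference of relations, and lists are rotated only
  inside the basic lemmas.\<close>

definition cyc :: "nat set \<Rightarrow> (nat \<Rightarrow> nat \<Rightarrow> bool) \<Rightarrow> bool" where
  "cyc U C \<longleftrightarrow> (\<exists>zs. distinct zs \<and> set zs = U \<and> 3 \<le> length zs \<and> C = linked (round_trip zs))"

section \<open>Closed lists and their edges\<close>

lemma linked_simps:
  "linked {} u v \<longleftrightarrow> False"
  "linked (insert (x, y) S) u v \<longleftrightarrow> edge x y u v \<or> linked S u v"
  "linked (S \<union> T) u v \<longleftrightarrow> linked S u v \<or> linked T u v"
  by (auto simp: linked_def edge_def)

lemma linked_sym: "linked S u v \<longleftrightarrow> linked S v u"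
  by (auto simp: linked_def)

lemma edge_self: "edge x y x y" "edge x y y x"
  by (auto simp: edge_def)

lemma steps_append:
  "xs \<noteq> [] \<Longrightarrow> ys \<noteq> [] \<Longrightarrow>
    set (steps (xs @ ys)) = set (steps xs) \<union> {(last xs, hd ys)} \<union> set (steps ys)"
proof (induction xs rule: steps.induct)
  case ("2_2" v)
  then show ?case by (cases ys) auto
qed auto

lemma steps_Cons: "ws \<noteq> [] \<Longrightarrow> steps (p # ws) = (p, hd ws) # steps ws"
  by (cases ws) auto

lemma steps_mem: "(x, y) \<in> set (steps zs) \<Longrightarrow> x \<in> set zs \<and> y \<in> set zs"
  by (induction zs rule: steps.induct) auto

lemma steps_split: "(x, y) \<in> set (steps zs) \<Longrightarrow> \<exists>as bs. zs = as @ x # y # bs"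
proof (induction zs rule: steps.induct)
  case (1 a b zs)
  show ?case
  proof (cases "(x, y) = (a, b)")
    case True
    then have "a # b # zs = [] @ x # y # zs" by simp
    then show ?thesis by blast
  next
    case False
    with 1 obtain as bs where "b # zs = as @ x # y # bs" by auto
    then have "a # b # zs = (a # as) @ x # y # bs" by simp
    then show ?thesis by blast
  qed
qed auto

lemma round_trip_swap:
  assumes "xs \<noteq> []" "ys \<noteq> []"
  shows "round_trip (xs @ ys) = round_trip (ys @ xs)"
  using assms by (auto simp: round_trip_def steps_append)

lemma cyc_mem: "cyc U C \<Longrightarrow> C u v \<Longrightarrow> u \<in> U \<and> v \<in> U"
  unfolding cyc_def linked_def round_trip_def
  by (auto dest!: steps_mem) (metis last_in_set hd_in_set list.size(3) not_numeral_le_zero)+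

lemma cyc_sym: "cyc U C \<Longrightarrow> C u v \<longleftrightarrow> C v u"
  unfolding cyc_def using linked_sym by blast

lemma cyc_card: "cyc U C \<Longrightarrow> finite U \<and> 3 \<le> card U"
  unfolding cyc_def by (auto simp: distinct_card)

lemma cyc_start:
  assumes "cyc U C" "p \<in> U"
  obtains ws where "distinct (p # ws)" "set (p # ws) = U" "2 \<le> length ws"
    "C = linked (insert (last ws, p) (insert (p, hd ws) (set (steps ws))))"
proof -
  obtain zs where zs: "distinct zs" "set zs = U" "3 \<le> length zs" "C = linked (round_trip zs)"
    using assms by (auto simp: cyc_def)
  obtain as bs where ab: "zs = as @ p # bs"
    using assms zs by (metis split_list)
  have "round_trip zs = round_trip (p # bs @ as)"
  proof (cases "as = []")
    case False
    then show ?thesis using round_trip_swap[of as "p # bs"] ab by simp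
  qed (simp add: ab)
  moreover have "2 \<le> length (bs @ as)" "bs @ as \<noteq> []"
    using zs ab by auto
  moreover have "round_trip (p # bs @ as) =
      insert (last (bs @ as), p) (insert (p, hd (bs @ as)) (set (steps (bs @ as))))"
    using \<open>bs @ as \<noteq> []\<close> by (subst round_trip_def, subst steps_Cons) auto
  ultimately show ?thesis
    using that[of "bs @ as"] zs ab by auto
qed

text \<open>Rotation makes any prescribed edge the closing one, so that subdividing it amounts to
  appending a vertex to the list.\<close>

lemma cyc_close:
  assumes "cyc U C" "C x y"
  obtains zs where "distinct zs" "set zs = U" "3 \<le> length zs" "C = linked (round_trip zs)"
    "edge x y (last zs) (hd zs)"
proof -
  obtain zs where zs: "distinct zs" "set zs = U" "3 \<le> length zs" "C = linked (round_trip zs)"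
    using assms by (auto simp: cyc_def)
  obtain a b where ab: "(a, b) \<in> round_trip zs" "edge x y a b"
    using assms zs by (auto simp: linked_def edge_def)
  show ?thesis
  proof (cases "(a, b) = (last zs, hd zs)")
    case True
    then show ?thesis using that zs ab by auto
  next
    case False
    then have "(a, b) \<in> set (steps zs)"
      using ab by (auto simp: round_trip_def)
    then obtain as bs where "zs = as @ a # b # bs"
      using steps_split by blast
    then have s: "zs = (as @ [a]) @ (b # bs)" by simp
    show ?thesis
      by (rule that[of "(b # bs) @ (as @ [a])"])
        (use zs s ab round_trip_swap[of "as @ [a]" "b # bs"] in auto)
  qed
qed

text \<open>If first and last entry were consecutive, distinctness would allow no entries besides
  these two. Hence removing the closing edge as an unordered pair removes no other edge of the
  cycle.\<close>

lemma closing_edge_new: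
  assumes "distinct zs" "3 \<le> length zs"
  shows "\<not> linked (set (steps zs)) (last zs) (hd zs)"
proof
  assume "linked (set (steps zs)) (last zs) (hd zs)"
  then consider as bs where "zs = as @ last zs # hd zs # bs"
    | as bs where "zs = as @ hd zs # last zs # bs"
    unfolding linked_def using steps_split by metis
  then show False
  proof cases
    case 1
    have "\<not> (hd (as @ l # h # bs) = h \<and> distinct (as @ l # h # bs))" for l h
      by (cases as) auto
    then show False using 1 assms by metis
  next
    case 2
    have "\<not> (hd (as @ h # l # bs) = h \<and> last (as @ h # l # bs) = l \<and>
        distinct (as @ h # l # bs) \<and> 3 \<le> length (as @ h # l # bs))" for l h
      by (cases as; cases bs rule: rev_cases) auto
    then show False using 2 assms by metis
  qed
qed

text \<open>With \<open>p\<close> rotated to the front, its neighbours are the two ends of the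
  remaining list, which differ because that list has at least two entries.\<close>

lemma cyc_degree:
  assumes "cyc U C" "p \<in> U"
  obtains x y where "x \<noteq> y" "x \<noteq> p" "y \<noteq> p" "\<And>z. C p z \<longleftrightarrow> z = x \<or> z = y"
proof -
  obtain ws where ws: "distinct (p # ws)" "set (p # ws) = U" "2 \<le> length ws"
    "C = linked (insert (last ws, p) (insert (p, hd ws) (set (steps ws))))"
    using cyc_start assms by metis
  obtain a b cs where w: "ws = a # b # cs"
    using ws(3) by (metis Suc_le_length_iff numeral_2_eq_2)
  have "p \<notin> set ws" using ws by simp
  then have "\<not> linked (set (steps ws)) p z" for z
    by (auto simp: linked_def dest: steps_mem)
  then have "C p z \<longleftrightarrow> z = hd ws \<or> z = last ws" for z
    using ws \<open>p \<notin> set ws\<close> w by (auto simp: linked_simps edge_def)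
  moreover have "hd ws \<noteq> last ws" "hd ws \<noteq> p" "last ws \<noteq> p"
    using w ws by (auto split: if_splits)
  ultimately show ?thesis using that by metis
qed

section \<open>Inserting and splicing out vertices\<close>

lemma cyc_insert:
  assumes "cyc U C" "C x y" "p \<notin> U"
  shows "cyc (insert p U) (\<lambda>u v. (C u v \<and> \<not> edge x y u v) \<or> edge x p u v \<or> edge p y u v)"
proof -
  obtain zs where zs: "distinct zs" "set zs = U" "3 \<le> length zs" "C = linked (round_trip zs)"
    "edge x y (last zs) (hd zs)"
    using cyc_close assms by metis
  have ne: "zs \<noteq> []" using zs by auto
  have "linked (round_trip (zs @ [p])) u v \<longleftrightarrow>
      (C u v \<and> \<not> edge x y u v) \<or> edge x p u v \<or> edge p y u v" for u v
  proof -
    have "linked (round_trip (zs @ [p])) u v \<longleftrightarrow>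
        edge p (hd zs) u v \<or> edge (last zs) p u v \<or> linked (set (steps zs)) u v"
      using ne by (auto simp: round_trip_def steps_append linked_simps)
    moreover have "C u v \<longleftrightarrow> edge (last zs) (hd zs) u v \<or> linked (set (steps zs)) u v"
      using zs by (simp add: round_trip_def linked_simps)
    moreover have "edge x y u v \<longleftrightarrow> edge (last zs) (hd zs) u v"
      using zs(5) by (auto simp: edge_def)
    moreover have "linked (set (steps zs)) u v \<Longrightarrow> \<not> edge (last zs) (hd zs) u v"
      using closing_edge_new[OF zs(1,3)] linked_sym by (auto simp: edge_def)
    moreover have "edge p (hd zs) u v \<or> edge (last zs) p u v \<longleftrightarrow> edge x p u v \<or> edge p y u v"
      using zs(5) by (auto simp: edge_def)
    ultimately show ?thesis by blast
  qed
  then show ?thesis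
    unfolding cyc_def using zs assms
    by (intro exI[of _ "zs @ [p]"]) (auto simp: fun_eq_iff)
qed

text \<open>With \<open>p\<close> rotated to the front, dropping the head leaves a list that closes
  up along \<open>x y\<close>. Four vertices are demanded so that three remain.\<close>

lemma cyc_splice:
  assumes "cyc U C" "C p x" "C p y" "x \<noteq> y" "4 \<le> card U"
  shows "cyc (U - {p}) (\<lambda>u v. (C u v \<and> u \<noteq> p \<and> v \<noteq> p) \<or> edge x y u v)"
proof -
  have "p \<in> U" using assms cyc_mem by metis
  then obtain ws where ws: "distinct (p # ws)" "set (p # ws) = U" "2 \<le> length ws"
    "C = linked (insert (last ws, p) (insert (p, hd ws) (set (steps ws))))"
    using cyc_start assms by metis
  have pn: "p \<notin> set ws" "ws \<noteq> []" using ws by auto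
  then have nl: "\<not> linked (set (steps ws)) p z" "\<not> linked (set (steps ws)) z p" for z
    by (auto simp: linked_def dest: steps_mem)
  have hl: "hd ws \<noteq> p" "last ws \<noteq> p" using pn hd_in_set last_in_set by metis+
  have "C p z \<longleftrightarrow> z = hd ws \<or> z = last ws" for z
    using ws nl hl by (auto simp: linked_simps edge_def)
  then have xy: "edge x y = edge (last ws) (hd ws)"
    using assms by (auto simp: edge_def fun_eq_iff)
  have "linked (round_trip ws) u v \<longleftrightarrow> (C u v \<and> u \<noteq> p \<and> v \<noteq> p) \<or> edge x y u v" for u v
    using ws nl hl by (auto simp: xy round_trip_def linked_simps edge_def)
  moreover have "length ws \<ge> 3" using ws assms(5) distinct_card[of "p # ws"] by simp
  ultimately show ?thesis
    unfolding cyc_def using ws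
    by (intro exI[of _ ws]) (auto simp: fun_eq_iff)
qed

text \<open>The path is threaded in from \<open>x\<close>: each new vertex subdivides the edge that
  still leads directly to \<open>y\<close>.\<close>

lemma cyc_insert_path:
  assumes "cyc U C" "C x y" "distinct ps" "set ps \<inter> U = {}"
  shows "cyc (U \<union> set ps)
    (\<lambda>u v. (C u v \<and> \<not> edge x y u v) \<or> linked (set (steps (x # ps @ [y]))) u v)"
  using assms
proof (induction ps arbitrary: U C x)
  case Nil
  then have "(\<lambda>u v. (C u v \<and> \<not> edge x y u v) \<or> edge x y u v) = C"
    using cyc_sym[OF Nil(1)] by (auto simp: fun_eq_iff edge_def)
  then show ?case using Nil by (simp add: linked_simps)
next
  case (Cons p ps)
  let ?C = "\<lambda>u v. (C u v \<and> \<not> edge x y u v) \<or> edge x p u v \<or> edge p y u v"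
  have "cyc (insert p U) ?C" using Cons cyc_insert by auto
  then have "cyc (insert p U \<union> set ps)
      (\<lambda>u v. (?C u v \<and> \<not> edge p y u v) \<or> linked (set (steps (p # ps @ [y]))) u v)"
    by (rule Cons.IH) (use Cons in \<open>auto simp: edge_def\<close>)
  \<comment> \<open>The edge \<open>p y\<close> is temporary. No edge of \<open>C\<close> touches
    \<open>p\<close>, and \<open>x p\<close> differs from \<open>p y\<close>, so discarding
    \<open>p y\<close> again discards nothing else.\<close>
  moreover have "(\<lambda>u v. (?C u v \<and> \<not> edge p y u v) \<or> linked (set (steps (p # ps @ [y]))) u v) =
      (\<lambda>u v. (C u v \<and> \<not> edge x y u v) \<or> linked (set (steps (x # (p # ps) @ [y]))) u v)"
  proof -
    have "C u v \<Longrightarrow> \<not> edge p y u v" for u v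
      using cyc_mem[OF Cons(2)] Cons by (fastforce simp: edge_def)
    moreover have "edge x p u v \<Longrightarrow> \<not> edge p y u v" for u v
      using Cons cyc_degree[OF Cons(2)] cyc_mem[OF Cons(2,3)]
      by (auto simp: edge_def) (metis)+
    ultimately show ?thesis
      by (auto simp: fun_eq_iff linked_simps)
  qed
  ultimately show ?case by simp
qed

text \<open>Removing the first inner vertex makes \<open>x\<close> adjacent to the next one, so the
  shorter path satisfies the same hypotheses. The bound leaves at least three vertices after the
  last removal.\<close>

lemma cyc_splice_path:
  assumes "cyc U C" "successively C (x # ps @ [y])" "distinct (x # ps @ [y])"
    "length ps + 3 \<le> card U"
  shows "cyc (U - set ps)
    (\<lambda>u v. (C u v \<and> u \<notin> set ps \<and> v \<notin> set ps) \<or> edge x y u v)"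
  using assms
proof (induction ps arbitrary: U C)
  case Nil
  then have "(\<lambda>u v. C u v \<or> edge x y u v) = C"
    using cyc_sym[OF Nil(1)] by (auto simp: fun_eq_iff edge_def)
  then show ?case using Nil by simp
next
  case (Cons p ps)
  let ?z = "hd (ps @ [y])"
  let ?C = "\<lambda>u v. (C u v \<and> u \<noteq> p \<and> v \<noteq> p) \<or> edge x ?z u v"
  have pU: "C p x" "C p ?z" "p \<in> U" "x \<noteq> ?z"
    using Cons.prems cyc_sym[OF Cons.prems(1)] cyc_mem[OF Cons.prems(1)]
    by (cases ps; auto)+
  have fin: "finite U" using cyc_card Cons by blast
  have "cyc (U - {p}) ?C"
    using cyc_splice[OF Cons.prems(1) pU(1,2,4)] Cons.prems by simp
  moreover have "successively C (p # ps @ [y])" using Cons.prems by simp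
  then have "successively C (ps @ [y])" by (cases ps) auto
  then have "successively ?C (ps @ [y])"
    by (rule successively_mono) (use Cons.prems in auto)
  then have "successively ?C (x # ps @ [y])"
    by (cases ps) (auto simp: edge_def)
  ultimately have "cyc (U - {p} - set ps)
      (\<lambda>u v. (?C u v \<and> u \<notin> set ps \<and> v \<notin> set ps) \<or> edge x y u v)"
    by (rule Cons.IH) (use Cons.prems pU fin in auto)
  moreover have "(\<lambda>u v. (?C u v \<and> u \<notin> set ps \<and> v \<notin> set ps) \<or> edge x y u v) =
      (\<lambda>u v. (C u v \<and> u \<notin> set (p # ps) \<and> v \<notin> set (p # ps)) \<or> edge x y u v)"
    by (cases ps) (auto simp: fun_eq_iff edge_def)
  moreover have "U - {p} - set ps = U - set (p # ps)" by auto
  ultimately show ?case by simp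
qed

section \<open>Comparison with Hamiltonian cycles given by indices\<close>

lemma hamiltonian_iff_cyc:
  assumes "\<And>u v. E u v \<Longrightarrow> E v u"
  shows "hamiltonian U E \<longleftrightarrow> (\<exists>C. cyc U C \<and> (\<forall>u v. C u v \<longrightarrow> E u v))"
proof -
  have rt: "(\<forall>i<length zs. E (zs ! i) (zs ! ((i + 1) mod length zs))) \<longleftrightarrow>
      (\<forall>u v. linked (round_trip zs) u v \<longrightarrow> E u v)" (is "?L \<longleftrightarrow> ?R") if "zs \<noteq> []" for zs
  proof -
    have "steps zs = zip zs (tl zs)"
      by (induction zs rule: steps.induct) auto
    then have st: "set (steps zs) = {(zs ! i, zs ! Suc i) | i. Suc i < length zs}"
      by (auto simp: set_zip nth_tl)
    have "?R \<longleftrightarrow> (\<forall>(u, v) \<in> round_trip zs. E u v)"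
      using assms by (auto simp: linked_def)
    also have "\<dots> \<longleftrightarrow> E (zs ! (length zs - 1)) (zs ! 0) \<and>
        (\<forall>i. Suc i < length zs \<longrightarrow> E (zs ! i) (zs ! Suc i))"
      using that by (auto simp: round_trip_def st last_conv_nth hd_conv_nth)
    also have "\<dots> \<longleftrightarrow> ?L"
    proof
      assume a: "E (zs ! (length zs - 1)) (zs ! 0) \<and>
        (\<forall>i. Suc i < length zs \<longrightarrow> E (zs ! i) (zs ! Suc i))"
      show ?L
      proof (intro allI impI)
        fix i assume "i < length zs"
        then consider "Suc i < length zs" | "i = length zs - 1" by linarith
        then show "E (zs ! i) (zs ! ((i + 1) mod length zs))"
          using a that by cases auto
      qed
    next
      assume l: ?L
      have "E (zs ! (length zs - 1)) (zs ! 0)"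
        using l[rule_format, of "length zs - 1"] that by simp
      moreover have "E (zs ! i) (zs ! Suc i)" if "Suc i < length zs" for i
        using l[rule_format, of i] that by simp
      ultimately show "E (zs ! (length zs - 1)) (zs ! 0) \<and>
        (\<forall>i. Suc i < length zs \<longrightarrow> E (zs ! i) (zs ! Suc i))" by blast
    qed
    finally show ?thesis ..
  qed
  have "ham_cycle U E zs \<longleftrightarrow> distinct zs \<and> set zs = U \<and> 3 \<le> length zs \<and>
      (\<forall>u v. linked (round_trip zs) u v \<longrightarrow> E u v)" for zs
    unfolding ham_cycle_def using rt[of zs] by (cases "zs = []") auto
  then show ?thesis
    unfolding hamiltonian_def cyc_def by blast
qed

section \<open>Lengthening a ladder\<close>

text \<open>The relation \<open>R\<close> lacks the rails \<open>ac\<close>, \<open>bd\<close> of the quadrilateral with rungs \<open>ab\<close>, \<open>cd\<close>. The cycles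
  through its diagonals \<open>bc\<close>, \<open>ad\<close> in the last two conjuncts turn into the Hamiltonian cycles that miss
  one of the four vertices added by the next extension.\<close>

definition extensible ::
  "nat set \<Rightarrow> (nat \<Rightarrow> nat \<Rightarrow> bool) \<Rightarrow> nat \<Rightarrow> nat \<Rightarrow> nat \<Rightarrow> nat \<Rightarrow> nat \<Rightarrow> bool" where
  "extensible V R a b c d w \<longleftrightarrow>
     finite V \<and> 5 \<le> card V \<and> {a, b, c, d, w} \<subseteq> V \<and> distinct [a, b, c, d, w] \<and>
     (\<forall>u v. R u v \<longrightarrow> u \<in> V \<and> v \<in> V) \<and> R a b \<and> R c d \<and> R b a \<and> R d c \<and>
     \<not> (\<exists>C. cyc V C \<and> (\<forall>u v. C u v \<longrightarrow> R u v \<or> edge a c u v \<or> edge b d u v)) \<and>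
     \<not> (\<exists>C. cyc (V - {w}) C \<and> (\<forall>u v. C u v \<longrightarrow> R u v \<or> edge a c u v \<or> edge b d u v)) \<and>
     (\<forall>x\<in>V. x \<noteq> w \<longrightarrow> (\<exists>C. cyc (V - {x}) C \<and>
        (\<forall>u v. C u v \<longrightarrow> R u v \<or> edge a c u v \<or> edge b d u v) \<and>
        (C a c \<or> C b d \<or> C a b \<or> C c d))) \<and>
     (\<exists>C. cyc V C \<and> (\<forall>u v. C u v \<longrightarrow> R u v \<or> edge b c u v) \<and> C b c) \<and>
     (\<exists>C. cyc V C \<and> (\<forall>u v. C u v \<longrightarrow> R u v \<or> edge a d u v) \<and> C a d)"

text \<open>Vertices added by a ladder extension are cubic, so a cycle through one omits exactly one
  of its three edges. The equalities among \<open>x\<close>, \<open>y\<close>, \<open>t\<close>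
  absorb coincidences in place of a distinctness hypothesis.\<close>

lemma cyc_degree_3:
  assumes "cyc U C" "p \<in> U" "\<And>z. C p z \<Longrightarrow> z = x \<or> z = y \<or> z = t"
  shows "C p x \<and> C p y \<and> \<not> C p t \<or> C p x \<and> \<not> C p y \<and> C p t \<or> \<not> C p x \<and> C p y \<and> C p t
    \<or> x = y \<or> x = t \<or> y = t"
proof -
  obtain g h where "g \<noteq> h" "g \<noteq> p" "h \<noteq> p" "\<And>z. C p z \<longleftrightarrow> z = g \<or> z = h"
    using cyc_degree[OF assms(1,2)] by metis
  then show ?thesis using assms(3) by metis
qed

text \<open>A 4-cycle inside a cycle is the whole cycle, which has too many vertices here. Formally:
  after \<open>q\<close> and \<open>s\<close> are spliced out, \<open>p\<close> would have
  \<open>r\<close> as its only neighbour.\<close>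

lemma cyc_no_square:
  assumes "cyc U C" "5 \<le> card U" "C p q" "C q s" "C s r" "C r p" "distinct [p, q, r, s]"
  shows False
proof -
  have sym: "C u v = C v u" for u v using cyc_sym[OF assms(1)] .
  have "cyc (U - set [q, s]) (\<lambda>u v. (C u v \<and> u \<notin> set [q, s] \<and> v \<notin> set [q, s]) \<or> edge p r u v)"
    by (rule cyc_splice_path[OF assms(1)]) (use assms in auto)
  then obtain g h where gh: "g \<noteq> h"
    "\<And>z. (C p z \<and> p \<notin> set [q, s] \<and> z \<notin> set [q, s]) \<or> edge p r p z \<longleftrightarrow> z = g \<or> z = h"
    by (rule cyc_degree[of _ _ p]) (use assms cyc_mem in auto)
  obtain g' h' where g': "\<And>z. C p z \<longleftrightarrow> z = g' \<or> z = h'"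
    using cyc_degree[OF assms(1), of p] cyc_mem[OF assms(1,3)] by metis
  have "C p r" using assms(6) sym by blast
  then have "C p z \<longleftrightarrow> z = q \<or> z = r" for z
    using g' assms(3,7) by (metis distinct_length_2_or_more)
  then have "(C p z \<and> p \<notin> set [q, s] \<and> z \<notin> set [q, s]) \<or> edge p r p z \<longleftrightarrow> z = r" for z
    using assms(7) by (auto simp: edge_def)
  then have "z = g \<or> z = h \<longleftrightarrow> z = r" for z using gh(2) by blast
  then show False using gh(1) by metis
qed

text \<open>The new rails run a-p-r-c and b-q-s-d, with new rungs pq and rs. Each passage of the
  cycle through \<open>p\<close>, \<open>q\<close>, \<open>r\<close>, \<open>s\<close> enters and
  leaves at two of the outer vertices, and these are always joined by a side of the old
  quadrilateral, never by a diagonal.\<close>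

lemma ladder_contract:
  fixes R :: "nat \<Rightarrow> nat \<Rightarrow> bool"
  assumes C: "cyc (U \<union> {p, q, r, s}) C"
    and CE: "\<And>u v. C u v \<Longrightarrow> R u v \<or> edge a p u v \<or> edge b q u v \<or> edge p q u v \<or>
      edge p r u v \<or> edge q s u v \<or> edge r s u v \<or> edge r c u v \<or> edge s d u v"
    and RV: "\<And>u v. R u v \<Longrightarrow> u \<notin> {p, q, r, s} \<and> v \<notin> {p, q, r, s}"
    and rung: "R a b" "R b a" "R c d" "R d c"
    and U: "finite U" "3 \<le> card U" "U \<inter> {p, q, r, s} = {}"
    and dist: "distinct [a, b, c, d, p, q, r, s]"
  shows "\<exists>C'. cyc U C' \<and> (\<forall>u v. C' u v \<longrightarrow> R u v \<or> edge a c u v \<or> edge b d u v)"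
proof -
  let ?E = "\<lambda>u v. R u v \<or> edge a c u v \<or> edge b d u v"
  have sym: "C u v = C v u" for u v using cyc_sym[OF C] .
  have card: "card (U \<union> {p, q, r, s}) = card U + 4"
    using U dist by (subst card_Un_disjoint) auto
  have nb: "C p z \<Longrightarrow> z = a \<or> z = q \<or> z = r" "C q z \<Longrightarrow> z = b \<or> z = p \<or> z = s"
    "C r z \<Longrightarrow> z = c \<or> z = s \<or> z = p" "C s z \<Longrightarrow> z = d \<or> z = r \<or> z = q" for z
    subgoal using CE[of p z] RV[of p z] dist by (auto simp: edge_def)
    subgoal using CE[of q z] RV[of q z] dist by (auto simp: edge_def)
    subgoal using CE[of r z] RV[of r z] dist by (auto simp: edge_def)
    subgoal using CE[of s z] RV[of s z] dist by (auto simp: edge_def)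
    done
  have D: "C p a \<and> C p q \<and> \<not> C p r \<or> C p a \<and> \<not> C p q \<and> C p r \<or> \<not> C p a \<and> C p q \<and> C p r"
    "C q b \<and> C q p \<and> \<not> C q s \<or> C q b \<and> \<not> C q p \<and> C q s \<or> \<not> C q b \<and> C q p \<and> C q s"
    "C r c \<and> C r s \<and> \<not> C r p \<or> C r c \<and> \<not> C r s \<and> C r p \<or> \<not> C r c \<and> C r s \<and> C r p"
    "C s d \<and> C s r \<and> \<not> C s q \<or> C s d \<and> \<not> C s r \<and> C s q \<or> \<not> C s d \<and> C s r \<and> C s q"
    subgoal using cyc_degree_3[OF C, of p a q r, OF _ nb(1)] dist by auto
    subgoal using cyc_degree_3[OF C, of q b p s, OF _ nb(2)] dist by auto
    subgoal using cyc_degree_3[OF C, of r c s p, OF _ nb(3)] dist by auto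
    subgoal using cyc_degree_3[OF C, of s d r q, OF _ nb(4)] dist by auto
    done
  have nsq: "\<not> (C p q \<and> C q s \<and> C s r \<and> C r p)"
    using cyc_no_square[OF C, of p q s r] U dist card by auto
  have rest: "C u v \<Longrightarrow> u \<notin> {p, q, r, s} \<Longrightarrow> v \<notin> {p, q, r, s} \<Longrightarrow> R u v" for u v
    using CE[of u v] by (auto simp: edge_def)
  have one: ?thesis
    if "successively C (x # ps @ [y])" "set ps = {p, q, r, s}" "length ps = 4" "distinct ps"
      "x \<notin> {p, q, r, s}" "y \<notin> {p, q, r, s}" "x \<noteq> y" "?E x y" "?E y x" for x y ps
  proof -
    note xy = that(8,9) and ps = that(2)
    have "U \<union> {p, q, r, s} - set ps = U" using U(3) that(2) by auto
    moreover have "distinct (x # ps @ [y])" using that(2,4-7) by auto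
    then have "cyc (U \<union> {p, q, r, s} - set ps)
        (\<lambda>u v. (C u v \<and> u \<notin> set ps \<and> v \<notin> set ps) \<or> edge x y u v)"
      using cyc_splice_path[OF C that(1)] card U(2) that(3) by simp
    ultimately have "cyc U (\<lambda>u v. (C u v \<and> u \<notin> set ps \<and> v \<notin> set ps) \<or> edge x y u v)" by simp
    moreover have "?E u v" if "(C u v \<and> u \<notin> set ps \<and> v \<notin> set ps) \<or> edge x y u v" for u v
      using that
    proof
      assume "edge x y u v"
      then show ?thesis using xy unfolding edge_def[of x y] by blast
    qed (use rest ps in blast)
    ultimately show ?thesis by blast
  qed
  have two: ?thesis
    if "successively C (x # ps @ [y])" "successively C (x' # ps' @ [y'])"
      "set (ps @ ps') = {p, q, r, s}" "length ps = 2" "length ps' = 2" "distinct (ps @ ps')"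
      "{x, y, x', y'} \<inter> {p, q, r, s} = {}" "x \<noteq> y" "x' \<noteq> y'"
      "?E x y" "?E y x" "?E x' y'" "?E y' x'" for x y x' y' ps ps'
  proof -
    note xy = that(10-13) and ps = that(3)
    let ?C = "\<lambda>u v. (C u v \<and> u \<notin> set ps \<and> v \<notin> set ps) \<or> edge x y u v"
    have s: "U \<union> {p, q, r, s} - set ps - set ps' = U" using U(3) that(3) by auto
    have d: "distinct (x # ps @ [y])" "distinct (x' # ps' @ [y'])"
      using that(3,6-9) by auto
    have 1: "cyc (U \<union> {p, q, r, s} - set ps) ?C"
      using cyc_splice_path[OF C that(1) d(1)] card U(2) that(4) by simp
    have "set ps \<subseteq> U \<union> {p, q, r, s}" "card (set ps) = 2"
      using that(3,4,6) by (auto simp: distinct_card)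
    then have "card (U \<union> {p, q, r, s} - set ps) = card U + 2"
      using card by (simp add: card_Diff_subset)
    moreover have "set (x' # ps' @ [y']) \<inter> set ps = {}" using that(3,6,7) by auto
    then have "successively ?C (x' # ps' @ [y'])"
      by (intro successively_mono[OF that(2)]) blast
    ultimately have "cyc (U \<union> {p, q, r, s} - set ps - set ps')
        (\<lambda>u v. (?C u v \<and> u \<notin> set ps' \<and> v \<notin> set ps') \<or> edge x' y' u v)"
      using cyc_splice_path[OF 1 _ d(2)] U(2) that(5) by simp
    then have "cyc U (\<lambda>u v. (?C u v \<and> u \<notin> set ps' \<and> v \<notin> set ps') \<or> edge x' y' u v)"
      by (simp only: s)
    moreover have "?E u v"
      if a: "(?C u v \<and> u \<notin> set ps' \<and> v \<notin> set ps') \<or> edge x' y' u v" for u v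
    proof -
      consider "C u v" "u \<notin> set (ps @ ps')" "v \<notin> set (ps @ ps')" | "edge x y u v" | "edge x' y' u v"
        using a by auto
      then show "?E u v"
      proof cases
        case 1
        then show ?thesis using rest unfolding ps by blast
      next
        case 2
        then show ?thesis using xy unfolding edge_def[of x y] by blast
      next
        case 3
        then show ?thesis using xy unfolding edge_def[of x' y'] by blast
      qed
    qed
    ultimately show ?thesis by blast
  qed
  have S: "C q p = C p q" "C s r = C r s" "C r p = C p r" "C s q = C q s"
    "C a p = C p a" "C b q = C q b" "C c r = C r c" "C d s = C s d"
    using sym by blast+
  \<comment> \<open>Each corner of the square pqsr omits at most one of its two sides in the square,
    and not all four sides are used. The used sides therefore form either three of the four (one
    passage through all new vertices) or an opposite pair (two passages).\<close>
  consider "C p q" "C r s" "C p r" "\<not> C q s" | "C p q" "C r s" "\<not> C p r" "C q s"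
    | "C p q" "C r s" "\<not> C p r" "\<not> C q s" | "C p q" "\<not> C r s" "C p r" "C q s"
    | "\<not> C p q" "C r s" "C p r" "C q s" | "\<not> C p q" "\<not> C r s" "C p r" "C q s"
    using D nsq unfolding S by blast
  then show ?thesis
  proof cases
    case 1
    then have x: "C b q" "C s d" using D unfolding S by blast+
    show ?thesis by (rule one[of b "[q, p, r, s]" d]) (use x 1 S dist in \<open>auto simp: rung edge_self\<close>)
  next
    case 2
    then have x: "C a p" "C r c" using D unfolding S by blast+
    show ?thesis by (rule one[of a "[p, q, s, r]" c]) (use x 2 S dist in \<open>auto simp: rung edge_self\<close>)
  next
    case 3
    then have x: "C a p" "C q b" "C c r" "C s d" using D unfolding S by blast+
    show ?thesis by (rule two[of a "[p, q]" b c "[r, s]" d]) (use x 3 S dist in \<open>auto simp: rung edge_self\<close>)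
  next
    case 4
    then have x: "C c r" "C s d" using D unfolding S by blast+
    show ?thesis by (rule one[of c "[r, p, q, s]" d]) (use x 4 S dist in \<open>auto simp: rung edge_self\<close>)
  next
    case 5
    then have x: "C a p" "C q b" using D unfolding S by blast+
    show ?thesis by (rule one[of a "[p, r, s, q]" b]) (use x 5 S dist in \<open>auto simp: rung edge_self\<close>)
  next
    case 6
    then have x: "C a p" "C r c" "C b q" "C s d" using D unfolding S by blast+
    show ?thesis by (rule two[of a "[p, r]" c b "[q, s]" d]) (use x 6 S dist in \<open>auto simp: rung edge_self\<close>)
  qed
qed

text \<open>The rails ac and bd no longer exist, so every rail in use must be rerouted: both in
  parallel if both are used, otherwise one detour through all four new vertices. If neither rail is
  used, a rung takes the detour. Each detour uses a side of the new quadrilateral r, s, c, d, so the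
  extension can be repeated.\<close>

lemma ladder_expand:
  fixes R :: "nat \<Rightarrow> nat \<Rightarrow> bool"
  assumes C: "cyc U C"
    and CE: "\<And>u v. C u v \<Longrightarrow> R u v \<or> edge a c u v \<or> edge b d u v"
    and use: "C a c \<or> C b d \<or> C a b \<or> C c d"
    and U: "U \<inter> {p, q, r, s} = {}"
    and dist: "distinct [a, b, c, d, p, q, r, s]"
  shows "\<exists>C'. cyc (U \<union> {p, q, r, s}) C' \<and>
      (\<forall>u v. C' u v \<longrightarrow> R u v \<or> edge a p u v \<or> edge b q u v \<or> edge p q u v \<or>
        edge p r u v \<or> edge q s u v \<or> edge r s u v \<or> edge r c u v \<or> edge s d u v) \<and>
      (C' r c \<or> C' s d \<or> C' r s \<or> C' c d)"
proof -
  have one: "cyc (U \<union> {p, q, r, s})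
      (\<lambda>u v. (C u v \<and> \<not> edge x y u v) \<or> linked (set (steps (x # ps @ [y]))) u v)"
    if "C x y" "set ps = {p, q, r, s}" "distinct ps" for x y ps
    using cyc_insert_path[OF C that(1,3)] U that by auto
  have o: "edge s r = edge r s" "edge q p = edge p q" "edge s q = edge q s" "edge r p = edge p r"
    "edge q b = edge b q" "edge c r = edge r c" "edge p a = edge a p" "edge d s = edge s d"
    by (auto simp: edge_def fun_eq_iff)
  have CR: "C u v \<Longrightarrow> \<not> edge a c u v \<Longrightarrow> \<not> edge b d u v \<Longrightarrow> R u v" for u v
    using CE by blast
  have nac: "\<not> C a c \<Longrightarrow> C u v \<Longrightarrow> \<not> edge a c u v" for u v
    using cyc_sym[OF C, of a c] by (auto simp: edge_def)
  have nbd: "\<not> C b d \<Longrightarrow> C u v \<Longrightarrow> \<not> edge b d u v" for u v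
    using cyc_sym[OF C, of b d] by (auto simp: edge_def)
  consider "C a c" "C b d" | "C a c" "\<not> C b d" | "\<not> C a c" "C b d"
    | "\<not> C a c" "\<not> C b d" "C a b" | "\<not> C a c" "\<not> C b d" "C c d"
    using use by blast
  then show ?thesis
  proof cases
    case 1
    let ?C = "\<lambda>u v. (C u v \<and> \<not> edge a c u v) \<or> linked (set (steps (a # [p, r] @ [c]))) u v"
    have 2: "cyc (U \<union> set [p, r]) ?C"
      using cyc_insert_path[OF C 1(1), of "[p, r]"] U dist by auto
    have "?C b d" using 1 dist by (auto simp: edge_def)
    then have "cyc (U \<union> set [p, r] \<union> set [q, s])
        (\<lambda>u v. (?C u v \<and> \<not> edge b d u v) \<or> linked (set (steps (b # [q, s] @ [d]))) u v)"
      using cyc_insert_path[OF 2, of b d "[q, s]"] U dist by auto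
    moreover have "U \<union> set [p, r] \<union> set [q, s] = U \<union> {p, q, r, s}" by auto
    ultimately show ?thesis
      by (intro exI[of _ "\<lambda>u v. (?C u v \<and> \<not> edge b d u v) \<or>
          linked (set (steps (b # [q, s] @ [d]))) u v"])
        (auto simp: linked_simps edge_self intro: CR)
  next
    case 2
    have "cyc (U \<union> {p, q, r, s})
      (\<lambda>u v. (C u v \<and> \<not> edge a c u v) \<or> linked (set (steps (a # [p, q, s, r] @ [c]))) u v)"
      by (rule one) (use 2 dist in auto)
    note h = this
    show ?thesis
      by (intro exI conjI, rule h)
        (use nac nbd 2(1,2) in \<open>auto simp: linked_simps o edge_self intro: CR\<close>)
  next
    case 3
    have "cyc (U \<union> {p, q, r, s})
      (\<lambda>u v. (C u v \<and> \<not> edge b d u v) \<or> linked (set (steps (b # [q, p, r, s] @ [d]))) u v)"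
      by (rule one) (use 3 dist in auto)
    note h = this
    show ?thesis
      by (intro exI conjI, rule h)
        (use nac nbd 3(1,2) in \<open>auto simp: linked_simps o edge_self intro: CR\<close>)
  next
    case 4
    have "cyc (U \<union> {p, q, r, s})
      (\<lambda>u v. (C u v \<and> \<not> edge a b u v) \<or> linked (set (steps (a # [p, r, s, q] @ [b]))) u v)"
      by (rule one) (use 4 dist in auto)
    note h = this
    show ?thesis
      by (intro exI conjI, rule h)
        (use nac nbd 4(1,2) in \<open>auto simp: linked_simps o edge_self intro: CR\<close>)
  next
    case 5
    have "cyc (U \<union> {p, q, r, s})
      (\<lambda>u v. (C u v \<and> \<not> edge c d u v) \<or> linked (set (steps (c # [r, p, q, s] @ [d]))) u v)"
      by (rule one) (use 5 dist in auto)
    note h = this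
    show ?thesis
      by (intro exI conjI, rule h)
        (use nac nbd 5(1,2) in \<open>auto simp: linked_simps o edge_self intro: CR\<close>)
  qed
qed

text \<open>The two non-hamiltonicity clauses are inherited by contraction, the deletion clause for
  old vertices by expansion. The diagonal cycles serve the new vertices and also reproduce
  themselves for the next quadrilateral, which is what closes the induction.\<close>

lemma extensible_step:
  assumes ext: "extensible V R a b c d w"
    and new: "{p, q, r, s} \<inter> V = {}" "distinct [p, q, r, s]"
    and R': "\<And>u v. R' u v \<longleftrightarrow> R u v \<or> edge a p u v \<or> edge b q u v \<or> edge p q u v \<or>
        edge p r u v \<or> edge q s u v \<or> edge r s u v"
  shows "extensible (V \<union> {p, q, r, s}) R' r s c d w"
proof -
  have b: "finite V" "5 \<le> card V" "{a, b, c, d, w} \<subseteq> V" "distinct [a, b, c, d, w]"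
    "R a b" "R c d" "R b a" "R d c" and RV: "\<And>u v. R u v \<Longrightarrow> u \<in> V \<and> v \<in> V"
    and nh: "\<And>C. cyc V C \<Longrightarrow> (\<And>u v. C u v \<Longrightarrow> R u v \<or> edge a c u v \<or> edge b d u v) \<Longrightarrow> False"
      "\<And>C. cyc (V - {w}) C \<Longrightarrow> (\<And>u v. C u v \<Longrightarrow> R u v \<or> edge a c u v \<or> edge b d u v) \<Longrightarrow> False"
    and del: "\<And>x. x \<in> V \<Longrightarrow> x \<noteq> w \<Longrightarrow> \<exists>C. cyc (V - {x}) C \<and>
        (\<forall>u v. C u v \<longrightarrow> R u v \<or> edge a c u v \<or> edge b d u v) \<and> (C a c \<or> C b d \<or> C a b \<or> C c d)"
    using ext unfolding extensible_def by blast+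
  obtain C1 where C1: "cyc V C1" "\<And>u v. C1 u v \<Longrightarrow> R u v \<or> edge b c u v" "C1 b c"
    using ext unfolding extensible_def by blast
  obtain C2 where C2: "cyc V C2" "\<And>u v. C2 u v \<Longrightarrow> R u v \<or> edge a d u v" "C2 a d"
    using ext unfolding extensible_def by blast
  have dist: "distinct [a, b, c, d, p, q, r, s]" "w \<notin> {p, q, r, s}" using b new by auto
  have E': "R' u v \<or> edge r c u v \<or> edge s d u v \<longleftrightarrow>
      R u v \<or> edge a p u v \<or> edge b q u v \<or> edge p q u v \<or>
      edge p r u v \<or> edge q s u v \<or> edge r s u v \<or> edge r c u v \<or> edge s d u v" for u v
    using R' by blast
  have Rn: "R u v \<Longrightarrow> u \<notin> {p, q, r, s} \<and> v \<notin> {p, q, r, s}" for u v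
    using RV new by blast
  \<comment> \<open>Stated for subsets of \<open>V\<close> because it is applied both to
    \<open>V\<close> and to \<open>V - {w}\<close>.\<close>
  have contract: "\<exists>C'. cyc U C' \<and> (\<forall>u v. C' u v \<longrightarrow> R u v \<or> edge a c u v \<or> edge b d u v)"
    if "cyc (U \<union> {p, q, r, s}) C" "\<And>u v. C u v \<Longrightarrow> R' u v \<or> edge r c u v \<or> edge s d u v"
      "U \<subseteq> V" "3 \<le> card U" for U C
  proof (rule ladder_contract[OF that(1) _ Rn b(5,7,6,8) _ that(4) _ dist(1)])
    show "finite U" using that(3) b(1) finite_subset by blast
    show "U \<inter> {p, q, r, s} = {}" using that(3) new(1) by blast
  qed (use that(2) in \<open>simp only: E'\<close>)
  have nh1: False if C: "cyc (V \<union> {p, q, r, s}) C"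
    "\<And>u v. C u v \<Longrightarrow> R' u v \<or> edge r c u v \<or> edge s d u v" for C
  proof -
    obtain C' where "cyc V C'" "\<forall>u v. C' u v \<longrightarrow> R u v \<or> edge a c u v \<or> edge b d u v"
      using contract[OF C order_refl] b(2) by auto
    then show False using nh(1) by blast
  qed
  have nh2: False if C: "cyc (V \<union> {p, q, r, s} - {w}) C"
    "\<And>u v. C u v \<Longrightarrow> R' u v \<or> edge r c u v \<or> edge s d u v" for C
  proof -
    have "V \<union> {p, q, r, s} - {w} = (V - {w}) \<union> {p, q, r, s}" using dist by auto
    then have "cyc ((V - {w}) \<union> {p, q, r, s}) C" using C by simp
    from contract[OF this C(2)] obtain C' where "cyc (V - {w}) C'"
      "\<forall>u v. C' u v \<longrightarrow> R u v \<or> edge a c u v \<or> edge b d u v"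
      using b(1-3) by force
    then show False using nh(2) by blast
  qed
  have nh': "\<not> (\<exists>C. cyc (V \<union> {p, q, r, s}) C \<and> (\<forall>u v. C u v \<longrightarrow> R' u v \<or> edge r c u v \<or> edge s d u v))"
    "\<not> (\<exists>C. cyc (V \<union> {p, q, r, s} - {w}) C \<and> (\<forall>u v. C u v \<longrightarrow> R' u v \<or> edge r c u v \<or> edge s d u v))"
    using nh1 nh2 by blast+
  have o: "edge s r = edge r s" "edge q p = edge p q" "edge s q = edge q s"
    "edge q b = edge b q" "edge r p = edge p r"
    by (auto simp: edge_def fun_eq_iff)
  have CR: "C1 u v \<Longrightarrow> \<not> edge b c u v \<Longrightarrow> R u v" "C2 u v \<Longrightarrow> \<not> edge a d u v \<Longrightarrow> R u v" for u v
    using C1(2) C2(2) by blast+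
  let ?D1 = "\<lambda>ps u v. (C1 u v \<and> \<not> edge b c u v) \<or> linked (set (steps (b # ps @ [c]))) u v"
  let ?D2 = "\<lambda>ps u v. (C2 u v \<and> \<not> edge a d u v) \<or> linked (set (steps (a # ps @ [d]))) u v"
  have D1: "cyc (V \<union> set ps) (?D1 ps)" if "set ps \<subseteq> {p, q, r, s}" "distinct ps" for ps
    using cyc_insert_path[OF C1(1,3) that(2)] new that by auto
  have D2: "cyc (V \<union> set ps) (?D2 ps)" if "set ps \<subseteq> {p, q, r, s}" "distinct ps" for ps
    using cyc_insert_path[OF C2(1,3) that(2)] new that by auto
  have del': "\<exists>C. cyc (V \<union> {p, q, r, s} - {x}) C \<and>
      (\<forall>u v. C u v \<longrightarrow> R' u v \<or> edge r c u v \<or> edge s d u v) \<and> (C r c \<or> C s d \<or> C r s \<or> C c d)"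
    if x: "x \<in> V \<union> {p, q, r, s}" "x \<noteq> w" for x
  proof -
    \<comment> \<open>For a new vertex, a fictitious diagonal of the old quadrilateral is replaced
      by a path through the other three: b-q-s-r-c and b-q-p-r-c avoid \<open>p\<close> and
      \<open>s\<close>, while a-p-r-s-d and a-p-q-s-d avoid \<open>q\<close> and
      \<open>r\<close>.\<close>
    consider "x \<in> V" | "x = p" | "x = q" | "x = r" | "x = s" using x by blast
    then show ?thesis
    proof cases
      case 1
      then obtain C where C: "cyc (V - {x}) C"
        "\<And>u v. C u v \<Longrightarrow> R u v \<or> edge a c u v \<or> edge b d u v" "C a c \<or> C b d \<or> C a b \<or> C c d"
        using del x by blast
      have eq: "(V - {x}) \<union> {p, q, r, s} = V \<union> {p, q, r, s} - {x}" using 1 new(1) by auto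
      have "(V - {x}) \<inter> {p, q, r, s} = {}" using new(1) by auto
      from ladder_expand[OF C this dist(1)] show ?thesis unfolding eq E' .
    next
      case 2
      have "cyc (V \<union> set [q, s, r]) (?D1 [q, s, r])" by (rule D1) (use new(2) in auto)
      moreover have "V \<union> set [q, s, r] = V \<union> {p, q, r, s} - {x}" using 2 new by auto
      ultimately show ?thesis
        unfolding E' by (intro exI[of _ "?D1 [q, s, r]"]) (auto simp: linked_simps o edge_self intro: CR)
    next
      case 3
      have "cyc (V \<union> set [p, r, s]) (?D2 [p, r, s])" by (rule D2) (use new(2) in auto)
      moreover have "V \<union> set [p, r, s] = V \<union> {p, q, r, s} - {x}" using 3 new by auto
      ultimately show ?thesis
        unfolding E' by (intro exI[of _ "?D2 [p, r, s]"]) (auto simp: linked_simps o edge_self intro: CR)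
    next
      case 4
      have "cyc (V \<union> set [p, q, s]) (?D2 [p, q, s])" by (rule D2) (use new(2) in auto)
      moreover have "V \<union> set [p, q, s] = V \<union> {p, q, r, s} - {x}" using 4 new by auto
      ultimately show ?thesis
        unfolding E' by (intro exI[of _ "?D2 [p, q, s]"]) (auto simp: linked_simps o edge_self intro: CR)
    next
      case 5
      have "cyc (V \<union> set [q, p, r]) (?D1 [q, p, r])" by (rule D1) (use new(2) in auto)
      moreover have "V \<union> set [q, p, r] = V \<union> {p, q, r, s} - {x}" using 5 new by auto
      ultimately show ?thesis
        unfolding E' by (intro exI[of _ "?D1 [q, p, r]"]) (auto simp: linked_simps o edge_self intro: CR)
    qed
  qed
  \<comment> \<open>A path through all four new vertices can finish along a diagonal of the new
    quadrilateral: b-q-p-r-s-c ends with sc, and a-p-q-s-r-d ends with rd.\<close>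
  have diag1: "\<exists>C. cyc (V \<union> {p, q, r, s}) C \<and> (\<forall>u v. C u v \<longrightarrow> R' u v \<or> edge s c u v) \<and> C s c"
  proof -
    have "cyc (V \<union> set [q, p, r, s]) (?D1 [q, p, r, s])" by (rule D1) (use new(2) in auto)
    moreover have "V \<union> set [q, p, r, s] = V \<union> {p, q, r, s}" by auto
    ultimately show ?thesis
      unfolding R' by (intro exI[of _ "?D1 [q, p, r, s]"]) (auto simp: linked_simps o edge_self intro: CR)
  qed
  have diag2: "\<exists>C. cyc (V \<union> {p, q, r, s}) C \<and> (\<forall>u v. C u v \<longrightarrow> R' u v \<or> edge r d u v) \<and> C r d"
  proof -
    have "cyc (V \<union> set [p, q, s, r]) (?D2 [p, q, s, r])" by (rule D2) (use new(2) in auto)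
    moreover have "V \<union> set [p, q, s, r] = V \<union> {p, q, r, s}" by auto
    ultimately show ?thesis
      unfolding R' by (intro exI[of _ "?D2 [p, q, s, r]"]) (auto simp: linked_simps o edge_self intro: CR)
  qed
  have "card V \<le> card (V \<union> {p, q, r, s})" using b(1) by (intro card_mono) auto
  then have "5 \<le> card (V \<union> {p, q, r, s})" using b(2) by linarith
  moreover have "\<forall>u v. R' u v \<longrightarrow> u \<in> V \<union> {p, q, r, s} \<and> v \<in> V \<union> {p, q, r, s}"
    unfolding R' using RV b(3) by (auto simp: edge_def)
  moreover have "R' r s" "R' s r" "R' c d" "R' d c"
    unfolding R' using b(6,8) by (auto simp: edge_self)
  moreover have "finite (V \<union> {p, q, r, s})" "{r, s, c, d, w} \<subseteq> V \<union> {p, q, r, s}"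
    "distinct [r, s, c, d, w]"
    using b(1,3,4) dist by auto
  moreover have "\<forall>x\<in>V \<union> {p, q, r, s}. x \<noteq> w \<longrightarrow> (\<exists>C. cyc (V \<union> {p, q, r, s} - {x}) C \<and>
      (\<forall>u v. C u v \<longrightarrow> R' u v \<or> edge r c u v \<or> edge s d u v) \<and> (C r c \<or> C s d \<or> C r s \<or> C c d))"
    using del' by blast
  ultimately show ?thesis
    unfolding extensible_def by (intro conjI nh' diag1 diag2)
qed

section \<open>A transfer-matrix test for non-hamiltonicity\<close>

text \<open>Vertices are eliminated one at a time. A state is the list of edges that the spliced cycle is
  forced to contain; eliminating \<open>p\<close> replaces its two cycle edges \<open>px\<close>, \<open>py\<close> by the forced edge \<open>xy\<close>.\<close>

definition neighbours :: "(nat \<times> nat) list \<Rightarrow> nat \<Rightarrow> nat list" where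
  "neighbours F p = map snd (filter (\<lambda>e. fst e = p) F) @ map fst (filter (\<lambda>e. snd e = p) F)"

definition avoiding :: "nat \<Rightarrow> (nat \<times> nat) list \<Rightarrow> (nat \<times> nat) list" where
  "avoiding p F = filter (\<lambda>e. fst e \<noteq> p \<and> snd e \<noteq> p) F"

text \<open>Keeping the forced edges sorted makes a state canonical, so \<open>remdups\<close>
  merges states reached in different ways.\<close>

fun insert_sorted :: "nat \<times> nat \<Rightarrow> (nat \<times> nat) list \<Rightarrow> (nat \<times> nat) list" where
  "insert_sorted e [] = [e]"
| "insert_sorted e (f # F) =
    (if fst e < fst f \<or> fst e = fst f \<and> snd e \<le> snd f then e # f # F
     else f # insert_sorted e F)"

text \<open>\<open>fs\<close> holds the forced neighbours of the eliminated vertex, all of which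
  must be ends of the new edge. A pair already joined by a forced edge is excluded: together with
  the eliminated vertex it would close a triangle prematurely.\<close>

definition joins :: "(nat \<times> nat) list \<Rightarrow> nat list \<Rightarrow> nat list \<Rightarrow> (nat \<times> nat) list list" where
  "joins G fs ns = concat (map (\<lambda>x. map (\<lambda>y. insert_sorted (x, y) G)
     (filter (\<lambda>y. y \<notin> set (neighbours G x))
       (filter (\<lambda>y. x < y \<and> list_all (\<lambda>z. z = x \<or> z = y) fs) ns))) ns)"

text \<open>An end of the new edge may carry at most one other forced edge, since vertices have
  degree 2 on a cycle.\<close>

definition free_ends :: "(nat \<times> nat) list \<Rightarrow> nat list \<Rightarrow> nat list" where
  "free_ends G xs = filter (\<lambda>x. length (remdups (neighbours G x)) \<le> 1) (remdups xs)"

definition successors :: "nat list \<Rightarrow> nat \<Rightarrow> (nat \<times> nat) list \<Rightarrow> (nat \<times> nat) list list" where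
  "successors es p F = joins (avoiding p F) (neighbours F p)
     (free_ends (avoiding p F) (neighbours F p @ es))"

text \<open>\<open>E\<close> holds the optional edges among the remaining vertices, \<open>S\<close>
  the possible sets of forced ones. On three vertices the triangle is the only candidate. Lists too
  short to carry a cycle are rejected rather than accepted.\<close>

fun no_cycle :: "(nat \<times> nat) list \<Rightarrow> nat list \<Rightarrow> (nat \<times> nat) list list \<Rightarrow> bool" where
  "no_cycle E (p # q # r # s # us) S =
     no_cycle (avoiding p E) (q # r # s # us) (remdups (concat (map (successors (neighbours E p) p) S)))"
| "no_cycle E [p, q, r] S = list_all (\<lambda>F. \<not> (q \<in> set (neighbours (F @ E) p) \<and>
     r \<in> set (neighbours (F @ E) p) \<and> r \<in> set (neighbours (F @ E) q))) S"
| "no_cycle E us S = False"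

section \<open>Soundness of vertex elimination\<close>

lemma set_insert_sorted: "set (insert_sorted e F) = insert e (set F)"
  by (induction F) auto

lemma set_neighbours: "x \<in> set (neighbours F p) \<longleftrightarrow> linked (set F) p x"
  by (force simp: neighbours_def linked_def)

lemma set_avoiding: "set (avoiding p F) = {e \<in> set F. fst e \<noteq> p \<and> snd e \<noteq> p}"
  by (auto simp: avoiding_def)

lemma linked_avoiding: "linked (set (avoiding p F)) u v \<longleftrightarrow> linked (set F) u v \<and> u \<noteq> p \<and> v \<noteq> p"
  by (auto simp: linked_def set_avoiding)

text \<open>No cycle escapes: splicing \<open>p\<close> out of a cycle compatible with
  \<open>F\<close> gives a cycle compatible with one of the successor states. Compatible means that
  it contains all forced edges and otherwise uses only edges of \<open>E\<close>.\<close>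

lemma successors_complete:
  assumes C: "cyc U C" "4 \<le> card U" and p: "p \<in> U"
    and F: "\<And>u v. linked (set F) u v \<Longrightarrow> C u v"
    and E: "\<And>u v. C u v \<Longrightarrow> linked (set F) u v \<or> linked (set E) u v"
  shows "\<exists>F'\<in>set (successors (neighbours E p) p F). \<exists>C'. cyc (U - {p}) C' \<and>
    (\<forall>u v. linked (set F') u v \<longrightarrow> C' u v) \<and>
    (\<forall>u v. C' u v \<longrightarrow> linked (set F') u v \<or> linked (set (avoiding p E)) u v)"
proof -
  obtain x y where xy: "x < y" "x \<noteq> p" "y \<noteq> p" "\<And>z. C p z \<longleftrightarrow> z = x \<or> z = y"
  proof -
    obtain x y where "x \<noteq> y" "x \<noteq> p" "y \<noteq> p" "\<And>z. C p z \<longleftrightarrow> z = x \<or> z = y"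
      using cyc_degree[OF C(1) p] by metis
    then show ?thesis using that[of x y] that[of y x] by (metis nat_neq_iff)
  qed
  have Cp: "C p x" "C p y" "C x p" "C y p" using xy cyc_sym[OF C(1)] by metis+
  let ?G = "avoiding p F"
  let ?C = "\<lambda>u v. (C u v \<and> u \<noteq> p \<and> v \<noteq> p) \<or> edge x y u v"
  have C': "cyc (U - {p}) ?C"
    using cyc_splice[OF C(1) Cp(1,2)] xy C(2) by simp
  \<comment> \<open>A cycle neighbour of \<open>p\<close> has one other cycle edge only, and forced
    edges lie on the cycle.\<close>
  have free: "length (remdups (neighbours ?G z)) \<le> 1" if zp: "C z p" for z
  proof -
    obtain g h where gh: "\<And>t. C z t \<longleftrightarrow> t = g \<or> t = h"
      using cyc_degree[OF C(1), of z] cyc_mem[OF C(1) zp] by metis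
    have "set (neighbours ?G z) \<subseteq> {g, h} - {p}"
    proof
      fix t assume "t \<in> set (neighbours ?G z)"
      then have "C z t" "t \<noteq> p" using F by (auto simp: set_neighbours linked_avoiding)
      then show "t \<in> {g, h} - {p}" using gh by blast
    qed
    moreover have "card ({g, h} - {p}) \<le> 1"
      using gh zp by (auto simp: card_insert_if)
    ultimately have "card (set (neighbours ?G z)) \<le> 1"
      by (meson card_mono finite.emptyI finite.insertI finite_Diff le_trans)
    then show ?thesis by (simp add: length_remdups_card_conv)
  qed
  \<comment> \<open>Otherwise the spliced cycle would contain \<open>x y\<close> already and
    \<open>x\<close> would be left with \<open>y\<close> as its single neighbour.\<close>
  have "\<not> C x y"
  proof
    assume "C x y"
    then have "?C x z \<longleftrightarrow> z = y" for z
    proof -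
      obtain g h where gh: "\<And>t. C x t \<longleftrightarrow> t = g \<or> t = h"
        using cyc_degree[OF C(1), of x] cyc_mem[OF C(1) Cp(1)] by metis
      then have "C x t \<longleftrightarrow> t = p \<or> t = y" for t
        using \<open>C x y\<close> Cp(3) xy(3) by metis
      then show ?thesis using xy by (auto simp: edge_def)
    qed
    moreover have "x \<in> U - {p}" using xy cyc_mem[OF C(1) Cp(1)] by simp
    ultimately show False using cyc_degree[OF C', of x] by metis
  qed
  then have "y \<notin> set (neighbours ?G x)"
    using F by (auto simp: set_neighbours linked_avoiding)
  moreover have "list_all (\<lambda>z. z = x \<or> z = y) (neighbours F p)"
  proof -
    have "z = x \<or> z = y" if "z \<in> set (neighbours F p)" for z
      using that F[of p z] xy(4)[of z] by (simp add: set_neighbours)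
    then show ?thesis by (simp add: list_all_iff)
  qed
  moreover have "x \<in> set (neighbours F p @ neighbours E p)" "y \<in> set (neighbours F p @ neighbours E p)"
    using E[OF Cp(1)] E[OF Cp(2)] by (auto simp: set_neighbours)
  ultimately have "insert_sorted (x, y) ?G \<in> set (successors (neighbours E p) p F)"
    unfolding successors_def joins_def free_ends_def using xy(1) free[OF Cp(3)] free[OF Cp(4)] by auto
  moreover have "\<forall>u v. linked (set (insert_sorted (x, y) ?G)) u v \<longrightarrow> ?C u v"
    using F by (auto simp: set_insert_sorted linked_simps linked_avoiding)
  moreover have "\<forall>u v. ?C u v \<longrightarrow>
      linked (set (insert_sorted (x, y) ?G)) u v \<or> linked (set (avoiding p E)) u v"
    using E by (auto simp: set_insert_sorted linked_simps linked_avoiding)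
  ultimately show ?thesis using C' by blast
qed

lemma no_cycle_sound:
  assumes "no_cycle E us S" "distinct us" "F \<in> set S" "cyc (set us) C"
    "\<And>u v. linked (set F) u v \<Longrightarrow> C u v"
    "\<And>u v. C u v \<Longrightarrow> linked (set F) u v \<or> linked (set E) u v"
  shows False
  using assms
proof (induction E us S arbitrary: F C rule: no_cycle.induct)
  case (1 E p q r s us S)
  let ?us = "p # q # r # s # us"
  have "card (set ?us) = length ?us" using 1(3) by (rule distinct_card)
  then have c: "4 \<le> card (set ?us)" by simp
  obtain F' C' where F': "F' \<in> set (successors (neighbours E p) p F)" "cyc (set ?us - {p}) C'"
    "\<forall>u v. linked (set F') u v \<longrightarrow> C' u v"
    "\<forall>u v. C' u v \<longrightarrow> linked (set F') u v \<or> linked (set (avoiding p E)) u v"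
    using successors_complete[OF 1(5) c, of p F E] 1(6,7) by auto
  have "set ?us - {p} = set (q # r # s # us)" using 1(3) by auto
  then have "cyc (set (q # r # s # us)) C'" using F'(2) by metis
  moreover have "F' \<in> set (remdups (concat (map (successors (neighbours E p) p) S)))" using F' 1(4) by auto
  ultimately show False
    using 1(1)[of F' C'] 1(2,3) F'(3,4) by (simp del: set_simps)
next
  case (2 E p q r S)
  \<comment> \<open>Two distinct neighbours among three vertices means adjacency to both others, so
    the cycle is the full triangle.\<close>
  have all: "C u v" if u: "u \<in> {p, q, r}" "v \<in> {p, q, r}" "u \<noteq> v" for u v
  proof -
    obtain g h where "g \<noteq> h" "g \<noteq> u" "h \<noteq> u" "\<And>z. C u z \<longleftrightarrow> z = g \<or> z = h"
      by (rule cyc_degree[OF 2(4), of u]) (use u in auto)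
    moreover have "{g, h} \<subseteq> {p, q, r}" using calculation cyc_mem[OF 2(4)] by auto
    ultimately show ?thesis using u 2(2) by auto
  qed
  have "linked (set (F @ E)) p q" "linked (set (F @ E)) p r" "linked (set (F @ E)) q r"
    using all[of p q] all[of p r] all[of q r] 2(2,6) by (auto simp: linked_simps)
  then show False using 2(1,3) by (auto simp: list_all_iff set_neighbours)
qed auto

section \<open>Certificates\<close>

text \<open>In a certificate for a graph on \<open>{..<N}\<close>, the quadrilateral carrying the ladder has the rungs
  \<open>(N - 2, N - 1)\<close>, \<open>(0, 1)\<close> and the rails \<open>(N - 2, 0)\<close>, \<open>(N - 1, 1)\<close>; the exceptional vertex is \<open>2\<close>,
  and the list \<open>B\<close> contains the remaining edges.\<close>

definition quad :: "nat \<Rightarrow> (nat \<times> nat) list" where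
  "quad N = [(N - 2, N - 1), (0, 1), (N - 2, 0), (N - 1, 1)]"

text \<open>Adjacency lists let each step of a listed cycle be checked by lookup instead of a scan
  of all edges.\<close>

definition table :: "nat \<Rightarrow> (nat \<times> nat) list \<Rightarrow> nat list list" where
  "table N E = map (neighbours E) [0..<N]"

text \<open>The list is rotated so that its closing edge is a side of the quadrilateral. This one
  test covers both the closing edge and the demand that the cycle use such a side.\<close>

definition cycle_without :: "nat \<Rightarrow> nat list list \<Rightarrow> nat \<Rightarrow> nat list \<Rightarrow> bool" where
  "cycle_without N A v zs \<longleftrightarrow> length zs = N - 1 \<and> distinct zs \<and> list_all (\<lambda>x. x < N \<and> x \<noteq> v) zs \<and>
     hd zs \<in> set (neighbours (quad N) (last zs)) \<and>
     list_all (\<lambda>(x, y). y \<in> set (A ! x)) (steps zs)"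

definition cycle_through :: "nat \<Rightarrow> (nat \<times> nat) list \<Rightarrow> nat \<Rightarrow> nat \<Rightarrow> nat list \<Rightarrow> bool" where
  "cycle_through N B x y zs \<longleftrightarrow> length zs = N \<and> distinct zs \<and> list_all (\<lambda>x. x < N) zs \<and>
     last zs = x \<and> hd zs = y \<and>
     list_all (\<lambda>(x, y). y \<in> set (neighbours ((N - 2, N - 1) # (0, 1) # B) x)) (steps zs)"

text \<open>\<open>us\<close> and \<open>us'\<close> are elimination orders for the graph and for
  the graph without vertex 2; \<open>[[]]\<close> is the single initial state without forced edges.
  The cycles in \<open>zss\<close> follow the order of the deleted vertices, with 2 skipped.\<close>

definition cycle_certificate :: "nat \<Rightarrow> (nat \<times> nat) list \<Rightarrow> nat list \<Rightarrow> nat list \<Rightarrow>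
    nat list list \<Rightarrow> nat list \<Rightarrow> nat list \<Rightarrow> bool" where
  "cycle_certificate N B us us' zss zs zs' \<longleftrightarrow> 8 \<le> N \<and>
     list_all (\<lambda>(x, y). x < N \<and> y < N \<and> x \<noteq> y) B \<and>
     length us = N \<and> distinct us \<and> list_all (\<lambda>x. x < N) us \<and>
     length us' = N - 1 \<and> distinct us' \<and> list_all (\<lambda>x. x < N \<and> x \<noteq> 2) us' \<and>
     no_cycle (quad N @ B) us [[]] \<and> no_cycle (avoiding 2 (quad N @ B)) us' [[]] \<and>
     list_all2 (cycle_without N (table N (quad N @ B))) (removeAll 2 [0..<N]) zss \<and>
     cycle_through N B (N - 1) 0 zs \<and> cycle_through N B (N - 2) 1 zs'"

section \<open>From a certificate to the ladder invariant\<close>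

lemma set_eq_lessThan:
  assumes "distinct us" "length us = N" "list_all (\<lambda>x. x < N) us"
  shows "set us = {..<N}"
proof (rule card_subset_eq)
  show "card (set us) = card {..<N}" using assms distinct_card by fastforce
qed (use assms in \<open>auto simp: list_all_iff\<close>)

lemma set_eq_lessThan_minus:
  assumes "distinct us" "length us = N - 1" "list_all (\<lambda>x. x < N \<and> x \<noteq> v) us" "v < N"
  shows "set us = {..<N} - {v}"
proof (rule card_subset_eq)
  show "card (set us) = card ({..<N} - {v})" using assms distinct_card by fastforce
qed (use assms in \<open>auto simp: list_all_iff\<close>)

lemma extensible_base:
  assumes cert: "cycle_certificate N B us us' zss zs zs'"
  shows "extensible {..<N} (linked (set ((N - 2, N - 1) # (0, 1) # B))) (N - 2) (N - 1) 0 1 2"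
proof -
  let ?R = "linked (set ((N - 2, N - 1) # (0, 1) # B))"
  let ?E = "\<lambda>u v. ?R u v \<or> edge (N - 2) 0 u v \<or> edge (N - 1) 1 u v"
  note c = cert[unfolded cycle_certificate_def]
  have N: "8 \<le> N" using c by blast
  have E: "linked (set (quad N @ B)) u v \<longleftrightarrow> ?E u v" for u v
    by (auto simp: quad_def linked_simps)
  have us: "set us = {..<N}" "set us' = {..<N} - {2}"
    using c set_eq_lessThan[of us N] set_eq_lessThan_minus[of us' N 2] N by auto
  have nh1: "\<not> (\<exists>C. cyc {..<N} C \<and> (\<forall>u v. C u v \<longrightarrow> ?E u v))"
  proof
    assume "\<exists>C. cyc {..<N} C \<and> (\<forall>u v. C u v \<longrightarrow> ?E u v)"
    then obtain C where C: "cyc (set us) C" "\<And>u v. C u v \<Longrightarrow> linked (set (quad N @ B)) u v"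
      unfolding us E by blast
    show False
      using no_cycle_sound[of "quad N @ B" us "[[]]" "[]" C] c C
      by (auto simp: linked_def)
  qed
  have nh2: "\<not> (\<exists>C. cyc ({..<N} - {2}) C \<and> (\<forall>u v. C u v \<longrightarrow> ?E u v))"
  proof
    assume "\<exists>C. cyc ({..<N} - {2}) C \<and> (\<forall>u v. C u v \<longrightarrow> ?E u v)"
    then obtain C where C: "cyc (set us') C" "\<And>u v. C u v \<Longrightarrow> linked (set (quad N @ B)) u v"
      unfolding us E by blast
    have "linked (set (avoiding 2 (quad N @ B))) u v" if "C u v" for u v
      using C(2)[OF that] cyc_mem[OF C(1) that] us(2) by (auto simp: linked_avoiding)
    then show False
      using no_cycle_sound[of "avoiding 2 (quad N @ B)" us' "[[]]" "[]" C] c C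
      by (auto simp: linked_def)
  qed
  have del: "\<exists>C. cyc ({..<N} - {x}) C \<and> (\<forall>u v. C u v \<longrightarrow> ?E u v) \<and>
      (C (N - 2) 0 \<or> C (N - 1) 1 \<or> C (N - 2) (N - 1) \<or> C 0 1)"
    if x: "x \<in> {..<N}" "x \<noteq> 2" for x
  proof -
    have "x \<in> set (removeAll 2 [0..<N])" using x by simp
    moreover have l2: "list_all2 (cycle_without N (table N (quad N @ B))) (removeAll 2 [0..<N]) zss" using c by blast
    ultimately obtain ws where ws: "cycle_without N (table N (quad N @ B)) x ws"
      by (metis in_set_conv_nth list_all2_conv_all_nth)
    note w = ws[unfolded cycle_without_def]
    let ?C = "linked (round_trip ws)"
    have "set ws = {..<N} - {x}" using w x set_eq_lessThan_minus[of ws N x] by auto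
    then have "cyc ({..<N} - {x}) ?C" unfolding cyc_def using w N by auto
    moreover have cl: "linked (set (quad N)) (last ws) (hd ws)" using w by (simp add: set_neighbours)
    have st: "\<And>u v. (u, v) \<in> set (steps ws) \<Longrightarrow> linked (set (quad N @ B)) u v"
    proof -
      fix u v assume uv: "(u, v) \<in> set (steps ws)"
      then have "v \<in> set (table N (quad N @ B) ! u)" "u < N"
        using w steps_mem[OF uv] by (auto simp: list_all_iff)
      then show "linked (set (quad N @ B)) u v" by (simp add: table_def set_neighbours)
    qed
    have "linked (set (quad N @ B)) u v" if "?C u v" for u v
      using that st cl linked_sym unfolding round_trip_def linked_simps(2) edge_def
      by (auto simp: linked_simps) (auto simp: linked_def)
    then have "\<forall>u v. ?C u v \<longrightarrow> ?E u v" unfolding E by blast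
    moreover have "?C (last ws) (hd ws)" "?C (hd ws) (last ws)"
      by (auto simp: round_trip_def linked_def)
    then have "?C (N - 2) 0 \<or> ?C (N - 1) 1 \<or> ?C (N - 2) (N - 1) \<or> ?C 0 1"
      using cl unfolding quad_def by (auto simp: linked_simps edge_def)
    ultimately show ?thesis by blast
  qed
  have diag: "\<exists>C. cyc {..<N} C \<and> (\<forall>u v. C u v \<longrightarrow> ?R u v \<or> edge x y u v) \<and> C x y"
    if "cycle_through N B x y ws" for x y ws
  proof -
    note w = that[unfolded cycle_through_def]
    let ?C = "linked (round_trip ws)"
    have "set ws = {..<N}" using w set_eq_lessThan[of ws N] by auto
    then have "cyc {..<N} ?C" unfolding cyc_def using w N by auto
    moreover have st: "\<And>u v. (u, v) \<in> set (steps ws) \<Longrightarrow> ?R u v"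
      using w by (auto simp: list_all_iff set_neighbours)
    have "\<forall>u v. ?C u v \<longrightarrow> ?R u v \<or> edge x y u v"
      using st linked_sym w unfolding round_trip_def linked_simps(2)
      by (metis linked_def)
    moreover have "?C x y" using w by (auto simp: round_trip_def linked_def)
    ultimately show ?thesis by blast
  qed
  have "\<forall>u v. ?R u v \<longrightarrow> u \<in> {..<N} \<and> v \<in> {..<N}"
    using c N by (auto simp: linked_def list_all_iff)
  moreover have "?R (N - 2) (N - 1)" "?R 0 1" "?R (N - 1) (N - 2)" "?R 1 0"
    by (auto simp: linked_def)
  moreover have "{N - 2, N - 1, 0, 1, 2} \<subseteq> {..<N}" "distinct [N - 2, N - 1, 0, 1, 2]"
    "5 \<le> card {..<N}"
    using N by auto
  moreover have "\<forall>x\<in>{..<N}. x \<noteq> 2 \<longrightarrow> (\<exists>C. cyc ({..<N} - {x}) C \<and> (\<forall>u v. C u v \<longrightarrow> ?E u v) \<and>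
      (C (N - 2) 0 \<or> C (N - 1) 1 \<or> C (N - 2) (N - 1) \<or> C 0 1))"
    using del by blast
  moreover have "\<exists>C. cyc {..<N} C \<and> (\<forall>u v. C u v \<longrightarrow> ?R u v \<or> edge (N - 1) 0 u v) \<and> C (N - 1) 0"
    "\<exists>C. cyc {..<N} C \<and> (\<forall>u v. C u v \<longrightarrow> ?R u v \<or> edge (N - 2) 1 u v) \<and> C (N - 2) 1"
    using diag c by blast+
  ultimately show ?thesis
    unfolding extensible_def by (intro conjI nh1 nh2 finite_lessThan)
qed

section \<open>Straight-line drawings\<close>

text \<open>Twice the signed area of the triangle abc. Integer coordinates keep every test on the
  start graphs exact.\<close>

definition orient :: "int \<times> int \<Rightarrow> int \<times> int \<Rightarrow> int \<times> int \<Rightarrow> int" where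
  "orient a b c = (fst b - fst a) * (snd c - snd a) - (snd b - snd a) * (fst c - fst a)"

definition pt :: "int \<times> int \<Rightarrow> complex" where
  "pt a = Complex (of_int (fst a)) (of_int (snd a))"

type_synonym seg = "(nat \<times> int \<times> int) \<times> (nat \<times> int \<times> int)"

definition same_side :: "int \<times> int \<Rightarrow> int \<times> int \<Rightarrow> (int \<times> int) list \<Rightarrow> bool" where
  "same_side a b cs \<longleftrightarrow>
     list_all (\<lambda>c. orient a b c > 0) cs \<or> list_all (\<lambda>c. orient a b c < 0) cs"

definition boxes_apart :: "int \<times> int \<Rightarrow> int \<times> int \<Rightarrow> int \<times> int \<Rightarrow> int \<times> int \<Rightarrow> bool" where
  "boxes_apart a b c d \<longleftrightarrow>
     fst a < fst c \<and> fst a < fst d \<and> fst b < fst c \<and> fst b < fst d \<or>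
     fst c < fst a \<and> fst c < fst b \<and> fst d < fst a \<and> fst d < fst b \<or>
     snd a < snd c \<and> snd a < snd d \<and> snd b < snd c \<and> snd b < snd d \<or>
     snd c < snd a \<and> snd c < snd b \<and> snd d < snd a \<and> snd d < snd b"

text \<open>Segments carry vertex names, so a common endpoint is recognised by name; then
  non-collinearity excludes any further common point. Otherwise a sufficient separation test is
  used, with the comparison of bounding boxes as its cheapest form.\<close>

fun noncrossing :: "seg \<Rightarrow> seg \<Rightarrow> bool" where
  "noncrossing ((u, a), (v, b)) ((x, c), (y, d)) \<longleftrightarrow>
    (if u = x then orient a b d \<noteq> 0
     else if u = y then orient a b c \<noteq> 0
     else if v = x then orient b a d \<noteq> 0
     else if v = y then orient b a c \<noteq> 0
     else boxes_apart a b c d \<or> same_side a b [c, d] \<or> same_side c d [a, b])"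

text \<open>Edges of the start graph may end at a corner of the square with side 20, so one end is
  allowed on the line of a side while the other lies strictly beyond it. The last alternative
  concerns segments whose line misses the square.\<close>

fun clear_of_square :: "seg \<Rightarrow> bool" where
  "clear_of_square ((u, a), (v, b)) \<longleftrightarrow>
     fst a \<le> 0 \<and> fst b < 0 \<or> fst a < 0 \<and> fst b \<le> 0 \<or>
     fst a \<ge> 20 \<and> fst b > 20 \<or> fst a > 20 \<and> fst b \<ge> 20 \<or>
     snd a \<le> 0 \<and> snd b < 0 \<or> snd a < 0 \<and> snd b \<le> 0 \<or>
     snd a \<ge> 20 \<and> snd b > 20 \<or> snd a > 20 \<and> snd b \<ge> 20 \<or>
     same_side a b [(0, 0), (20, 0), (0, 20), (20, 20)]"

definition square :: "complex set" where
  "square = {z. 0 \<le> Re z \<and> Re z \<le> 20 \<and> 0 \<le> Im z \<and> Im z \<le> 20}"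

section \<open>Correctness of the segment tests\<close>

lemma in_segment_complex:
  assumes "z \<in> closed_segment a b"
  obtains s where "0 \<le> s" "s \<le> 1" "Re z = (1 - s) * Re a + s * Re b" "Im z = (1 - s) * Im a + s * Im b"
  using assms by (auto simp: closed_segment_def)

text \<open>The extension of \<open>orient a b\<close> to the whole plane. It is affine and vanishes
  on the line ab, so its values along a segment are governed by those at the ends.\<close>

definition rorient :: "int \<times> int \<Rightarrow> int \<times> int \<Rightarrow> complex \<Rightarrow> real" where
  "rorient a b z = of_int (fst b - fst a) * (Im z - of_int (snd a)) - of_int (snd b - snd a) * (Re z - of_int (fst a))"

lemma rorient_pt: "rorient a b (pt c) = of_int (orient a b c)"
  by (simp add: rorient_def orient_def pt_def)

lemma rorient_affine:
  assumes "Re z = (1 - s) * Re x + s * Re y" "Im z = (1 - s) * Im x + s * Im y"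
  shows "rorient a b z = (1 - s) * rorient a b x + s * rorient a b y"
  unfolding rorient_def assms by algebra

lemma rorient_on_segment:
  assumes "z \<in> closed_segment (pt a) (pt b)"
  shows "rorient a b z = 0"
proof -
  obtain s where "Re z = (1 - s) * Re (pt a) + s * Re (pt b)" "Im z = (1 - s) * Im (pt a) + s * Im (pt b)"
    using in_segment_complex[OF assms] by metis
  from rorient_affine[OF this, of a b] show ?thesis
    by (simp add: rorient_pt orient_def)
qed

lemma convex_combination_pos:
  assumes "0 \<le> s" "s \<le> 1" "0 < x" "0 < (y::real)"
  shows "0 < (1 - s) * x + s * y"
  using assms by (smt (verit) mult_nonneg_nonneg mult_pos_pos)

lemma same_side_disjoint:
  assumes "same_side a b [c, d]"
  shows "closed_segment (pt a) (pt b) \<inter> closed_segment (pt c) (pt d) = {}"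
proof (rule ccontr)
  assume "\<not> ?thesis"
  then obtain z where z: "z \<in> closed_segment (pt a) (pt b)" "z \<in> closed_segment (pt c) (pt d)" by blast
  obtain s where s: "0 \<le> s" "s \<le> 1" "Re z = (1 - s) * Re (pt c) + s * Re (pt d)"
    "Im z = (1 - s) * Im (pt c) + s * Im (pt d)"
    using in_segment_complex[OF z(2)] by metis
  have "(1 - s) * of_int (orient a b c) + s * of_int (orient a b d) = (0::real)"
    using rorient_affine[OF s(3,4), of a b] rorient_on_segment[OF z(1)] by (simp add: rorient_pt)
  moreover have "0 < (1 - s) * of_int (orient a b c) + s * of_int (orient a b d)
      \<or> 0 < (1 - s) * - of_int (orient a b c) + s * - (of_int (orient a b d) :: real)"
    using assms convex_combination_pos[OF s(1,2), of "of_int (orient a b c)" "of_int (orient a b d)"]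
      convex_combination_pos[OF s(1,2), of "- of_int (orient a b c)" "- of_int (orient a b d)"]
    by (auto simp: same_side_def)
  ultimately show False by auto
qed

lemma in_segment_bounds:
  assumes "z \<in> closed_segment (pt a) (pt b)"
  shows "of_int (min (fst a) (fst b)) \<le> Re z" "Re z \<le> of_int (max (fst a) (fst b))"
    "of_int (min (snd a) (snd b)) \<le> Im z" "Im z \<le> of_int (max (snd a) (snd b))"
proof -
  obtain s where s: "0 \<le> s" "s \<le> 1" "Re z = (1 - s) * of_int (fst a) + s * of_int (fst b)"
    "Im z = (1 - s) * of_int (snd a) + s * of_int (snd b)"
    using in_segment_complex[OF assms] by (auto simp: pt_def)
  have *: "min x y \<le> (1 - s) * x + s * y \<and> (1 - s) * x + s * y \<le> max x y" for x y :: real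
  proof -
    have "(1 - s) * x + s * y \<le> (1 - s) * max x y + s * max x y"
      "(1 - s) * min x y + s * min x y \<le> (1 - s) * x + s * y"
      using s by (intro add_mono mult_left_mono; simp)+
    then show ?thesis by (simp add: algebra_simps)
  qed
  show "of_int (min (fst a) (fst b)) \<le> Re z" "Re z \<le> of_int (max (fst a) (fst b))"
    "of_int (min (snd a) (snd b)) \<le> Im z" "Im z \<le> of_int (max (snd a) (snd b))"
    using *[of "of_int (fst a)" "of_int (fst b)"] *[of "of_int (snd a)" "of_int (snd b)"]
    unfolding s of_int_min of_int_max by auto
qed

lemma boxes_apart_disjoint:
  assumes "boxes_apart a b c d"
  shows "closed_segment (pt a) (pt b) \<inter> closed_segment (pt c) (pt d) = {}"
proof (rule ccontr)
  assume "\<not> ?thesis"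
  then obtain z where z: "z \<in> closed_segment (pt a) (pt b)" "z \<in> closed_segment (pt c) (pt d)" by blast
  show False
    using in_segment_bounds[OF z(1)] in_segment_bounds[OF z(2)] assms
    unfolding boxes_apart_def by linarith
qed

text \<open>Along the segment from \<open>a\<close> to \<open>c\<close> the function
  \<open>rorient a b\<close> grows linearly from 0 with nonzero slope, so it returns to 0 nowhere
  else.\<close>

lemma common_endpoint:
  assumes "orient a b c \<noteq> 0"
  shows "closed_segment (pt a) (pt b) \<inter> closed_segment (pt a) (pt c) \<subseteq> {pt a}"
proof
  fix z assume "z \<in> closed_segment (pt a) (pt b) \<inter> closed_segment (pt a) (pt c)"
  then have z: "z \<in> closed_segment (pt a) (pt b)" "z \<in> closed_segment (pt a) (pt c)" by auto
  obtain s where s: "Re z = (1 - s) * Re (pt a) + s * Re (pt c)" "Im z = (1 - s) * Im (pt a) + s * Im (pt c)"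
    using in_segment_complex[OF z(2)] by metis
  have "s * of_int (orient a b c) = (0::real)"
    using rorient_affine[OF s, of a b] rorient_on_segment[OF z(1)]
    by (simp add: rorient_pt orient_def)
  then have "s = 0" using assms by simp
  then show "z \<in> {pt a}" using s by (simp add: complex_eq_iff)
qed

lemma noncrossing_sound:
  assumes "noncrossing ((u, P u), (v, P v)) ((x, P x), (y, P y))" "{u, v} \<noteq> {x, y}"
  shows "closed_segment (pt (P u)) (pt (P v)) \<inter> closed_segment (pt (P x)) (pt (P y))
    \<subseteq> (\<lambda>z. pt (P z)) ` ({u, v} \<inter> {x, y})"
proof -
  consider "u = x" "orient (P u) (P v) (P y) \<noteq> 0" | "u = y" "orient (P u) (P v) (P x) \<noteq> 0"
    | "v = x" "orient (P v) (P u) (P y) \<noteq> 0" | "v = y" "orient (P v) (P u) (P x) \<noteq> 0"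
    | "boxes_apart (P u) (P v) (P x) (P y)" | "same_side (P u) (P v) [P x, P y]"
    | "same_side (P x) (P y) [P u, P v]"
    using assms(1) by (auto split: if_splits)
  then show ?thesis
  proof cases
    case 1
    then show ?thesis using common_endpoint by blast
  next
    case 2
    then show ?thesis using common_endpoint[OF 2(2)] by (simp add: closed_segment_commute) blast
  next
    case 3
    then show ?thesis using common_endpoint[OF 3(2)] by (simp add: closed_segment_commute) blast
  next
    case 4
    then show ?thesis using common_endpoint[OF 4(2)] by (simp add: closed_segment_commute) blast
  next
    case 5
    then show ?thesis using boxes_apart_disjoint by blast
  next
    case 6
    then show ?thesis using same_side_disjoint by blast
  next
    case 7
    then show ?thesis using same_side_disjoint by blast
  qed
qed

lemma strict_side:
  assumes "0 \<le> s" "s \<le> 1" "(x::real) \<le> 0" "y < 0" "0 \<le> (1 - s) * x + s * y"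
  shows "s = 0"
proof (rule ccontr)
  assume "s \<noteq> 0"
  then have "s * y < 0" using assms by (simp add: mult_pos_neg)
  moreover have "(1 - s) * x \<le> 0" using assms by (simp add: mult_nonneg_nonpos)
  ultimately show False using assms by linarith
qed

lemma clear_of_square_sound:
  assumes "clear_of_square ((u, a), (v, b))" "z \<in> closed_segment (pt a) (pt b)" "z \<in> square"
  shows "z = pt a \<or> z = pt b"
proof -
  obtain s where s: "0 \<le> s" "s \<le> 1" "Re z = (1 - s) * of_int (fst a) + s * of_int (fst b)"
    "Im z = (1 - s) * of_int (snd a) + s * of_int (snd b)"
    using in_segment_complex[OF assms(2)] by (auto simp: pt_def)
  have sq: "0 \<le> Re z" "Re z \<le> 20" "0 \<le> Im z" "Im z \<le> 20" using assms(3) by (auto simp: square_def)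
  have s': "0 \<le> 1 - s" "1 - s \<le> 1" using s by auto
  have end0: "s = 0 \<Longrightarrow> z = pt a" and end1: "1 - s = 0 \<Longrightarrow> z = pt b"
    using s by (simp_all add: complex_eq_iff pt_def)
  have side: "s = 0 \<or> 1 - s = 0"
    if "x \<le> 0 \<and> y < 0 \<or> x < 0 \<and> y \<le> 0" "0 \<le> (1 - s) * x + s * y" for x y :: real
    using that strict_side[OF s(1,2), of x y] strict_side[OF s', of y x] by (auto simp: add.commute)
  have "\<not> same_side a b [(0, 0), (20, 0), (0, 20), (20, 20)]"
  proof
    assume ss: "same_side a b [(0, 0), (20, 0), (0, 20), (20, 20)]"
    \<comment> \<open>Bilinear interpolation from the four corners of the square reproduces affine
      functions; 400 = 20 * 20 clears the denominators. The weights are nonnegative on the square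
      and sum to 400, so corner values of one strict sign cannot average to 0.\<close>
    have bil: "400 * rorient a b z = (20 - Re z) * (20 - Im z) * rorient a b (pt (0, 0)) +
        Re z * (20 - Im z) * rorient a b (pt (20, 0)) +
        (20 - Re z) * Im z * rorient a b (pt (0, 20)) + Re z * Im z * rorient a b (pt (20, 20))"
      by (simp add: rorient_def pt_def) algebra
    let ?c = "\<lambda>c. of_int (orient a b c) :: real"
    have eq: "(20 - Re z) * (20 - Im z) * ?c (0, 0) + Re z * (20 - Im z) * ?c (20, 0) +
        (20 - Re z) * Im z * ?c (0, 20) + Re z * Im z * ?c (20, 20) = 0"
      using bil rorient_on_segment[OF assms(2)] by (simp add: rorient_pt)
    have w: "0 \<le> (20 - Re z) * (20 - Im z)" "0 \<le> Re z * (20 - Im z)" "0 \<le> (20 - Re z) * Im z"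
      "0 \<le> Re z * Im z"
      using sq by auto
    have tot: "(20 - Re z) * (20 - Im z) + Re z * (20 - Im z) + (20 - Re z) * Im z + Re z * Im z = 400"
      by (simp add: algebra_simps)
    have comb: "0 < g1 * x1 + g2 * x2 + g3 * x3 + g4 * x4"
      if "0 < x1" "0 < x2" "0 < x3" "0 < x4" "0 \<le> g1" "0 \<le> g2" "0 \<le> g3" "0 \<le> g4"
        "g1 + g2 + g3 + g4 = 400" for g1 g2 g3 g4 x1 x2 x3 x4 :: real
    proof -
      have nn: "0 \<le> g1 * x1" "0 \<le> g2 * x2" "0 \<le> g3 * x3" "0 \<le> g4 * x4" using that by auto
      moreover have "0 < g1 * x1 \<or> 0 < g2 * x2 \<or> 0 < g3 * x3 \<or> 0 < g4 * x4"
        using that by (auto simp: zero_less_mult_iff)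
      ultimately show ?thesis by linarith
    qed
    show False
      using ss comb[OF _ _ _ _ w tot, of "?c (0, 0)" "?c (20, 0)" "?c (0, 20)" "?c (20, 20)"]
        comb[OF _ _ _ _ w tot, of "- ?c (0, 0)" "- ?c (20, 0)" "- ?c (0, 20)" "- ?c (20, 20)"] eq
      by (auto simp: same_side_def)
  qed
  then consider "fst a \<le> 0 \<and> fst b < 0 \<or> fst a < 0 \<and> fst b \<le> 0"
    | "fst a \<ge> 20 \<and> fst b > 20 \<or> fst a > 20 \<and> fst b \<ge> 20"
    | "snd a \<le> 0 \<and> snd b < 0 \<or> snd a < 0 \<and> snd b \<le> 0"
    | "snd a \<ge> 20 \<and> snd b > 20 \<or> snd a > 20 \<and> snd b \<ge> 20"
    using assms(1) by auto
  then have "s = 0 \<or> 1 - s = 0"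
  proof cases
    case 1
    show ?thesis by (rule side[of "of_int (fst a)" "of_int (fst b)"]) (use 1 sq s in auto)
  next
    \<comment> \<open>The reflection sending x to 20 - x turns the right side of the square into the
      left one.\<close>
    case 2
    show ?thesis by (rule side[of "20 - of_int (fst a)" "20 - of_int (fst b)"])
        (use 2 sq s in \<open>auto simp: algebra_simps\<close>)
  next
    case 3
    show ?thesis by (rule side[of "of_int (snd a)" "of_int (snd b)"]) (use 3 sq s in auto)
  next
    case 4
    show ?thesis by (rule side[of "20 - of_int (snd a)" "20 - of_int (snd b)"])
        (use 4 sq s in \<open>auto simp: algebra_simps\<close>)
  qed
  then show ?thesis using end0 end1 by blast
qed

text \<open>Planarity also forbids an edge from passing through a foreign vertex. Since every vertex
  has an incident edge, such a vertex would be a forbidden meeting point of two edges, so the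
  pairwise condition suffices.\<close>

lemma planar_straight:
  fixes p :: "nat \<Rightarrow> complex"
  assumes simple: "\<And>u v. (u, v) \<in> S \<Longrightarrow> u \<in> V \<and> v \<in> V \<and> u \<noteq> v"
    and inj: "inj_on p V"
    and incident: "\<And>z. z \<in> V \<Longrightarrow> \<exists>x. linked S z x"
    and meet: "\<And>u v x y. (u, v) \<in> S \<Longrightarrow> (x, y) \<in> S \<Longrightarrow> {u, v} \<noteq> {x, y} \<Longrightarrow>
      closed_segment (p u) (p v) \<inter> closed_segment (p x) (p y) \<subseteq> p ` ({u, v} \<inter> {x, y})"
  shows "planar V (linked S)"
proof -
  have sim: "u \<in> V \<and> v \<in> V \<and> u \<noteq> v" if "linked S u v" for u v
    using that simple by (auto simp: linked_def)
  have meet': "closed_segment (p u) (p v) \<inter> closed_segment (p x) (p y) \<subseteq> p ` ({u, v} \<inter> {x, y})"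
    if uv: "linked S u v" and xy: "linked S x y" and ne: "{u, v} \<noteq> {x, y}" for u v x y
  proof -
    obtain u' v' where u': "(u', v') \<in> S" "{u', v'} = {u, v}"
      "closed_segment (p u') (p v') = closed_segment (p u) (p v)"
      using uv closed_segment_commute unfolding linked_def by blast
    obtain x' y' where x': "(x', y') \<in> S" "{x', y'} = {x, y}"
      "closed_segment (p x') (p y') = closed_segment (p x) (p y)"
      using xy closed_segment_commute unfolding linked_def by blast
    show ?thesis using meet[OF u'(1) x'(1)] u'(2,3) x'(2,3) ne by metis
  qed
  have own: "closed_segment (p u) (p v) \<inter> p ` V = {p u, p v}" if uv: "linked S u v" for u v
  proof
    show "closed_segment (p u) (p v) \<inter> p ` V \<subseteq> {p u, p v}"
    proof
      fix a assume "a \<in> closed_segment (p u) (p v) \<inter> p ` V"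
      then obtain z where z: "z \<in> V" "a = p z" "p z \<in> closed_segment (p u) (p v)" by blast
      show "a \<in> {p u, p v}"
      proof (cases "z \<in> {u, v}")
        case False
        obtain x where x: "linked S z x" using incident z by blast
        have "p z \<in> p ` ({u, v} \<inter> {z, x})"
          using meet'[OF uv x] False z(3) by blast
        then show ?thesis using z by blast
      qed (use z in auto)
    qed
    show "{p u, p v} \<subseteq> closed_segment (p u) (p v) \<inter> p ` V" using sim[OF uv] by auto
  qed
  show ?thesis
    unfolding planar_def
  proof (rule exI[of _ p], rule exI[of _ "\<lambda>u v. linepath (p u) (p v)"], intro conjI allI impI)
    fix u v assume uv: "linked S u v"
    then show "arc (linepath (p u) (p v))"
      using sim inj by (intro arc_linepath) (auto simp: inj_on_def)
    show "path_image (linepath (p u) (p v)) \<inter> p ` V = {p u, p v}"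
      using own[OF uv] by simp
  next
    fix u v x y assume "linked S u v" "linked S x y" "{u, v} \<noteq> {x, y}"
    then show "path_image (linepath (p u) (p v)) \<inter> path_image (linepath (p x) (p y))
        \<subseteq> p ` ({u, v} \<inter> {x, y})"
      using meet' by simp
  qed (use inj in auto)
qed

section \<open>Drawing the ladder\<close>

text \<open>\<open>lane N k t i\<close> is the vertex on rail \<open>t \<in> {0, 1}\<close> and rung \<open>i \<in> {0..2 * k + 1}\<close>.\<close>

definition lane :: "nat \<Rightarrow> nat \<Rightarrow> nat \<Rightarrow> nat \<Rightarrow> nat" where
  "lane N k t i = (if i = 2 * k + 1 then t else N - 2 + 2 * i + t)"

definition ladder :: "nat \<Rightarrow> nat \<Rightarrow> (nat \<times> nat) set" where
  "ladder N k = {(lane N k t i, lane N k t (i + 1)) | t i. t \<le> 1 \<and> i \<le> 2 * k} \<union>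
     {(lane N k 0 i, lane N k 1 i) | i. i \<le> 2 * k + 1}"

text \<open>From the number \<open>length P - 2\<close> on, labels alternate between the two rails,
  so quotient and remainder by 2 give rung and rail. Rung \<open>i\<close> sits at abscissa 20 i /
  (2k + 1); the two end rungs are placed by \<open>P\<close> itself.\<close>

definition position :: "(int \<times> int) list \<Rightarrow> nat \<Rightarrow> nat \<Rightarrow> complex" where
  "position P k v = (if v < length P then pt (P ! v)
     else Complex (20 * real ((v - (length P - 2)) div 2) / real (2 * k + 1))
       (20 * real ((v - (length P - 2)) mod 2)))"

definition segments :: "(int \<times> int) list \<Rightarrow> (nat \<times> nat) list \<Rightarrow> seg list" where
  "segments P B = map (\<lambda>(u, v). ((u, P ! u), (v, P ! v))) B"

text \<open>Nothing here depends on the length of the ladder. The quadrilateral occupies the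
  boundary of the square, the vertices from 2 to \<open>N - 3\<close> lie outside it, and the edges
  in \<open>B\<close> are pairwise compatible and touch it only at their ends. Nonempty neighbour
  lists supply the incidence demanded of every vertex.\<close>

definition drawing_certificate :: "nat \<Rightarrow> (nat \<times> nat) list \<Rightarrow> (int \<times> int) list \<Rightarrow> bool" where
  "drawing_certificate N B P \<longleftrightarrow> 8 \<le> N \<and> length P = N \<and> distinct P \<and>
     P ! 0 = (20, 0) \<and> P ! 1 = (20, 20) \<and> P ! (N - 2) = (0, 0) \<and> P ! (N - 1) = (0, 20) \<and>
     list_all (\<lambda>(x, y). x < 0 \<or> 20 < x \<or> y < 0 \<or> 20 < y) (take (N - 4) (drop 2 P)) \<and>
     list_all (\<lambda>(u, v). u < N \<and> v < N \<and> u \<noteq> v) B \<and>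
     list_all (\<lambda>v. neighbours B v \<noteq> []) [2..<N - 2] \<and>
     sorted_wrt noncrossing (segments P B) \<and> list_all clear_of_square (segments P B)"

locale drawing =
  fixes N k :: nat and B :: "(nat \<times> nat) list" and P :: "(int \<times> int) list"
  assumes cert: "drawing_certificate N B P"
begin

abbreviation "p \<equiv> position P k"
abbreviation "vx \<equiv> lane N k"

text \<open>The abscissa rescaled so that rung \<open>i\<close> has column \<open>i\<close>; the
  fractions then disappear from the comparisons.\<close>

definition col :: "complex \<Rightarrow> real" where
  "col z = Re z * real (2 * k + 1) / 20"

section \<open>Coordinates and incidences on the ladder\<close>

lemma N: "8 \<le> N" "length P = N"
  using cert by (auto simp: drawing_certificate_def)

lemma position_lane:
  assumes "t \<le> 1" "i \<le> 2 * k + 1"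
  shows "p (vx t i) = Complex (20 * real i / real (2 * k + 1)) (20 * real t)"
proof -
  have P: "P ! 0 = (20, 0)" "P ! 1 = (20, 20)" "P ! (N - 2) = (0, 0)" "P ! (N - 1) = (0, 20)"
    using cert by (auto simp: drawing_certificate_def)
  have t: "t = 0 \<or> t = 1" using assms by auto
  consider "i = 2 * k + 1" | "i = 0" | "0 < i" "i \<le> 2 * k" using assms by linarith
  then show ?thesis
  proof cases
    case 1
    then show ?thesis using t N P by (auto simp: position_def lane_def pt_def field_simps)
  next
    case 2
    have "N - 2 + 1 = N - 1" using N by simp
    then show ?thesis using 2 t N P by (auto simp: position_def lane_def pt_def)
  next
    case 3
    then have "vx t i = N - 2 + (2 * i + t)" "\<not> vx t i < N" using N by (auto simp: lane_def)
    moreover have "(2 * i + t) div 2 = i" "(2 * i + t) mod 2 = t" using t by auto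
    moreover have "vx t i - (N - 2) = 2 * i + t" using 3 by (simp add: lane_def)
    ultimately show ?thesis using N by (simp only: position_def if_False)
  qed
qed

lemma col_lane: "t \<le> 1 \<Longrightarrow> i \<le> 2 * k + 1 \<Longrightarrow> col (p (vx t i)) = real i"
  by (simp add: position_lane col_def)

lemma Im_lane: "t \<le> 1 \<Longrightarrow> i \<le> 2 * k + 1 \<Longrightarrow> Im (p (vx t i)) = 20 * real t"
  by (simp add: position_lane)

lemma eq_lane:
  assumes "t \<le> 1" "i \<le> 2 * k + 1" "col z = real i" "Im z = 20 * real t"
  shows "z = p (vx t i)"
proof -
  have "Re z = 20 * real i / real (2 * k + 1)"
    using assms(3) by (simp add: col_def field_simps)
  then show ?thesis using assms by (simp add: position_lane complex_eq_iff)
qed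

lemma rail_points:
  assumes "t \<le> 1" "i \<le> 2 * k" "z \<in> closed_segment (p (vx t i)) (p (vx t (i + 1)))"
  shows "real i \<le> col z" "col z \<le> real i + 1" "Im z = 20 * real t"
proof -
  let ?a = "p (vx t i)" and ?b = "p (vx t (i + 1))"
  obtain s where s: "0 \<le> s" "s \<le> 1" "Re z = (1 - s) * Re ?a + s * Re ?b"
    "Im z = (1 - s) * Im ?a + s * Im ?b"
    using in_segment_complex[OF assms(3)] by metis
  have "col z = (1 - s) * col ?a + s * col ?b"
    unfolding col_def s(3) by (simp add: field_simps)
  also have "\<dots> = real i + s"
    using assms by (simp add: col_lane algebra_simps)
  finally show "real i \<le> col z" "col z \<le> real i + 1" using s by auto
  show "Im z = 20 * real t" using s(4) assms by (simp add: Im_lane algebra_simps)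
qed

lemma rung_points:
  assumes "i \<le> 2 * k + 1" "z \<in> closed_segment (p (vx 0 i)) (p (vx 1 i))"
  shows "col z = real i" "0 \<le> Im z" "Im z \<le> 20"
proof -
  let ?a = "p (vx 0 i)" and ?b = "p (vx 1 i)"
  obtain s where s: "0 \<le> s" "s \<le> 1" "Re z = (1 - s) * Re ?a + s * Re ?b"
    "Im z = (1 - s) * Im ?a + s * Im ?b"
    using in_segment_complex[OF assms(2)] by metis
  have "col z = (1 - s) * col ?a + s * col ?b"
    unfolding col_def s(3) by (simp add: field_simps)
  then show "col z = real i" using assms by (simp add: col_lane algebra_simps)
  show "0 \<le> Im z" "Im z \<le> 20" using s(1,2) unfolding s(4) using assms by (simp_all add: Im_lane)
qed

lemma ladder_cases:
  assumes "(u, v) \<in> ladder N k"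
  obtains (rail) t i where "t \<le> 1" "i \<le> 2 * k" "u = vx t i" "v = vx t (i + 1)"
  | (rung) i where "i \<le> 2 * k + 1" "u = vx 0 i" "v = vx 1 i"
  using assms by (auto simp: ladder_def)

lemma ladder_points:
  assumes "(u, v) \<in> ladder N k" "z \<in> closed_segment (p u) (p v)"
  shows "0 \<le> col z" "col z \<le> real (2 * k + 1)" "0 \<le> Im z" "Im z \<le> 20"
proof -
  have "0 \<le> col z \<and> col z \<le> real (2 * k + 1) \<and> 0 \<le> Im z \<and> Im z \<le> 20"
    using assms(1)
  proof (cases rule: ladder_cases)
    case (rail t i)
    then have "real i \<le> col z" "col z \<le> real i + 1" "Im z = 20 * real t"
      using rail_points assms(2) by auto
    moreover have "real i + 1 \<le> real (2 * k + 1)" "real t \<le> 1" using rail by linarith+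
    ultimately show ?thesis by linarith
  next
    case (rung i)
    then have "col z = real i" "0 \<le> Im z" "Im z \<le> 20"
      using rung_points assms(2) by auto
    then show ?thesis using rung by simp
  qed
  then show "0 \<le> col z" "col z \<le> real (2 * k + 1)" "0 \<le> Im z" "Im z \<le> 20" by auto
qed

lemma ladder_in_square:
  assumes "(u, v) \<in> ladder N k" "z \<in> closed_segment (p u) (p v)"
  shows "z \<in> square"
proof -
  have z: "Re z = col z * 20 / real (2 * k + 1)" by (simp add: col_def)
  have "0 \<le> Re z"
    unfolding z using ladder_points[OF assms] by (intro divide_nonneg_nonneg) auto
  moreover have "Re z \<le> 20"
    unfolding z using ladder_points[OF assms] by (subst pos_divide_le_eq) auto
  ultimately have "0 \<le> Re z" "Re z \<le> 20" by auto
  then show ?thesis using ladder_points[OF assms] by (simp add: square_def)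
qed

lemma lane_on_ladder:
  assumes "(u, v) \<in> ladder N k" "t \<le> 1" "i \<le> 2 * k + 1" "p (vx t i) \<in> closed_segment (p u) (p v)"
  shows "vx t i \<in> {u, v}"
  using assms(1)
proof (cases rule: ladder_cases)
  case (rail t' j)
  then have "real j \<le> real i" "real i \<le> real j + 1" "20 * real t = 20 * real t'"
    using rail_points[of t' j "p (vx t i)"] assms by (auto simp: col_lane Im_lane)
  then have "t = t'" "i = j \<or> i = j + 1" by auto
  then show ?thesis using rail by auto
next
  case (rung j)
  then have "real i = real j" using rung_points[of j "p (vx t i)"] assms by (auto simp: col_lane)
  moreover have "t = 0 \<or> t = 1" using assms by auto
  ultimately show ?thesis using rung by auto
qed

text \<open>Two pieces of one rail have unit column intervals sharing at most an integer, a rail and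
  a rung can meet only where column and height are both those of a ladder vertex, and distinct rungs
  have distinct columns. That this vertex is an end of both edges is then a matter for
  \<open>lane_on_ladder\<close>.\<close>

lemma ladder_meet_lane:
  assumes "(u, v) \<in> ladder N k" "(x, y) \<in> ladder N k" "{u, v} \<noteq> {x, y}"
    "z \<in> closed_segment (p u) (p v)" "z \<in> closed_segment (p x) (p y)"
  shows "\<exists>t i. t \<le> 1 \<and> i \<le> 2 * k + 1 \<and> z = p (vx t i)"
  using assms(1)
proof (cases rule: ladder_cases)
  case uv: (rail t i)
  note a = rail_points[OF uv(1,2), of z, folded uv(3,4), OF assms(4)]
  show ?thesis using assms(2)
  proof (cases rule: ladder_cases)
    case xy: (rail t' j)
    note b = rail_points[OF xy(1,2), of z, folded xy(3,4), OF assms(5)]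
    have t: "t = t'" using a(3) b(3) by simp
    then have "i \<noteq> j" using assms(3) uv xy by auto
    then consider "i + 1 \<le> j" | "j + 1 \<le> i" by linarith
    then have "\<exists>m. m \<le> 2 * k + 1 \<and> col z = real m"
    proof cases
      case 1
      then have "real i + 1 \<le> real j" by linarith
      then have "col z = real j" using a b by linarith
      then show ?thesis using xy by (intro exI[of _ j]) auto
    next
      case 2
      then have "real j + 1 \<le> real i" by linarith
      then have "col z = real i" using a b by linarith
      then show ?thesis using uv by (intro exI[of _ i]) auto
    qed
    then show ?thesis using eq_lane[OF uv(1) _ _ a(3)] uv(1) by blast
  next
    case xy: (rung j)
    note b = rung_points[OF xy(1), of z, folded xy(2,3), OF assms(5)]
    show ?thesis using eq_lane[OF uv(1) xy(1) b(1) a(3)] uv(1) xy(1) by blast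
  qed
next
  case uv: (rung i)
  note a = rung_points[OF uv(1), of z, folded uv(2,3), OF assms(4)]
  show ?thesis using assms(2)
  proof (cases rule: ladder_cases)
    case xy: (rail t j)
    note b = rail_points[OF xy(1,2), of z, folded xy(3,4), OF assms(5)]
    show ?thesis using eq_lane[OF xy(1) uv(1) a(1) b(3)] uv(1) xy(1) by blast
  next
    case xy: (rung j)
    note b = rung_points[OF xy(1), of z, folded xy(2,3), OF assms(5)]
    have "i = j" using a b by simp
    then show ?thesis using assms(3) uv xy by simp
  qed
qed

section \<open>Outer vertices, ladder vertices and the complete drawing\<close>

lemma vertex_cases:
  assumes "v < N + 4 * k"
  obtains (outer) "2 \<le> v" "v < N - 2" | (lane) t i where "t \<le> 1" "i \<le> 2 * k + 1" "v = vx t i"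
proof -
  consider "2 \<le> v" "v < N - 2" | "v < 2" | "N - 2 \<le> v" by linarith
  then show ?thesis
  proof cases
    \<comment> \<open>The last rung, of index \<open>2 * k + 1\<close>, keeps the labels 0 and 1
      whatever the length of the ladder.\<close>
    case 2
    then show ?thesis using lane[of v "2 * k + 1"] by (simp add: lane_def)
  next
    case 3
    let ?j = "v - (N - 2)"
    have v: "v = N - 2 + 2 * (?j div 2) + ?j mod 2" using 3 by simp
    have "?j div 2 \<le> 2 * k" using assms N by simp
    then show ?thesis using lane[of "?j mod 2" "?j div 2"] v by (simp add: lane_def)
  qed (use outer in blast)
qed

lemma outer_not_in_square:
  assumes "2 \<le> v" "v < N - 2"
  shows "p v \<notin> square"
proof -
  have "v < N" using assms by simp
  have "Suc (Suc (v - 2)) = v" using assms by simp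
  then have "P ! v = take (N - 4) (drop 2 P) ! (v - 2)" using assms N by simp
  moreover have "v - 2 < length (take (N - 4) (drop 2 P))" using assms N by simp
  ultimately have "P ! v \<in> set (take (N - 4) (drop 2 P))" using nth_mem by metis
  moreover have "list_all (\<lambda>(x, y). x < 0 \<or> 20 < x \<or> y < 0 \<or> 20 < y) (take (N - 4) (drop 2 P))"
    using cert by (simp add: drawing_certificate_def)
  ultimately have "fst (P ! v) < 0 \<or> 20 < fst (P ! v) \<or> snd (P ! v) < 0 \<or> 20 < snd (P ! v)"
    by (auto simp: list_all_iff split: prod.splits)
  then show ?thesis using \<open>v < N\<close> N by (auto simp: position_def square_def pt_def)
qed

lemma lane_in_square:
  assumes "t \<le> 1" "i \<le> 2 * k + 1"
  shows "p (vx t i) \<in> square"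
proof -
  have "(vx 0 i, vx 1 i) \<in> ladder N k" using assms by (auto simp: ladder_def)
  moreover have "t = 0 \<or> t = 1" using assms by auto
  then have "p (vx t i) \<in> closed_segment (p (vx 0 i)) (p (vx 1 i))" by auto
  ultimately show ?thesis using ladder_in_square by blast
qed

lemma position_inj: "inj_on p {..<N + 4 * k}"
proof (rule inj_onI)
  fix u v assume u: "u \<in> {..<N + 4 * k}" and v: "v \<in> {..<N + 4 * k}" and eq: "p u = p v"
  have "u < N + 4 * k" "v < N + 4 * k" using u v by auto
  from this(1) show "u = v"
  proof (cases rule: vertex_cases)
    case outer
    from \<open>v < N + 4 * k\<close> show ?thesis
    proof (cases rule: vertex_cases)
      case v: outer
      have "u < N" "v < N" using outer v by auto
      then have "pt (P ! u) = pt (P ! v)" using eq N by (simp add: position_def)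
      then have "P ! u = P ! v" by (simp add: pt_def prod_eq_iff)
      moreover have "distinct P" using cert by (simp add: drawing_certificate_def)
      ultimately show ?thesis using \<open>u < N\<close> \<open>v < N\<close> N by (simp add: nth_eq_iff_index_eq)
    next
      case (lane t i)
      then show ?thesis using outer_not_in_square[OF outer] lane_in_square eq by auto
    qed
  next
    case u: (lane t i)
    from \<open>v < N + 4 * k\<close> show ?thesis
    proof (cases rule: vertex_cases)
      case outer
      then show ?thesis using outer_not_in_square[OF outer] lane_in_square[OF u(1,2)] u(3) eq by auto
    next
      case (lane t' i')
      have "real i = real i'" "20 * real t = 20 * real t'"
        using eq u lane col_lane Im_lane by metis+
      then show ?thesis using u lane by simp
    qed
  qed
qed

lemma edges_proper:
  assumes "(u, v) \<in> set B \<union> ladder N k"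
  shows "u < N + 4 * k \<and> v < N + 4 * k \<and> u \<noteq> v"
proof -
  have lane_lt: "vx t i < N + 4 * k" if "t \<le> 1" "i \<le> 2 * k + 1" for t i
    using that N by (auto simp: lane_def)
  have B: "list_all (\<lambda>(u, v). u < N \<and> v < N \<and> u \<noteq> v) B"
    using cert by (auto simp: drawing_certificate_def)
  show ?thesis
    using assms
  proof
    assume "(u, v) \<in> ladder N k"
    then show ?thesis
    proof (cases rule: ladder_cases)
      case (rail t i)
      then have "p u \<noteq> p v" using col_lane[of t i] col_lane[of t "i + 1"] by auto
      then show ?thesis using rail lane_lt by auto
    next
      case (rung i)
      then have "p u \<noteq> p v" using Im_lane[of 0 i] Im_lane[of 1 i] by auto
      then show ?thesis using rung lane_lt by auto
    qed
  qed (use B in \<open>force simp: list_all_iff\<close>)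
qed

lemma drawing_planar: "planar {..<N + 4 * k} (linked (set B \<union> ladder N k))"
proof (rule planar_straight[where p = p])
  have B: "list_all (\<lambda>(u, v). u < N \<and> v < N \<and> u \<noteq> v) B"
    and seg: "sorted_wrt noncrossing (segments P B)" "list_all clear_of_square (segments P B)"
    and nb: "list_all (\<lambda>v. neighbours B v \<noteq> []) [2..<N - 2]"
    using cert by (auto simp: drawing_certificate_def)
  have pB: "p u = pt (P ! u)" if "u < N" for u using that N by (simp add: position_def)
  have BN: "u < N \<and> v < N \<and> u \<noteq> v" if "(u, v) \<in> set B" for u v
    using B that by (auto simp: list_all_iff)
  show "u \<in> {..<N + 4 * k} \<and> v \<in> {..<N + 4 * k} \<and> u \<noteq> v"
    if "(u, v) \<in> set B \<union> ladder N k" for u v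
    using edges_proper[OF that] by simp
  show "inj_on p {..<N + 4 * k}" by (rule position_inj)
  show "\<exists>x. linked (set B \<union> ladder N k) z x" if "z \<in> {..<N + 4 * k}" for z
  proof -
    have "z < N + 4 * k" using that by simp
    then show ?thesis
    proof (cases rule: vertex_cases)
      case outer
      then have "neighbours B z \<noteq> []" using nb by (auto simp: list_all_iff)
      then obtain x where "x \<in> set (neighbours B z)" by (cases "neighbours B z") auto
      then show ?thesis by (auto simp: set_neighbours linked_simps)
    next
      case (lane t i)
      then have "t = 0 \<or> t = 1" "(vx 0 i, vx 1 i) \<in> ladder N k" by (auto simp: ladder_def)
      then show ?thesis using lane by (auto simp: linked_def)
    qed
  qed
  \<comment> \<open>A common point lies in the square, hence is an end of the start-graph edge.
    Outer vertices are not in the square, so that end is a ladder vertex, and a ladder vertex on a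
    ladder edge is one of its ends.\<close>
  have BL: "closed_segment (p u) (p v) \<inter> closed_segment (p x) (p y) \<subseteq> p ` ({u, v} \<inter> {x, y})"
    if e: "(u, v) \<in> set B" and f: "(x, y) \<in> ladder N k" for u v x y
  proof
    fix z assume z: "z \<in> closed_segment (p u) (p v) \<inter> closed_segment (p x) (p y)"
    have "((u, P ! u), (v, P ! v)) \<in> set (segments P B)"
      using e by (force simp: segments_def)
    then have "clear_of_square ((u, P ! u), (v, P ! v))"
      using seg(2) unfolding list_all_iff by blast
    moreover have "z \<in> square" using ladder_in_square[OF f] z by blast
    ultimately have "z = p u \<or> z = p v"
      using clear_of_square_sound z pB BN[OF e] by auto
    then obtain c where c: "c \<in> {u, v}" "z = p c" by blast
    then have "c < N + 4 * k" using BN[OF e] by auto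
    then have "c \<in> {x, y}"
    proof (cases rule: vertex_cases)
      case outer
      then show ?thesis using outer_not_in_square \<open>z \<in> square\<close> c by blast
    next
      case (lane t i)
      then show ?thesis using lane_on_ladder[OF f lane(1,2)] c z by blast
    qed
    then show "z \<in> p ` ({u, v} \<inter> {x, y})" using c by blast
  qed
  show "closed_segment (p u) (p v) \<inter> closed_segment (p x) (p y) \<subseteq> p ` ({u, v} \<inter> {x, y})"
    if uv: "(u, v) \<in> set B \<union> ladder N k" and xy: "(x, y) \<in> set B \<union> ladder N k"
      and ne: "{u, v} \<noteq> {x, y}" for u v x y
  proof -
    consider "(u, v) \<in> set B" "(x, y) \<in> set B" | "(u, v) \<in> set B" "(x, y) \<in> ladder N k"
      | "(u, v) \<in> ladder N k" "(x, y) \<in> set B" | "(u, v) \<in> ladder N k" "(x, y) \<in> ladder N k"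
      using uv xy by blast
    then show ?thesis
    proof cases
      case 1
      obtain i j where ij: "i < length B" "B ! i = (u, v)" "j < length B" "B ! j = (x, y)"
        using 1 by (metis in_set_conv_nth)
      have nc: "noncrossing (segments P B ! a) (segments P B ! b)" if "a < b" "b < length B" for a b
        using seg(1) that by (auto simp: sorted_wrt_iff_nth_less segments_def)
      have s: "segments P B ! i = ((u, P ! u), (v, P ! v))" "segments P B ! j = ((x, P ! x), (y, P ! y))"
        using ij by (auto simp: segments_def)
      have "i \<noteq> j" using ij ne by auto
      then consider "i < j" | "j < i" by linarith
      then have "closed_segment (pt (P ! u)) (pt (P ! v)) \<inter> closed_segment (pt (P ! x)) (pt (P ! y))
          \<subseteq> (\<lambda>z. pt (P ! z)) ` ({u, v} \<inter> {x, y})"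
      proof cases
        case 1
        then show ?thesis using nc[OF 1 ij(3)] noncrossing_sound[of u "(!) P" v x y] ne s by simp
      next
        case 2
        then show ?thesis using nc[OF 2 ij(1)] noncrossing_sound[of x "(!) P" y u v] ne s
          by (simp add: Int_commute)
      qed
      moreover have "(\<lambda>z. pt (P ! z)) ` ({u, v} \<inter> {x, y}) = p ` ({u, v} \<inter> {x, y})"
        using pB BN[OF 1(1)] by (intro image_cong) auto
      ultimately show ?thesis using pB BN[OF 1(1)] BN[OF 1(2)] by simp
    next
      case 2
      then show ?thesis using BL by blast
    next
      case 3
      then show ?thesis using BL[OF 3(2,1)] by blast
    next
      case 4
      show ?thesis
      proof
        fix z assume z: "z \<in> closed_segment (p u) (p v) \<inter> closed_segment (p x) (p y)"
        then obtain t i where ti: "t \<le> 1" "i \<le> 2 * k + 1" "z = p (vx t i)"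
          using ladder_meet_lane[OF 4 ne] by blast
        then have "vx t i \<in> {u, v} \<inter> {x, y}"
          using lane_on_ladder[OF 4(1) ti(1,2)] lane_on_ladder[OF 4(2) ti(1,2)] z by blast
        then show "z \<in> p ` ({u, v} \<inter> {x, y})" using ti by blast
      qed
    qed
  qed
qed

end

section \<open>The infinite families\<close>

text \<open>Each stage adds the six edges of one extension, with \<open>m - 2\<close>,
  \<open>m - 1\<close> as the old rung and \<open>m\<close> to \<open>m + 3\<close> as its four new
  vertices. The two rails leading to 0 and 1 are left out because the next extension subdivides
  them.\<close>

primrec open_ladder :: "nat \<Rightarrow> nat \<Rightarrow> (nat \<times> nat) set" where
  "open_ladder N 0 = {(N - 2, N - 1), (0, 1)}"
| "open_ladder N (Suc k) = open_ladder N k \<union>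
     (let m = N + 4 * k
      in {(m - 2, m), (m - 1, m + 1), (m, m + 1), (m, m + 2), (m + 1, m + 3), (m + 2, m + 3)})"

section \<open>The recursive ladder in closed form\<close>

lemma open_ladder_eq:
  assumes "2 \<le> N"
  shows "open_ladder N k = {(0, 1)} \<union> {(N - 2 + 2 * i, N - 2 + 2 * i + 1) | i. i \<le> 2 * k} \<union>
    {(N - 2 + 2 * i + t, N - 2 + 2 * (i + 1) + t) | t i. t \<le> 1 \<and> i < 2 * k}"
proof (induction k)
  case 0
  then show ?case using assms by auto
next
  case (Suc k)
  have 1: "{(N - 2 + 2 * i, N - 2 + 2 * i + 1) | i. i \<le> 2 * Suc k} =
      {(N - 2 + 2 * i, N - 2 + 2 * i + 1) | i. i \<le> 2 * k} \<union>
      {(N - 2 + 2 * i, N - 2 + 2 * i + 1) | i. i = 2 * k + 1 \<or> i = 2 * k + 2}"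
  proof -
    have eq: "i \<le> 2 * Suc k \<longleftrightarrow> i \<le> 2 * k \<or> i = 2 * k + 1 \<or> i = 2 * k + 2" for i by auto
    show ?thesis unfolding eq by blast
  qed
  have 2: "{(N - 2 + 2 * i + t, N - 2 + 2 * (i + 1) + t) | t i. t \<le> 1 \<and> i < 2 * Suc k} =
      {(N - 2 + 2 * i + t, N - 2 + 2 * (i + 1) + t) | t i. t \<le> 1 \<and> i < 2 * k} \<union>
      {(N - 2 + 2 * i + t, N - 2 + 2 * (i + 1) + t) | t i. (t = 0 \<or> t = 1) \<and> (i = 2 * k \<or> i = 2 * k + 1)}"
  proof -
    have eq: "t \<le> 1 \<and> i < 2 * Suc k \<longleftrightarrow>
        t \<le> 1 \<and> i < 2 * k \<or> (t = 0 \<or> t = 1) \<and> (i = 2 * k \<or> i = 2 * k + 1)" for t i :: nat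
      by auto
    show ?thesis unfolding eq by blast
  qed
  have 3: "{(N - 2 + 2 * i, N - 2 + 2 * i + 1) | i. i = 2 * k + 1 \<or> i = 2 * k + 2} =
      {(N + 4 * k, N + 4 * k + 1), (N + 4 * k + 2, N + 4 * k + 3)}"
  proof -
    have "{(N - 2 + 2 * i, N - 2 + 2 * i + 1) | i. i = 2 * k + 1 \<or> i = 2 * k + 2} =
        {(N - 2 + 2 * (2 * k + 1), N - 2 + 2 * (2 * k + 1) + 1),
         (N - 2 + 2 * (2 * k + 2), N - 2 + 2 * (2 * k + 2) + 1)}"
      by blast
    moreover have "N - 2 + 2 * (2 * k + 1) = N + 4 * k" "N - 2 + 2 * (2 * k + 2) = N + 4 * k + 2"
      using assms by auto
    ultimately show ?thesis by (simp add: numeral_3_eq_3)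
  qed
  have 4: "{(N - 2 + 2 * i + t, N - 2 + 2 * (i + 1) + t) | t i.
        (t = 0 \<or> t = 1) \<and> (i = 2 * k \<or> i = 2 * k + 1)} =
      {(N + 4 * k - 2, N + 4 * k), (N + 4 * k - 1, N + 4 * k + 1),
       (N + 4 * k, N + 4 * k + 2), (N + 4 * k + 1, N + 4 * k + 3)}"
  proof -
    have A: "{(N - 2 + 2 * i + t, N - 2 + 2 * (i + 1) + t) | t i.
          (t = 0 \<or> t = 1) \<and> (i = 2 * k \<or> i = 2 * k + 1)} =
        {(N - 2 + 2 * (2 * k) + 0, N - 2 + 2 * (2 * k + 1) + 0),
         (N - 2 + 2 * (2 * k) + 1, N - 2 + 2 * (2 * k + 1) + 1),
         (N - 2 + 2 * (2 * k + 1) + 0, N - 2 + 2 * (2 * k + 1 + 1) + 0),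
         (N - 2 + 2 * (2 * k + 1) + 1, N - 2 + 2 * (2 * k + 1 + 1) + 1)}"
      by blast
    have n: "N - 2 + 2 * (2 * k) = N + 4 * k - 2" "N - 2 + 2 * (2 * k + 1) = N + 4 * k"
      "N - 2 + 2 * (2 * k + 1 + 1) = N + 4 * k + 2" "N + 4 * k - 2 + 1 = N + 4 * k - 1"
      "N + 4 * k + 2 + 1 = N + 4 * k + 3"
      using assms by auto
    show ?thesis unfolding A add_0_right n ..
  qed
  show ?case
    unfolding open_ladder.simps Let_def Suc 1 2 3 4 by blast
qed

text \<open>Reconciles the two views of the graph: the cycle argument builds the ladder stage by
  stage, the drawing places all its rungs at once.\<close>

lemma ladder_eq:
  assumes "2 \<le> N"
  shows "ladder N k = open_ladder N k \<union> {(N + 4 * k - 2, 0), (N + 4 * k - 1, 1)}"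
proof -
  have 1: "{(lane N k 0 i, lane N k 1 i) | i. i \<le> 2 * k + 1} =
      {(0, 1)} \<union> {(N - 2 + 2 * i, N - 2 + 2 * i + 1) | i. i \<le> 2 * k}"
  proof -
    have "{(lane N k 0 i, lane N k 1 i) | i. i \<le> 2 * k + 1} =
        insert (lane N k 0 (2 * k + 1), lane N k 1 (2 * k + 1)) {(lane N k 0 i, lane N k 1 i) | i. i \<le> 2 * k}"
    proof -
      have eq: "i \<le> 2 * k + 1 \<longleftrightarrow> i = 2 * k + 1 \<or> i \<le> 2 * k" for i by auto
      show ?thesis unfolding eq by blast
    qed
    moreover have "{(lane N k 0 i, lane N k 1 i) | i. i \<le> 2 * k} =
        {(N - 2 + 2 * i, N - 2 + 2 * i + 1) | i. i \<le> 2 * k}"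
    proof -
      have "(lane N k 0 i, lane N k 1 i) = (N - 2 + 2 * i, N - 2 + 2 * i + 1)" if "i \<le> 2 * k" for i
        using that by (simp add: lane_def)
      then show ?thesis by (metis (no_types, lifting))
    qed
    ultimately show ?thesis by (simp add: lane_def)
  qed
  have 2: "{(lane N k t i, lane N k t (i + 1)) | t i. t \<le> 1 \<and> i \<le> 2 * k} =
      {(N - 2 + 2 * i + t, N - 2 + 2 * (i + 1) + t) | t i. t \<le> 1 \<and> i < 2 * k} \<union>
      {(N + 4 * k - 2, 0), (N + 4 * k - 1, 1)}"
  proof -
    have "{(lane N k t i, lane N k t (i + 1)) | t i. t \<le> 1 \<and> i \<le> 2 * k} =
        {(lane N k t i, lane N k t (i + 1)) | t i. t \<le> 1 \<and> i < 2 * k} \<union>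
        {(lane N k 0 (2 * k), lane N k 0 (2 * k + 1)), (lane N k 1 (2 * k), lane N k 1 (2 * k + 1))}"
    proof -
      have eq: "t \<le> 1 \<and> i \<le> 2 * k \<longleftrightarrow> t \<le> 1 \<and> i < 2 * k \<or> (t = 0 \<or> t = 1) \<and> i = 2 * k" for t i :: nat
        by auto
      show ?thesis unfolding eq by blast
    qed
    moreover have "{(lane N k t i, lane N k t (i + 1)) | t i. t \<le> 1 \<and> i < 2 * k} =
        {(N - 2 + 2 * i + t, N - 2 + 2 * (i + 1) + t) | t i. t \<le> 1 \<and> i < 2 * k}"
    proof -
      have "(lane N k t i, lane N k t (i + 1)) = (N - 2 + 2 * i + t, N - 2 + 2 * (i + 1) + t)"
        if "i < 2 * k" for t i
        using that by (simp add: lane_def)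
      then show ?thesis by (metis (no_types, lifting))
    qed
    moreover have "lane N k 0 (2 * k) = N + 4 * k - 2" "lane N k 1 (2 * k) = N + 4 * k - 1"
      using assms by (auto simp: lane_def)
    ultimately show ?thesis by (simp add: lane_def)
  qed
  show ?thesis unfolding ladder_def 1 2 open_ladder_eq[OF assms] by blast
qed

text \<open>The ladder grows at one end: the outermost new rung becomes the rung ab of the next
  stage, while cd stays the edge between 0 and 1.\<close>

lemma family_extensible:
  assumes "cycle_certificate N B us us' zss zs zs'"
  shows "extensible {..<N + 4 * k} (linked (set B \<union> open_ladder N k))
    (N + 4 * k - 2) (N + 4 * k - 1) 0 1 2"
proof (induction k)
  case 0
  have "set B \<union> open_ladder N 0 = set ((N - 2, N - 1) # (0, 1) # B)" by auto
  then show ?case using extensible_base[OF assms] by simp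
next
  case (Suc k)
  let ?m = "N + 4 * k"
  have V: "{..<N + 4 * Suc k} = {..<?m} \<union> {?m, ?m + 1, ?m + 2, ?m + 3}" by auto
  have ab: "N + 4 * Suc k - 2 = ?m + 2" "N + 4 * Suc k - 1 = ?m + 3" by auto
  have "extensible ({..<?m} \<union> {?m, ?m + 1, ?m + 2, ?m + 3})
      (linked (set B \<union> open_ladder N (Suc k))) (?m + 2) (?m + 3) 0 1 2"
    by (rule extensible_step[OF Suc]) (auto simp: linked_simps Let_def)
  then show ?case unfolding V ab .
qed

section \<open>From the invariant to the graphs\<close>

lemma cyc_connected:
  assumes "cyc U C" "u \<in> U" "v \<in> U"
  shows "C\<^sup>*\<^sup>* u v"
proof -
  obtain ws where ws: "set (u # ws) = U" "2 \<le> length ws"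
    "C = linked (insert (last ws, u) (insert (u, hd ws) (set (steps ws))))"
    using cyc_start[OF assms(1,2)] by metis
  have st: "set (steps (u # ws)) \<subseteq> {(x, y). C x y}"
    using ws(2,3) by (cases ws) (auto simp: linked_def)
  have "C\<^sup>*\<^sup>* x v" if "set (steps (x # ys)) \<subseteq> {(x, y). C x y}" "v \<in> set (x # ys)" for x ys
    using that
  proof (induction ys arbitrary: x)
    case (Cons y ys)
    show ?case
    proof (cases "v = x")
      case False
      then have "C\<^sup>*\<^sup>* y v" using Cons by simp
      moreover have "C x y" using Cons.prems by simp
      ultimately show ?thesis by (meson converse_rtranclp_into_rtranclp)
    qed simp
  qed simp
  then show ?thesis using st ws(1) assms(3) by blast
qed

lemma almost_hypohamiltonian_family:
  assumes cyc_cert: "cycle_certificate N B us us' zss zs zs'"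
    and draw_cert: "drawing_certificate N B P"
    and deg: "length (filter (\<lambda>u. u \<in> set (neighbours B 2)) [0..<N]) = 3"
  shows "\<exists>V E w. simple_graph V E \<and> connected_graph V E \<and> card V = N + 4 * k \<and> planar V E \<and>
    almost_hypohamiltonian_exc V E w \<and> degree V E w = 3"
proof -
  interpret drawing N k B P using draw_cert by unfold_locales
  let ?V = "{..<N + 4 * k}" and ?E = "linked (set B \<union> ladder N k)"
  let ?R = "linked (set B \<union> open_ladder N k)"
  let ?a = "N + 4 * k - 2" and ?b = "N + 4 * k - 1"
  have ext: "extensible ?V ?R ?a ?b 0 1 2" using family_extensible[OF cyc_cert] .
  have E: "?E u v \<longleftrightarrow> ?R u v \<or> edge ?a 0 u v \<or> edge ?b 1 u v" for u v
  proof -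
    have "ladder N k = open_ladder N k \<union> {(?a, 0), (?b, 1)}" using ladder_eq N by simp
    then show ?thesis by (auto simp: linked_simps)
  qed
  have ham: "hamiltonian U ?E \<longleftrightarrow> (\<exists>C. cyc U C \<and> (\<forall>u v. C u v \<longrightarrow> ?E u v))" for U
    by (rule hamiltonian_iff_cyc) (use linked_sym in blast)
  have del: "hamiltonian (?V - {x}) ?E" if "x \<in> ?V" "x \<noteq> 2" for x
  proof -
    have "\<forall>x\<in>?V. x \<noteq> 2 \<longrightarrow> (\<exists>C. cyc (?V - {x}) C \<and>
        (\<forall>u v. C u v \<longrightarrow> ?R u v \<or> edge ?a 0 u v \<or> edge ?b 1 u v) \<and>
        (C ?a 0 \<or> C ?b 1 \<or> C ?a ?b \<or> C 0 1))"
      using ext unfolding extensible_def by (elim conjE)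
    from bspec[OF this that(1), rule_format, OF that(2)]
    obtain C where "cyc (?V - {x}) C"
      "\<forall>u v. C u v \<longrightarrow> ?R u v \<or> edge ?a 0 u v \<or> edge ?b 1 u v"
      by (elim exE conjE)
    then have "cyc (?V - {x}) C \<and> (\<forall>u v. C u v \<longrightarrow> ?E u v)" unfolding E by (rule conjI)
    then show ?thesis unfolding ham by blast
  qed
  have ah: "almost_hypohamiltonian_exc ?V ?E 2"
    unfolding almost_hypohamiltonian_exc_def
  proof (intro conjI ballI impI)
    show "\<not> hamiltonian ?V ?E"
      using ext unfolding extensible_def ham E by (elim conjE)
    show "\<not> hamiltonian (?V - {2}) ?E"
      using ext unfolding extensible_def ham E by (elim conjE)
    show "2 \<in> ?V" using N by simp
  qed (use del in blast)
  have proper: "u \<in> ?V \<and> v \<in> ?V \<and> u \<noteq> v" if "?E u v" for u v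
    using that edges_proper by (auto simp: linked_def)
  then have simple: "simple_graph ?V ?E"
    unfolding simple_graph_def using linked_sym by blast
  have conn: "connected_graph ?V ?E"
    unfolding connected_graph_def
  proof (intro conjI ballI)
    show "?V \<noteq> {}" using N by (simp add: lessThan_empty_iff)
    fix u v assume uv: "u \<in> ?V" "v \<in> ?V"
    \<comment> \<open>Connectivity comes from hamiltonicity: a vertex other than \<open>u\<close>,
      \<open>v\<close> and 2 can be deleted, and the remaining Hamiltonian cycle joins
      \<open>u\<close> to \<open>v\<close>.\<close>
    have "card {u, v, 2} < card ?V" using N by (auto simp: card_insert_if)
    then obtain x where x: "x \<in> ?V" "x \<notin> {u, v, 2}"
      by (metis card_mono finite.emptyI finite.insertI not_le subsetI)
    then obtain C where C: "cyc (?V - {x}) C" "\<And>u v. C u v \<Longrightarrow> ?E u v"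
      using del ham by blast
    have "C\<^sup>*\<^sup>* u v" using cyc_connected[OF C(1)] uv x by blast
    then show "(\<lambda>x y. x \<in> ?V \<and> y \<in> ?V \<and> ?E x y)\<^sup>*\<^sup>* u v"
      by (rule rtranclp_mono[THEN predicate2D, rotated]) (use C(2) proper in blast)
  qed
  \<comment> \<open>The exceptional vertex 2 is off the ladder, so its degree is the same for every
    \<open>k\<close> and is read off from \<open>B\<close>.\<close>
  have "{u \<in> ?V. ?E 2 u} = set (filter (\<lambda>u. u \<in> set (neighbours B 2)) [0..<N])"
  proof -
    have "\<not> linked (ladder N k) 2 u" for u
      using N by (auto simp: linked_def ladder_def lane_def split: if_splits)
    moreover have "linked (set B) 2 u \<Longrightarrow> u < N \<and> u < N + 4 * k" for u
      using draw_cert by (force simp: drawing_certificate_def linked_def list_all_iff)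
    ultimately show ?thesis by (auto simp: linked_simps set_neighbours)
  qed
  then have "degree ?V ?E 2 = 3"
    unfolding degree_def using deg by (metis distinct_card distinct_filter distinct_upt)
  then show ?thesis
    using simple conn drawing_planar ah card_lessThan by blast
qed

section \<open>The four start graphs\<close>

text \<open>The 53 edges listed and the four of \<open>quad\<close> make 57, as required by 22
  pentagons and one quadrilateral. The cubic vertex of the quadrilateral is 34, a neighbour of
  2.\<close>

definition edges36 :: "(nat \<times> nat) list" where
  "edges36 =
   [(0, 5), (0, 9), (1, 16), (1, 17), (2, 3), (2, 4), (2, 34), (3, 5), (3, 6), (4, 7), (4, 8),
    (5, 11), (6, 8), (6, 12), (7, 13), (7, 14), (7, 35), (8, 15), (9, 18), (9, 19), (10, 20),
    (10, 21), (10, 35), (11, 12), (11, 18), (12, 22), (13, 15), (13, 23), (14, 20), (14, 24),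
    (15, 22), (16, 19), (16, 25), (17, 21), (17, 26), (18, 27), (19, 23), (20, 28), (21, 29),
    (22, 27), (23, 24), (23, 27), (23, 30), (24, 31), (25, 26), (25, 30), (26, 32), (28, 29),
    (28, 31), (29, 32), (30, 33), (31, 33), (32, 33)]"

text \<open>The first two and last two entries are the corners of the square, which is left empty as
  the quadrilateral face.\<close>

definition points36 :: "(int \<times> int) list" where
  "points36 =
   [(20, 0), (20, 20), (-16, -5), (-24, -15), (-23, 2), (-17, -22), (-38, -19), (-16, 17),
    (-37, -8), (71, -12), (-1, 25), (-48, -50), (-55, -34), (-30, 20), (-13, 28), (-48, -7),
    (45, 46), (12, 27), (-72, -94), (99, 76), (-6, 28), (4, 28), (-78, -32), (-26, 49),
    (-15, 37), (17, 41), (11, 34), (-132, -57), (-4, 32), (1, 31), (-4, 42), (-7, 35), (3, 34),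
    (-3, 37), (0, 0), (0, 20)]"

definition cycles36 :: "nat list list" where
  "cycles36 =
   [[1, 16, 19, 9, 18, 11, 5, 3, 6, 12, 22, 27, 23, 24, 31, 28, 29, 32, 33, 30, 25, 26, 17, 21,
     10, 20, 14, 7, 13, 15, 8, 4, 2, 34, 35],
    [0, 5, 3, 2, 4, 7, 13, 23, 27, 22, 15, 8, 6, 12, 11, 18, 9, 19, 16, 25, 30, 33, 31, 24, 14,
     20, 28, 29, 32, 26, 17, 21, 10, 35, 34],
    [1, 0, 5, 11, 12, 6, 8, 15, 22, 27, 18, 9, 19, 16, 25, 26, 17, 21, 10, 20, 14, 24, 31, 28,
     29, 32, 33, 30, 23, 13, 7, 4, 2, 34, 35],
    [0, 1, 16, 25, 30, 33, 31, 24, 14, 20, 28, 29, 32, 26, 17, 21, 10, 35, 7, 13, 15, 8, 6, 12,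
     22, 27, 23, 19, 9, 18, 11, 5, 3, 2, 34],
    [1, 0, 9, 19, 16, 25, 26, 17, 21, 10, 20, 14, 24, 31, 28, 29, 32, 33, 30, 23, 13, 7, 4, 8,
     15, 22, 27, 18, 11, 12, 6, 3, 2, 34, 35],
    [0, 1, 16, 19, 9, 18, 27, 22, 12, 11, 5, 3, 2, 4, 8, 15, 13, 7, 14, 20, 28, 29, 32, 33, 31,
     24, 23, 30, 25, 26, 17, 21, 10, 35, 34],
    [0, 1, 35, 10, 20, 14, 24, 31, 28, 29, 21, 17, 26, 32, 33, 30, 25, 16, 19, 9, 18, 11, 5, 3,
     6, 12, 22, 27, 23, 13, 15, 8, 4, 2, 34],
    [0, 5, 11, 12, 6, 3, 2, 4, 7, 13, 15, 22, 27, 18, 9, 19, 16, 1, 17, 21, 29, 28, 31, 33, 32,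
     26, 25, 30, 23, 24, 14, 20, 10, 35, 34],
    [0, 5, 3, 2, 4, 8, 6, 12, 11, 18, 27, 22, 15, 13, 7, 14, 20, 10, 21, 17, 26, 25, 30, 33, 32,
     29, 28, 31, 24, 23, 19, 16, 1, 35, 34],
    [0, 5, 3, 2, 4, 8, 6, 12, 11, 18, 9, 19, 16, 1, 17, 21, 29, 28, 20, 14, 24, 31, 33, 32, 26,
     25, 30, 23, 27, 22, 15, 13, 7, 35, 34],
    [0, 5, 3, 2, 4, 7, 13, 15, 8, 6, 12, 22, 27, 18, 9, 19, 16, 1, 17, 21, 29, 28, 31, 33, 32,
     26, 25, 30, 23, 24, 14, 20, 10, 35, 34],
    [0, 1, 16, 25, 30, 33, 31, 24, 14, 20, 28, 29, 32, 26, 17, 21, 10, 35, 7, 13, 15, 22, 27, 23,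
     19, 9, 18, 11, 5, 3, 6, 8, 4, 2, 34],
    [0, 1, 16, 19, 9, 18, 27, 22, 15, 8, 6, 12, 11, 5, 3, 2, 4, 7, 14, 20, 28, 29, 32, 33, 31,
     24, 23, 30, 25, 26, 17, 21, 10, 35, 34],
    [0, 1, 35, 10, 20, 28, 29, 21, 17, 26, 32, 33, 31, 24, 23, 30, 25, 16, 19, 9, 18, 27, 22, 12,
     11, 5, 3, 6, 8, 15, 13, 7, 4, 2, 34],
    [0, 1, 16, 25, 30, 33, 31, 24, 14, 20, 28, 29, 32, 26, 17, 21, 10, 35, 7, 13, 23, 19, 9, 18,
     27, 22, 12, 11, 5, 3, 6, 8, 4, 2, 34],
    [0, 5, 3, 2, 4, 8, 6, 12, 11, 18, 9, 19, 23, 27, 22, 15, 13, 7, 14, 24, 31, 28, 20, 10, 21,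
     29, 32, 33, 30, 25, 26, 17, 1, 35, 34],
    [0, 1, 16, 19, 9, 18, 11, 5, 3, 2, 4, 7, 13, 15, 8, 6, 12, 22, 27, 23, 24, 14, 20, 28, 31,
     33, 30, 25, 26, 32, 29, 21, 10, 35, 34],
    [1, 0, 9, 19, 16, 25, 26, 17, 21, 10, 20, 14, 24, 31, 28, 29, 32, 33, 30, 23, 27, 22, 12, 11,
     5, 3, 6, 8, 15, 13, 7, 4, 2, 34, 35],
    [0, 9, 18, 11, 5, 3, 2, 4, 7, 13, 15, 8, 6, 12, 22, 27, 23, 24, 14, 20, 10, 21, 17, 26, 32,
     29, 28, 31, 33, 30, 25, 16, 1, 35, 34],
    [0, 1, 35, 10, 21, 17, 26, 25, 16, 19, 9, 18, 11, 5, 3, 6, 12, 22, 27, 23, 30, 33, 32, 29,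
     28, 31, 24, 14, 7, 13, 15, 8, 4, 2, 34],
    [0, 1, 17, 26, 25, 16, 19, 9, 18, 11, 5, 3, 2, 4, 7, 13, 15, 8, 6, 12, 22, 27, 23, 30, 33,
     32, 29, 28, 31, 24, 14, 20, 10, 35, 34],
    [0, 5, 11, 12, 6, 3, 2, 4, 8, 15, 13, 7, 14, 20, 10, 21, 17, 26, 25, 30, 33, 32, 29, 28, 31,
     24, 23, 27, 18, 9, 19, 16, 1, 35, 34],
    [0, 1, 35, 10, 20, 14, 24, 31, 28, 29, 21, 17, 26, 32, 33, 30, 25, 16, 19, 9, 18, 27, 22, 12,
     11, 5, 3, 6, 8, 15, 13, 7, 4, 2, 34],
    [0, 1, 17, 26, 32, 29, 21, 10, 35, 7, 14, 20, 28, 31, 33, 30, 25, 16, 19, 9, 18, 11, 5, 3, 6,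
     12, 22, 27, 23, 13, 15, 8, 4, 2, 34],
    [0, 1, 16, 19, 9, 18, 11, 5, 3, 2, 4, 7, 13, 15, 8, 6, 12, 22, 27, 23, 30, 33, 31, 24, 14,
     20, 28, 29, 32, 26, 17, 21, 10, 35, 34],
    [0, 5, 3, 2, 4, 7, 13, 23, 27, 22, 15, 8, 6, 12, 11, 18, 9, 19, 16, 25, 30, 33, 32, 29, 28,
     31, 24, 14, 20, 10, 21, 17, 1, 35, 34],
    [0, 1, 16, 19, 9, 18, 11, 5, 3, 2, 4, 8, 6, 12, 22, 15, 13, 7, 14, 20, 28, 29, 32, 33, 31,
     24, 23, 30, 25, 26, 17, 21, 10, 35, 34],
    [0, 1, 16, 19, 9, 18, 11, 5, 3, 2, 4, 7, 13, 15, 8, 6, 12, 22, 27, 23, 30, 25, 26, 17, 21,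
     29, 32, 33, 31, 24, 14, 20, 10, 35, 34],
    [0, 1, 35, 7, 14, 24, 31, 28, 20, 10, 21, 17, 26, 32, 33, 30, 25, 16, 19, 9, 18, 11, 5, 3, 6,
     12, 22, 27, 23, 13, 15, 8, 4, 2, 34],
    [0, 1, 17, 21, 29, 28, 20, 10, 35, 7, 14, 24, 31, 33, 32, 26, 25, 16, 19, 9, 18, 11, 5, 3, 6,
     12, 22, 27, 23, 13, 15, 8, 4, 2, 34],
    [0, 1, 16, 19, 9, 18, 11, 5, 3, 2, 4, 7, 13, 15, 8, 6, 12, 22, 27, 23, 24, 14, 20, 28, 29,
     32, 33, 30, 25, 26, 17, 21, 10, 35, 34],
    [0, 1, 17, 26, 25, 16, 19, 9, 18, 11, 5, 3, 2, 4, 7, 13, 15, 8, 6, 12, 22, 27, 23, 30, 33,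
     31, 24, 14, 20, 28, 29, 21, 10, 35, 34],
    [0, 5, 3, 2, 4, 8, 6, 12, 11, 18, 9, 19, 16, 1, 17, 21, 10, 20, 14, 24, 31, 28, 29, 32, 26,
     25, 30, 23, 27, 22, 15, 13, 7, 35, 34],
    [1, 0, 5, 3, 2, 4, 7, 13, 23, 27, 22, 15, 8, 6, 12, 11, 18, 9, 19, 16, 25, 30, 33, 31, 24,
     14, 20, 28, 29, 32, 26, 17, 21, 10, 35],
    [0, 1, 16, 19, 9, 18, 11, 5, 3, 6, 12, 22, 27, 23, 24, 31, 28, 29, 32, 33, 30, 25, 26, 17,
     21, 10, 20, 14, 7, 13, 15, 8, 4, 2, 34]]"

text \<open>The two lists before \<open>cycles36\<close> are elimination orders; soundness holds for
  any order, and the choice governs the number of states. The two lists after it close along the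
  diagonals from 35 to 0 and from 34 to 1.\<close>

lemma cycle_certificate_36:
  "cycle_certificate 36 edges36
   [31, 28, 24, 20, 14, 10, 21, 29, 32, 33, 26, 30, 25, 17, 16, 19, 1, 35, 9, 34, 0, 7, 13, 23,
    27, 18, 11, 5, 22, 12, 15, 3, 4, 6, 8, 2]
   [3, 4, 8, 6, 15, 12, 22, 11, 5, 27, 13, 18, 34, 9, 19, 23, 30, 24, 0, 25, 16, 1, 17, 26, 32,
    21, 33, 29, 31, 28, 20, 14, 10, 7, 35]
   cycles36
   [0, 1, 16, 19, 9, 18, 11, 5, 3, 6, 12, 22, 27, 23, 24, 31, 28, 29, 32, 33, 30, 25, 26, 17, 21,
    10, 20, 14, 7, 13, 15, 8, 4, 2, 34, 35]
   [1, 0, 5, 3, 2, 4, 7, 13, 23, 27, 22, 15, 8, 6, 12, 11, 18, 9, 19, 16, 25, 30, 33, 31, 24, 14,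
    20, 28, 29, 32, 26, 17, 21, 10, 35, 34]"
  by code_simp

lemma drawing_certificate_36: "drawing_certificate 36 edges36 points36"
  by code_simp

lemma exceptional_degree_36: "length (filter (\<lambda>u. u \<in> set (neighbours edges36 2)) [0..<36]) = 3"
  by code_simp

definition edges39 :: "(nat \<times> nat) list" where
  "edges39 =
   [(0, 5), (0, 9), (1, 15), (1, 16), (2, 3), (2, 4), (2, 37), (3, 5), (3, 6), (4, 7), (4, 8),
    (5, 11), (6, 8), (6, 12), (7, 13), (7, 38), (8, 14), (9, 17), (9, 18), (9, 19), (10, 20),
    (10, 21), (10, 38), (11, 12), (11, 17), (12, 22), (12, 23), (13, 14), (13, 20), (14, 22),
    (15, 21), (15, 24), (16, 19), (16, 25), (17, 26), (18, 27), (18, 28), (19, 29), (20, 30),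
    (21, 31), (22, 30), (23, 26), (23, 31), (24, 25), (24, 32), (25, 33), (26, 27), (27, 34),
    (28, 29), (28, 35), (29, 33), (30, 31), (31, 32), (31, 34), (32, 36), (33, 36), (34, 35),
    (35, 36)]"

definition points39 :: "(int \<times> int) list" where
  "points39 =
   [(20, 0), (20, 20), (-28, -18), (-60, -66), (-23, 13), (36, -50), (-66, 36), (-9, 24),
    (-33, 32), (33, 30), (7, 34), (89, 62), (27, 115), (-5, 38), (-9, 48), (19, 32), (24, 28),
    (53, 50), (31, 39), (28, 31), (5, 43), (16, 39), (10, 73), (29, 75), (22, 36), (24, 34),
    (38, 58), (32, 48), (28, 39), (27, 36), (12, 56), (21, 52), (22, 43), (25, 37), (26, 48),
    (26, 43), (25, 41), (0, 0), (0, 20)]"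

definition cycles39 :: "nat list list" where
  "cycles39 =
   [[1, 15, 21, 10, 20, 30, 22, 12, 23, 26, 27, 18, 28, 29, 33, 36, 35, 34, 31, 32, 24, 25, 16,
     19, 9, 17, 11, 5, 3, 6, 8, 14, 13, 7, 4, 2, 37, 38],
    [0, 5, 3, 2, 4, 7, 13, 20, 30, 22, 14, 8, 6, 12, 11, 17, 9, 18, 27, 26, 23, 31, 34, 35, 28,
     29, 19, 16, 25, 33, 36, 32, 24, 15, 21, 10, 38, 37],
    [1, 0, 5, 11, 12, 6, 8, 14, 22, 30, 31, 23, 26, 17, 9, 18, 27, 34, 35, 28, 29, 19, 16, 25,
     33, 36, 32, 24, 15, 21, 10, 20, 13, 7, 4, 2, 37, 38],
    [0, 1, 15, 21, 10, 38, 7, 13, 20, 30, 22, 14, 8, 6, 12, 23, 26, 27, 18, 28, 29, 33, 36, 35,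
     34, 31, 32, 24, 25, 16, 19, 9, 17, 11, 5, 3, 2, 37],
    [1, 0, 9, 17, 11, 12, 23, 26, 27, 18, 28, 29, 19, 16, 25, 33, 36, 35, 34, 31, 32, 24, 15, 21,
     10, 20, 30, 22, 14, 13, 7, 4, 8, 6, 3, 2, 37, 38],
    [0, 1, 15, 21, 10, 20, 30, 22, 12, 23, 26, 27, 18, 28, 29, 33, 36, 35, 34, 31, 32, 24, 25,
     16, 19, 9, 17, 11, 5, 3, 2, 4, 8, 14, 13, 7, 38, 37],
    [0, 1, 38, 10, 20, 13, 14, 22, 30, 31, 21, 15, 24, 32, 36, 33, 25, 16, 19, 29, 28, 35, 34,
     27, 18, 9, 17, 26, 23, 12, 11, 5, 3, 6, 8, 4, 2, 37],
    [0, 5, 11, 12, 6, 3, 2, 4, 7, 13, 14, 22, 30, 20, 10, 21, 15, 24, 25, 33, 29, 28, 18, 27, 34,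
     35, 36, 32, 31, 23, 26, 17, 9, 19, 16, 1, 38, 37],
    [0, 5, 3, 2, 4, 7, 13, 20, 30, 22, 14, 8, 6, 12, 11, 17, 26, 23, 31, 32, 24, 25, 33, 36, 35,
     34, 27, 18, 28, 29, 19, 16, 1, 15, 21, 10, 38, 37],
    [0, 5, 11, 17, 9, 18, 28, 29, 19, 16, 1, 15, 21, 31, 32, 24, 25, 33, 36, 35, 34, 27, 26, 23,
     12, 6, 3, 2, 4, 8, 14, 22, 30, 20, 13, 7, 38, 37],
    [0, 5, 3, 2, 4, 7, 13, 14, 8, 6, 12, 22, 30, 20, 10, 21, 15, 24, 25, 33, 29, 28, 18, 27, 34,
     35, 36, 32, 31, 23, 26, 17, 9, 19, 16, 1, 38, 37],
    [0, 1, 38, 7, 13, 14, 22, 30, 20, 10, 21, 15, 24, 25, 16, 19, 9, 18, 27, 34, 35, 28, 29, 33,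
     36, 32, 31, 23, 26, 17, 11, 5, 3, 6, 8, 4, 2, 37],
    [0, 1, 15, 21, 10, 20, 30, 22, 14, 8, 6, 12, 23, 26, 27, 18, 28, 29, 33, 36, 35, 34, 31, 32,
     24, 25, 16, 19, 9, 17, 11, 5, 3, 2, 4, 7, 38, 37],
    [0, 1, 15, 21, 10, 38, 7, 13, 20, 30, 22, 12, 23, 26, 27, 18, 28, 29, 33, 36, 35, 34, 31, 32,
     24, 25, 16, 19, 9, 17, 11, 5, 3, 6, 8, 4, 2, 37],
    [0, 1, 16, 19, 9, 17, 11, 5, 3, 2, 4, 7, 13, 20, 30, 22, 14, 8, 6, 12, 23, 26, 27, 18, 28,
     29, 33, 25, 24, 32, 36, 35, 34, 31, 21, 10, 38, 37],
    [0, 5, 11, 12, 23, 26, 17, 9, 19, 29, 28, 18, 27, 34, 35, 36, 33, 25, 24, 32, 31, 21, 15, 1,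
     38, 10, 20, 30, 22, 14, 13, 7, 4, 8, 6, 3, 2, 37],
    [0, 5, 11, 12, 6, 3, 2, 4, 8, 14, 22, 30, 31, 23, 26, 27, 34, 35, 28, 18, 9, 19, 29, 33, 36,
     32, 24, 25, 16, 1, 15, 21, 10, 20, 13, 7, 38, 37],
    [0, 1, 15, 21, 10, 20, 13, 14, 8, 6, 12, 22, 30, 31, 23, 26, 27, 34, 35, 28, 29, 33, 36, 32,
     24, 25, 16, 19, 9, 17, 11, 5, 3, 2, 4, 7, 38, 37],
    [0, 5, 3, 2, 4, 7, 13, 20, 10, 21, 15, 24, 32, 36, 35, 34, 27, 26, 23, 31, 30, 22, 14, 8, 6,
     12, 11, 17, 9, 18, 28, 29, 33, 25, 16, 1, 38, 37],
    [0, 1, 38, 10, 21, 15, 24, 25, 16, 19, 9, 18, 27, 34, 35, 28, 29, 33, 36, 32, 31, 30, 22, 12,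
     23, 26, 17, 11, 5, 3, 6, 8, 14, 13, 7, 4, 2, 37],
    [0, 1, 15, 24, 25, 16, 19, 9, 18, 27, 34, 35, 28, 29, 33, 36, 32, 31, 23, 26, 17, 11, 5, 3,
     2, 4, 7, 13, 14, 8, 6, 12, 22, 30, 20, 10, 38, 37],
    [0, 1, 15, 24, 32, 36, 33, 25, 16, 19, 29, 28, 35, 34, 27, 18, 9, 17, 26, 23, 12, 11, 5, 3,
     6, 8, 14, 13, 20, 30, 31, 21, 10, 38, 7, 4, 2, 37],
    [0, 1, 15, 21, 10, 20, 13, 14, 8, 6, 12, 22, 30, 31, 32, 24, 25, 16, 19, 9, 18, 28, 29, 33,
     36, 35, 34, 27, 26, 17, 11, 5, 3, 2, 4, 7, 38, 37],
    [0, 5, 11, 12, 23, 26, 17, 9, 18, 27, 34, 35, 28, 29, 19, 16, 25, 33, 36, 32, 31, 21, 15, 1,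
     38, 10, 20, 30, 22, 14, 13, 7, 4, 8, 6, 3, 2, 37],
    [0, 1, 16, 19, 9, 17, 11, 5, 3, 2, 4, 7, 13, 20, 30, 22, 14, 8, 6, 12, 23, 26, 27, 18, 28,
     29, 33, 36, 35, 34, 31, 32, 24, 15, 21, 10, 38, 37],
    [0, 1, 15, 24, 32, 36, 33, 25, 16, 19, 29, 28, 35, 34, 27, 18, 9, 17, 11, 5, 3, 2, 4, 7, 13,
     20, 30, 22, 14, 8, 6, 12, 23, 31, 21, 10, 38, 37],
    [0, 1, 38, 7, 13, 14, 22, 30, 20, 10, 21, 15, 24, 25, 16, 19, 29, 33, 36, 32, 31, 34, 35, 28,
     18, 9, 17, 26, 23, 12, 11, 5, 3, 6, 8, 4, 2, 37],
    [0, 1, 16, 25, 33, 29, 19, 9, 18, 27, 26, 17, 11, 5, 3, 2, 4, 7, 13, 20, 30, 22, 14, 8, 6,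
     12, 23, 31, 34, 35, 36, 32, 24, 15, 21, 10, 38, 37],
    [0, 1, 15, 24, 32, 36, 33, 25, 16, 19, 9, 17, 11, 5, 3, 2, 4, 7, 13, 20, 30, 22, 14, 8, 6,
     12, 23, 26, 27, 18, 28, 35, 34, 31, 21, 10, 38, 37],
    [0, 1, 38, 7, 4, 8, 6, 12, 22, 14, 13, 20, 10, 21, 15, 24, 25, 16, 19, 9, 18, 27, 34, 35, 28,
     29, 33, 36, 32, 31, 23, 26, 17, 11, 5, 3, 2, 37],
    [0, 1, 38, 7, 13, 14, 22, 30, 20, 10, 21, 15, 24, 32, 36, 33, 25, 16, 19, 29, 28, 35, 34, 27,
     18, 9, 17, 26, 23, 12, 11, 5, 3, 6, 8, 4, 2, 37],
    [0, 1, 15, 24, 25, 16, 19, 9, 17, 11, 5, 3, 2, 4, 7, 13, 20, 30, 22, 14, 8, 6, 12, 23, 26,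
     27, 18, 28, 29, 33, 36, 35, 34, 31, 21, 10, 38, 37],
    [0, 1, 15, 21, 10, 20, 13, 14, 8, 6, 12, 22, 30, 31, 23, 26, 27, 34, 35, 36, 32, 24, 25, 16,
     19, 29, 28, 18, 9, 17, 11, 5, 3, 2, 4, 7, 38, 37],
    [0, 1, 15, 24, 32, 36, 35, 28, 29, 33, 25, 16, 19, 9, 18, 27, 26, 17, 11, 5, 3, 2, 4, 7, 13,
     20, 30, 22, 14, 8, 6, 12, 23, 31, 21, 10, 38, 37],
    [0, 1, 15, 24, 32, 36, 33, 25, 16, 19, 29, 28, 18, 9, 17, 11, 5, 3, 2, 4, 7, 13, 20, 30, 22,
     14, 8, 6, 12, 23, 26, 27, 34, 31, 21, 10, 38, 37],
    [0, 1, 16, 25, 33, 29, 19, 9, 17, 11, 5, 3, 2, 4, 7, 13, 20, 30, 22, 14, 8, 6, 12, 23, 26,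
     27, 18, 28, 35, 34, 31, 32, 24, 15, 21, 10, 38, 37],
    [1, 0, 5, 3, 2, 4, 7, 13, 20, 30, 22, 14, 8, 6, 12, 11, 17, 9, 18, 27, 26, 23, 31, 34, 35,
     28, 29, 19, 16, 25, 33, 36, 32, 24, 15, 21, 10, 38],
    [0, 1, 15, 21, 10, 20, 30, 22, 12, 23, 26, 27, 18, 28, 29, 33, 36, 35, 34, 31, 32, 24, 25,
     16, 19, 9, 17, 11, 5, 3, 6, 8, 14, 13, 7, 4, 2, 37]]"

lemma cycle_certificate_39:
  "cycle_certificate 39 edges39
   [27, 18, 28, 35, 34, 36, 29, 33, 32, 19, 25, 24, 16, 15, 21, 31, 23, 26, 17, 9, 1, 11, 0, 5,
    37, 10, 38, 3, 2, 6, 4, 7, 8, 13, 20, 14, 12, 30, 22]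
   [4, 3, 37, 6, 8, 14, 13, 7, 22, 30, 20, 10, 38, 12, 11, 5, 21, 0, 1, 15, 23, 17, 26, 9, 18,
    27, 34, 31, 19, 16, 28, 29, 25, 24, 36, 35, 32, 33]
   cycles39
   [0, 1, 15, 21, 10, 20, 30, 22, 12, 23, 26, 27, 18, 28, 29, 33, 36, 35, 34, 31, 32, 24, 25, 16,
    19, 9, 17, 11, 5, 3, 6, 8, 14, 13, 7, 4, 2, 37, 38]
   [1, 0, 5, 3, 2, 4, 7, 13, 20, 30, 22, 14, 8, 6, 12, 11, 17, 9, 18, 27, 26, 23, 31, 34, 35, 28,
    29, 19, 16, 25, 33, 36, 32, 24, 15, 21, 10, 38, 37]"
  by code_simp

lemma drawing_certificate_39: "drawing_certificate 39 edges39 points39"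
  by code_simp

lemma exceptional_degree_39: "length (filter (\<lambda>u. u \<in> set (neighbours edges39 2)) [0..<39]) = 3"
  by code_simp

text \<open>Here the cubic vertex of the quadrilateral is \<open>N - 1\<close> = 41, whereas it is
  \<open>N - 2\<close> in the other three start graphs.\<close>

definition edges42 :: "(nat \<times> nat) list" where
  "edges42 =
   [(0, 15), (0, 16), (1, 7), (1, 10), (2, 3), (2, 4), (2, 41), (3, 5), (3, 6), (4, 7), (4, 8),
    (5, 11), (5, 40), (6, 8), (6, 12), (7, 13), (8, 14), (9, 17), (9, 18), (9, 19), (9, 40),
    (10, 20), (10, 21), (11, 12), (11, 17), (12, 22), (12, 23), (13, 14), (13, 20), (14, 22),
    (15, 21), (15, 24), (16, 19), (16, 25), (17, 26), (18, 27), (18, 28), (19, 29), (20, 30),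
    (21, 31), (22, 30), (23, 26), (23, 31), (24, 25), (24, 32), (24, 33), (25, 34), (26, 27),
    (26, 35), (27, 36), (28, 29), (28, 37), (29, 34), (30, 31), (31, 32), (32, 35), (33, 38),
    (33, 39), (34, 39), (35, 38), (36, 37), (36, 38), (37, 39)]"

definition points42 :: "(int \<times> int) list" where
  "points42 =
   [(20, 0), (20, 20), (-12, 61), (-49, 108), (12, 56), (-36, -27), (29, 119), (21, 35),
    (27, 71), (24, -20), (31, 14), (50, -100), (90, -10), (32, 31), (39, 38), (29, -1), (25, -8),
    (39, -48), (30, -18), (26, -14), (37, 18), (35, 4), (59, 13), (60, -12), (33, -7), (29, -9),
    (44, -23), (36, -19), (31, -16), (29, -14), (47, 10), (45, -2), (39, -8), (34, -11),
    (30, -12), (40, -15), (35, -16), (33, -15), (36, -14), (32, -13), (0, 0), (0, 20)]"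

definition cycles42 :: "nat list list" where
  "cycles42 =
   [[1, 7, 4, 2, 3, 5, 11, 17, 26, 23, 31, 30, 22, 12, 6, 8, 14, 13, 20, 10, 21, 15, 24, 32, 35,
     38, 33, 39, 34, 25, 16, 19, 29, 28, 37, 36, 27, 18, 9, 40, 41],
    [0, 15, 21, 10, 20, 30, 22, 12, 23, 31, 32, 24, 25, 16, 19, 9, 18, 27, 36, 37, 28, 29, 34,
     39, 33, 38, 35, 26, 17, 11, 5, 3, 6, 8, 14, 13, 7, 4, 2, 41, 40],
    [0, 1, 41, 2, 4, 7, 13, 14, 8, 6, 12, 22, 30, 20, 10, 21, 15, 24, 25, 16, 19, 9, 18, 27, 36,
     37, 28, 29, 34, 39, 33, 38, 35, 32, 31, 23, 26, 17, 11, 5, 40],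
    [0, 1, 7, 13, 14, 8, 6, 12, 22, 30, 20, 10, 21, 15, 24, 25, 16, 19, 9, 18, 27, 36, 37, 28,
     29, 34, 39, 33, 38, 35, 32, 31, 23, 26, 17, 11, 5, 3, 2, 41, 40],
    [0, 1, 41, 2, 3, 6, 8, 4, 7, 13, 14, 22, 12, 11, 17, 26, 23, 31, 30, 20, 10, 21, 15, 24, 32,
     35, 38, 33, 39, 34, 25, 16, 19, 29, 28, 37, 36, 27, 18, 9, 40],
    [0, 1, 7, 4, 8, 14, 13, 20, 10, 21, 15, 24, 25, 16, 19, 9, 18, 27, 36, 37, 28, 29, 34, 39,
     33, 38, 35, 32, 31, 30, 22, 12, 23, 26, 17, 11, 5, 3, 2, 41, 40],
    [0, 1, 10, 20, 13, 14, 22, 30, 31, 21, 15, 24, 32, 35, 38, 33, 39, 34, 25, 16, 19, 29, 28,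
     37, 36, 27, 18, 9, 17, 26, 23, 12, 11, 5, 3, 6, 8, 4, 2, 41, 40],
    [0, 1, 41, 2, 4, 7, 13, 14, 22, 12, 6, 3, 5, 11, 17, 26, 23, 31, 30, 20, 10, 21, 15, 24, 32,
     35, 38, 33, 39, 34, 25, 16, 19, 29, 28, 37, 36, 27, 18, 9, 40],
    [1, 7, 4, 2, 3, 6, 8, 14, 13, 20, 10, 21, 15, 0, 16, 19, 29, 28, 18, 27, 36, 37, 39, 34, 25,
     24, 33, 38, 35, 32, 31, 30, 22, 12, 23, 26, 17, 11, 5, 40, 41],
    [1, 7, 4, 2, 3, 6, 8, 14, 13, 20, 30, 22, 12, 23, 26, 27, 18, 28, 29, 34, 25, 24, 33, 39, 37,
     36, 38, 35, 32, 31, 21, 15, 0, 16, 19, 9, 17, 11, 5, 40, 41],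
    [1, 0, 15, 24, 32, 35, 38, 33, 39, 34, 25, 16, 19, 29, 28, 37, 36, 27, 18, 9, 17, 26, 23, 12,
     6, 8, 14, 22, 30, 31, 21, 10, 20, 13, 7, 4, 2, 3, 5, 40, 41],
    [0, 1, 7, 13, 14, 22, 30, 20, 10, 21, 15, 24, 25, 16, 19, 9, 18, 27, 36, 37, 28, 29, 34, 39,
     33, 38, 35, 32, 31, 23, 26, 17, 11, 5, 3, 6, 8, 4, 2, 41, 40],
    [0, 15, 21, 10, 20, 30, 22, 14, 8, 4, 7, 1, 41, 2, 3, 6, 12, 23, 31, 32, 24, 25, 16, 19, 9,
     18, 27, 36, 37, 28, 29, 34, 39, 33, 38, 35, 26, 17, 11, 5, 40],
    [0, 1, 7, 13, 20, 10, 21, 15, 24, 25, 16, 19, 9, 18, 27, 36, 37, 28, 29, 34, 39, 33, 38, 35,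
     32, 31, 30, 22, 12, 23, 26, 17, 11, 5, 3, 6, 8, 4, 2, 41, 40],
    [0, 16, 19, 9, 17, 11, 5, 3, 2, 4, 7, 13, 20, 30, 22, 14, 8, 6, 12, 23, 26, 27, 18, 28, 29,
     34, 25, 24, 33, 39, 37, 36, 38, 35, 32, 31, 21, 10, 1, 41, 40],
    [1, 0, 15, 21, 10, 20, 13, 7, 4, 2, 3, 5, 11, 17, 26, 23, 12, 6, 8, 14, 22, 30, 31, 32, 35,
     38, 33, 24, 25, 34, 39, 37, 36, 27, 18, 28, 29, 19, 9, 40, 41],
    [0, 1, 41, 2, 3, 5, 11, 12, 6, 8, 4, 7, 13, 14, 22, 30, 20, 10, 21, 15, 24, 25, 16, 19, 29,
     34, 39, 33, 38, 35, 32, 31, 23, 26, 27, 36, 37, 28, 18, 9, 40],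
    [0, 1, 7, 4, 8, 6, 12, 23, 26, 27, 36, 37, 28, 29, 34, 39, 33, 38, 35, 32, 31, 30, 22, 14,
     13, 20, 10, 21, 15, 24, 25, 16, 19, 9, 17, 11, 5, 3, 2, 41, 40],
    [1, 0, 16, 25, 24, 15, 21, 10, 20, 13, 7, 4, 2, 3, 5, 11, 17, 26, 23, 12, 6, 8, 14, 22, 30,
     31, 32, 35, 38, 33, 39, 34, 29, 28, 37, 36, 27, 18, 9, 40, 41],
    [0, 1, 10, 21, 15, 24, 25, 16, 19, 9, 18, 27, 36, 37, 28, 29, 34, 39, 33, 38, 35, 32, 31, 30,
     22, 12, 23, 26, 17, 11, 5, 3, 6, 8, 14, 13, 7, 4, 2, 41, 40],
    [0, 15, 24, 25, 16, 19, 9, 18, 27, 36, 37, 28, 29, 34, 39, 33, 38, 35, 32, 31, 23, 26, 17,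
     11, 5, 3, 2, 4, 7, 13, 14, 8, 6, 12, 22, 30, 20, 10, 1, 41, 40],
    [0, 1, 10, 20, 30, 31, 21, 15, 24, 32, 35, 38, 33, 39, 34, 25, 16, 19, 29, 28, 37, 36, 27,
     18, 9, 17, 26, 23, 12, 11, 5, 3, 6, 8, 14, 13, 7, 4, 2, 41, 40],
    [0, 15, 21, 10, 1, 7, 4, 8, 6, 12, 22, 14, 13, 20, 30, 31, 32, 24, 25, 16, 19, 9, 18, 27, 36,
     37, 28, 29, 34, 39, 33, 38, 35, 26, 17, 11, 5, 3, 2, 41, 40],
    [1, 0, 15, 21, 10, 20, 13, 7, 4, 2, 3, 5, 11, 17, 26, 23, 12, 6, 8, 14, 22, 30, 31, 32, 35,
     38, 33, 39, 34, 25, 16, 19, 29, 28, 37, 36, 27, 18, 9, 40, 41],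
    [0, 16, 19, 9, 17, 11, 5, 3, 2, 4, 7, 13, 20, 30, 22, 14, 8, 6, 12, 23, 31, 32, 35, 26, 27,
     18, 28, 29, 34, 39, 37, 36, 38, 33, 24, 15, 21, 10, 1, 41, 40],
    [0, 1, 7, 4, 8, 6, 12, 23, 31, 30, 22, 14, 13, 20, 10, 21, 15, 24, 32, 35, 38, 33, 39, 34,
     25, 16, 19, 29, 28, 37, 36, 27, 18, 9, 17, 11, 5, 3, 2, 41, 40],
    [0, 1, 7, 4, 8, 6, 12, 23, 26, 35, 32, 31, 30, 22, 14, 13, 20, 10, 21, 15, 24, 25, 16, 19,
     29, 34, 39, 33, 38, 36, 37, 28, 18, 9, 17, 11, 5, 3, 2, 41, 40],
    [0, 16, 25, 34, 29, 19, 9, 18, 27, 26, 17, 11, 5, 3, 2, 4, 7, 13, 20, 30, 22, 14, 8, 6, 12,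
     23, 31, 32, 35, 38, 36, 37, 39, 33, 24, 15, 21, 10, 1, 41, 40],
    [0, 1, 7, 4, 8, 6, 12, 23, 26, 27, 18, 28, 37, 36, 38, 35, 32, 31, 30, 22, 14, 13, 20, 10,
     21, 15, 24, 33, 39, 34, 25, 16, 19, 9, 17, 11, 5, 3, 2, 41, 40],
    [0, 1, 7, 4, 8, 6, 12, 22, 14, 13, 20, 10, 21, 15, 24, 25, 16, 19, 9, 18, 27, 36, 37, 28, 29,
     34, 39, 33, 38, 35, 32, 31, 23, 26, 17, 11, 5, 3, 2, 41, 40],
    [0, 1, 7, 13, 14, 22, 30, 20, 10, 21, 15, 24, 32, 35, 38, 33, 39, 34, 25, 16, 19, 29, 28, 37,
     36, 27, 18, 9, 17, 26, 23, 12, 11, 5, 3, 6, 8, 4, 2, 41, 40],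
    [0, 1, 7, 4, 8, 6, 12, 23, 31, 30, 22, 14, 13, 20, 10, 21, 15, 24, 25, 16, 19, 9, 18, 27, 36,
     37, 28, 29, 34, 39, 33, 38, 35, 26, 17, 11, 5, 3, 2, 41, 40],
    [0, 1, 7, 4, 8, 6, 12, 23, 26, 27, 18, 28, 29, 34, 39, 37, 36, 38, 35, 32, 31, 30, 22, 14,
     13, 20, 10, 21, 15, 24, 25, 16, 19, 9, 17, 11, 5, 3, 2, 41, 40],
    [0, 1, 7, 4, 8, 6, 12, 23, 26, 27, 36, 37, 39, 33, 38, 35, 32, 31, 30, 22, 14, 13, 20, 10,
     21, 15, 24, 25, 16, 19, 29, 28, 18, 9, 17, 11, 5, 3, 2, 41, 40],
    [0, 15, 21, 10, 1, 41, 2, 4, 7, 13, 20, 30, 22, 14, 8, 6, 3, 5, 11, 12, 23, 31, 32, 24, 25,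
     16, 19, 29, 34, 39, 33, 38, 36, 37, 28, 18, 27, 26, 17, 9, 40],
    [0, 1, 7, 4, 8, 6, 12, 23, 31, 30, 22, 14, 13, 20, 10, 21, 15, 24, 32, 35, 38, 33, 39, 37,
     28, 29, 34, 25, 16, 19, 9, 18, 27, 26, 17, 11, 5, 3, 2, 41, 40],
    [0, 1, 7, 4, 8, 6, 12, 23, 26, 27, 36, 38, 35, 32, 31, 30, 22, 14, 13, 20, 10, 21, 15, 24,
     33, 39, 34, 25, 16, 19, 29, 28, 18, 9, 17, 11, 5, 3, 2, 41, 40],
    [0, 1, 7, 4, 8, 6, 12, 23, 26, 35, 32, 31, 30, 22, 14, 13, 20, 10, 21, 15, 24, 33, 39, 34,
     25, 16, 19, 29, 28, 37, 36, 27, 18, 9, 17, 11, 5, 3, 2, 41, 40],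
    [0, 16, 25, 34, 29, 19, 9, 17, 11, 5, 3, 2, 4, 7, 13, 20, 30, 22, 14, 8, 6, 12, 23, 31, 32,
     35, 26, 27, 18, 28, 37, 36, 38, 33, 24, 15, 21, 10, 1, 41, 40],
    [1, 0, 15, 21, 10, 20, 30, 22, 12, 23, 31, 32, 24, 25, 16, 19, 9, 18, 27, 36, 37, 28, 29, 34,
     39, 33, 38, 35, 26, 17, 11, 5, 3, 6, 8, 14, 13, 7, 4, 2, 41],
    [0, 1, 7, 4, 2, 3, 5, 11, 17, 26, 23, 31, 30, 22, 12, 6, 8, 14, 13, 20, 10, 21, 15, 24, 32,
     35, 38, 33, 39, 34, 25, 16, 19, 29, 28, 37, 36, 27, 18, 9, 40]]"

lemma cycle_certificate_42:
  "cycle_certificate 42 edges42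
   [28, 18, 27, 37, 36, 39, 34, 29, 33, 38, 19, 25, 16, 35, 32, 24, 9, 17, 26, 15, 0, 21, 23, 31,
    11, 40, 5, 41, 1, 10, 30, 20, 22, 12, 13, 14, 3, 6, 4, 2, 7, 8]
   [41, 4, 3, 7, 13, 14, 8, 6, 22, 30, 20, 10, 1, 12, 11, 5, 21, 23, 31, 17, 40, 15, 0, 32, 26,
    35, 24, 25, 16, 19, 33, 38, 34, 39, 29, 37, 36, 9, 28, 27, 18]
   cycles42
   [0, 1, 7, 4, 2, 3, 5, 11, 17, 26, 23, 31, 30, 22, 12, 6, 8, 14, 13, 20, 10, 21, 15, 24, 32,
    35, 38, 33, 39, 34, 25, 16, 19, 29, 28, 37, 36, 27, 18, 9, 40, 41]
   [1, 0, 15, 21, 10, 20, 30, 22, 12, 23, 31, 32, 24, 25, 16, 19, 9, 18, 27, 36, 37, 28, 29, 34,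
    39, 33, 38, 35, 26, 17, 11, 5, 3, 6, 8, 14, 13, 7, 4, 2, 41, 40]"
  by code_simp

lemma drawing_certificate_42: "drawing_certificate 42 edges42 points42"
  by code_simp

lemma exceptional_degree_42: "length (filter (\<lambda>u. u \<in> set (neighbours edges42 2)) [0..<42]) = 3"
  by code_simp

definition edges45 :: "(nat \<times> nat) list" where
  "edges45 =
   [(0, 5), (0, 9), (1, 15), (1, 16), (2, 3), (2, 4), (2, 43), (3, 5), (3, 6), (4, 7), (4, 8),
    (5, 11), (6, 8), (6, 12), (7, 13), (7, 44), (8, 14), (9, 17), (9, 18), (10, 19), (10, 20),
    (10, 44), (11, 12), (11, 17), (12, 21), (12, 22), (13, 14), (13, 19), (14, 21), (15, 20),
    (15, 23), (15, 24), (16, 18), (16, 25), (16, 26), (17, 27), (18, 28), (19, 29), (20, 30),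
    (21, 29), (22, 27), (22, 30), (23, 31), (23, 32), (24, 26), (24, 33), (25, 34), (25, 35),
    (26, 36), (27, 28), (28, 31), (28, 34), (29, 30), (30, 31), (31, 37), (32, 33), (32, 38),
    (33, 39), (34, 40), (35, 36), (35, 41), (36, 39), (37, 38), (37, 40), (38, 42), (39, 42),
    (40, 41), (41, 42)]"

definition points45 :: "(int \<times> int) list" where
  "points45 =
   [(20, 0), (20, 20), (-5, -11), (0, -25), (-16, -7), (13, -22), (-7, -43), (-17, 9),
    (-26, -20), (31, 1), (-3, 41), (18, -40), (4, -84), (-36, 15), (-55, -11), (29, 38),
    (31, 23), (37, -13), (36, 15), (-36, 46), (28, 56), (-102, -26), (102, -12), (37, 42),
    (32, 34), (36, 27), (33, 30), (61, -1), (46, 23), (-69, 81), (57, 90), (45, 49), (37, 38),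
    (35, 35), (41, 28), (36, 30), (35, 31), (41, 40), (38, 38), (36, 34), (40, 34), (38, 33),
    (37, 35), (0, 0), (0, 20)]"

definition cycles45 :: "nat list list" where
  "cycles45 =
   [[1, 15, 23, 31, 28, 34, 25, 35, 36, 39, 42, 41, 40, 37, 38, 32, 33, 24, 26, 16, 18, 9, 17,
     27, 22, 12, 11, 5, 3, 6, 8, 14, 21, 29, 30, 20, 10, 19, 13, 7, 4, 2, 43, 44],
    [0, 5, 3, 2, 4, 7, 13, 19, 29, 21, 14, 8, 6, 12, 11, 17, 9, 18, 16, 25, 34, 28, 27, 22, 30,
     31, 23, 32, 33, 39, 42, 38, 37, 40, 41, 35, 36, 26, 24, 15, 20, 10, 44, 43],
    [1, 0, 5, 11, 12, 6, 8, 14, 21, 29, 30, 22, 27, 17, 9, 18, 16, 25, 34, 28, 31, 23, 32, 33,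
     39, 42, 38, 37, 40, 41, 35, 36, 26, 24, 15, 20, 10, 19, 13, 7, 4, 2, 43, 44],
    [0, 1, 15, 23, 31, 28, 34, 25, 35, 36, 39, 42, 41, 40, 37, 38, 32, 33, 24, 26, 16, 18, 9, 17,
     27, 22, 30, 20, 10, 44, 7, 13, 19, 29, 21, 14, 8, 6, 12, 11, 5, 3, 2, 43],
    [1, 0, 9, 17, 11, 12, 22, 27, 28, 18, 16, 25, 34, 40, 37, 38, 32, 33, 39, 42, 41, 35, 36, 26,
     24, 15, 23, 31, 30, 20, 10, 19, 29, 21, 14, 13, 7, 4, 8, 6, 3, 2, 43, 44],
    [0, 1, 15, 23, 31, 28, 34, 25, 35, 36, 39, 42, 41, 40, 37, 38, 32, 33, 24, 26, 16, 18, 9, 17,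
     27, 22, 12, 11, 5, 3, 2, 4, 8, 14, 21, 29, 30, 20, 10, 19, 13, 7, 44, 43],
    [0, 1, 44, 10, 19, 13, 14, 21, 29, 30, 20, 15, 23, 31, 28, 34, 25, 35, 36, 39, 42, 41, 40,
     37, 38, 32, 33, 24, 26, 16, 18, 9, 17, 27, 22, 12, 11, 5, 3, 6, 8, 4, 2, 43],
    [0, 5, 11, 12, 6, 3, 2, 4, 7, 13, 14, 21, 29, 19, 10, 20, 15, 23, 31, 30, 22, 27, 17, 9, 18,
     28, 34, 25, 35, 36, 39, 42, 41, 40, 37, 38, 32, 33, 24, 26, 16, 1, 44, 43],
    [0, 5, 3, 2, 4, 7, 13, 19, 29, 21, 14, 8, 6, 12, 11, 17, 27, 22, 30, 31, 23, 32, 33, 24, 26,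
     36, 39, 42, 38, 37, 40, 41, 35, 25, 34, 28, 18, 16, 1, 15, 20, 10, 44, 43],
    [0, 5, 11, 17, 9, 18, 16, 1, 15, 20, 30, 31, 23, 32, 33, 24, 26, 36, 39, 42, 38, 37, 40, 41,
     35, 25, 34, 28, 27, 22, 12, 6, 3, 2, 4, 8, 14, 21, 29, 19, 13, 7, 44, 43],
    [0, 5, 3, 2, 4, 7, 13, 14, 8, 6, 12, 21, 29, 19, 10, 20, 15, 23, 31, 30, 22, 27, 17, 9, 18,
     28, 34, 25, 35, 36, 39, 42, 41, 40, 37, 38, 32, 33, 24, 26, 16, 1, 44, 43],
    [0, 1, 44, 7, 13, 14, 21, 29, 19, 10, 20, 15, 23, 31, 30, 22, 27, 28, 34, 25, 35, 36, 39, 42,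
     41, 40, 37, 38, 32, 33, 24, 26, 16, 18, 9, 17, 11, 5, 3, 6, 8, 4, 2, 43],
    [0, 1, 15, 23, 31, 28, 34, 25, 35, 36, 39, 42, 41, 40, 37, 38, 32, 33, 24, 26, 16, 18, 9, 17,
     27, 22, 30, 20, 10, 19, 29, 21, 14, 8, 6, 12, 11, 5, 3, 2, 4, 7, 44, 43],
    [0, 1, 15, 23, 31, 28, 34, 25, 35, 36, 39, 42, 41, 40, 37, 38, 32, 33, 24, 26, 16, 18, 9, 17,
     27, 22, 30, 20, 10, 44, 7, 13, 19, 29, 21, 12, 11, 5, 3, 6, 8, 4, 2, 43],
    [0, 1, 16, 18, 9, 17, 11, 5, 3, 2, 4, 7, 13, 19, 29, 21, 14, 8, 6, 12, 22, 27, 28, 34, 25,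
     35, 36, 26, 24, 33, 39, 42, 41, 40, 37, 38, 32, 23, 31, 30, 20, 10, 44, 43],
    [0, 5, 11, 12, 22, 27, 17, 9, 18, 28, 34, 25, 35, 36, 26, 24, 33, 39, 42, 41, 40, 37, 38, 32,
     23, 31, 30, 20, 15, 1, 44, 10, 19, 29, 21, 14, 13, 7, 4, 8, 6, 3, 2, 43],
    [1, 0, 9, 18, 16, 25, 34, 28, 27, 22, 12, 11, 5, 3, 6, 8, 14, 21, 29, 30, 31, 23, 32, 33, 39,
     42, 38, 37, 40, 41, 35, 36, 26, 24, 15, 20, 10, 19, 13, 7, 4, 2, 43, 44],
    [0, 9, 17, 11, 5, 3, 2, 4, 7, 13, 14, 8, 6, 12, 21, 29, 19, 10, 20, 15, 23, 31, 30, 22, 27,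
     28, 34, 25, 35, 36, 39, 42, 41, 40, 37, 38, 32, 33, 24, 26, 16, 1, 44, 43],
    [0, 1, 44, 10, 20, 15, 23, 31, 28, 34, 25, 35, 36, 39, 42, 41, 40, 37, 38, 32, 33, 24, 26,
     16, 18, 9, 17, 27, 22, 30, 29, 21, 12, 11, 5, 3, 6, 8, 14, 13, 7, 4, 2, 43],
    [0, 1, 15, 23, 31, 28, 34, 25, 35, 36, 39, 42, 41, 40, 37, 38, 32, 33, 24, 26, 16, 18, 9, 17,
     27, 22, 30, 29, 19, 10, 44, 7, 13, 14, 21, 12, 11, 5, 3, 6, 8, 4, 2, 43],
    [0, 1, 15, 23, 31, 28, 34, 25, 35, 36, 39, 42, 41, 40, 37, 38, 32, 33, 24, 26, 16, 18, 9, 17,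
     27, 22, 12, 11, 5, 3, 6, 8, 14, 13, 19, 29, 30, 20, 10, 44, 7, 4, 2, 43],
    [0, 5, 11, 12, 6, 3, 2, 4, 8, 14, 21, 29, 30, 31, 23, 32, 33, 24, 26, 36, 39, 42, 38, 37, 40,
     41, 35, 25, 34, 28, 27, 17, 9, 18, 16, 1, 15, 20, 10, 19, 13, 7, 44, 43],
    [0, 1, 15, 24, 26, 16, 18, 9, 17, 11, 5, 3, 2, 4, 7, 13, 19, 29, 21, 14, 8, 6, 12, 22, 27,
     28, 34, 25, 35, 36, 39, 33, 32, 38, 42, 41, 40, 37, 31, 30, 20, 10, 44, 43],
    [0, 1, 16, 26, 36, 35, 25, 34, 40, 41, 42, 39, 33, 32, 38, 37, 31, 23, 15, 20, 10, 19, 13,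
     14, 8, 6, 12, 21, 29, 30, 22, 27, 28, 18, 9, 17, 11, 5, 3, 2, 4, 7, 44, 43],
    [0, 1, 15, 20, 10, 19, 13, 14, 8, 6, 12, 21, 29, 30, 22, 27, 28, 34, 40, 37, 31, 23, 32, 38,
     42, 41, 35, 36, 39, 33, 24, 26, 16, 18, 9, 17, 11, 5, 3, 2, 4, 7, 44, 43],
    [0, 1, 16, 18, 9, 17, 11, 5, 3, 2, 4, 7, 13, 19, 29, 21, 14, 8, 6, 12, 22, 27, 28, 34, 25,
     35, 36, 39, 33, 24, 15, 23, 32, 38, 42, 41, 40, 37, 31, 30, 20, 10, 44, 43],
    [0, 1, 15, 23, 31, 28, 34, 25, 35, 36, 39, 42, 41, 40, 37, 38, 32, 33, 24, 26, 16, 18, 9, 17,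
     11, 5, 3, 2, 4, 7, 13, 19, 29, 21, 14, 8, 6, 12, 22, 30, 20, 10, 44, 43],
    [0, 1, 44, 7, 13, 14, 21, 29, 19, 10, 20, 30, 31, 23, 15, 24, 26, 36, 35, 41, 42, 39, 33, 32,
     38, 37, 40, 34, 25, 16, 18, 9, 17, 27, 22, 12, 11, 5, 3, 6, 8, 4, 2, 43],
    [0, 1, 44, 7, 4, 8, 6, 12, 21, 14, 13, 19, 10, 20, 15, 23, 31, 30, 22, 27, 28, 34, 25, 35,
     36, 39, 42, 41, 40, 37, 38, 32, 33, 24, 26, 16, 18, 9, 17, 11, 5, 3, 2, 43],
    [0, 1, 44, 7, 13, 14, 21, 29, 19, 10, 20, 15, 23, 31, 28, 34, 25, 35, 36, 39, 42, 41, 40, 37,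
     38, 32, 33, 24, 26, 16, 18, 9, 17, 27, 22, 12, 11, 5, 3, 6, 8, 4, 2, 43],
    [0, 5, 3, 2, 4, 7, 13, 19, 10, 20, 15, 23, 32, 33, 24, 26, 36, 39, 42, 38, 37, 40, 41, 35,
     25, 34, 28, 27, 22, 30, 29, 21, 14, 8, 6, 12, 11, 17, 9, 18, 16, 1, 44, 43],
    [0, 1, 16, 25, 34, 40, 41, 35, 36, 26, 24, 33, 39, 42, 38, 37, 31, 23, 15, 20, 10, 19, 13,
     14, 8, 6, 12, 21, 29, 30, 22, 27, 28, 18, 9, 17, 11, 5, 3, 2, 4, 7, 44, 43],
    [0, 1, 15, 24, 26, 16, 18, 9, 17, 11, 5, 3, 2, 4, 7, 13, 19, 29, 21, 14, 8, 6, 12, 22, 27,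
     28, 34, 25, 35, 36, 39, 42, 41, 40, 37, 38, 32, 23, 31, 30, 20, 10, 44, 43],
    [0, 1, 15, 20, 10, 19, 13, 14, 8, 6, 12, 21, 29, 30, 22, 27, 28, 31, 23, 32, 33, 24, 26, 36,
     39, 42, 38, 37, 40, 41, 35, 25, 16, 18, 9, 17, 11, 5, 3, 2, 4, 7, 44, 43],
    [0, 1, 16, 25, 34, 40, 41, 42, 38, 37, 31, 23, 32, 33, 39, 36, 26, 24, 15, 20, 10, 19, 13,
     14, 8, 6, 12, 21, 29, 30, 22, 27, 28, 18, 9, 17, 11, 5, 3, 2, 4, 7, 44, 43],
    [0, 1, 15, 20, 10, 19, 13, 14, 8, 6, 12, 21, 29, 30, 22, 27, 28, 31, 23, 32, 38, 37, 40, 34,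
     25, 35, 41, 42, 39, 33, 24, 26, 16, 18, 9, 17, 11, 5, 3, 2, 4, 7, 44, 43],
    [0, 1, 15, 20, 10, 19, 13, 14, 8, 6, 12, 21, 29, 30, 22, 27, 28, 31, 23, 32, 38, 42, 39, 33,
     24, 26, 36, 35, 41, 40, 34, 25, 16, 18, 9, 17, 11, 5, 3, 2, 4, 7, 44, 43],
    [0, 1, 15, 20, 10, 19, 13, 14, 8, 6, 12, 21, 29, 30, 22, 27, 28, 34, 25, 35, 36, 39, 42, 41,
     40, 37, 31, 23, 32, 33, 24, 26, 16, 18, 9, 17, 11, 5, 3, 2, 4, 7, 44, 43],
    [0, 1, 15, 20, 10, 19, 13, 14, 8, 6, 12, 21, 29, 30, 22, 27, 28, 31, 23, 32, 33, 24, 26, 36,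
     35, 41, 42, 38, 37, 40, 34, 25, 16, 18, 9, 17, 11, 5, 3, 2, 4, 7, 44, 43],
    [0, 1, 44, 7, 13, 14, 21, 29, 19, 10, 20, 30, 31, 37, 38, 32, 23, 15, 24, 33, 39, 42, 41, 35,
     36, 26, 16, 25, 34, 28, 18, 9, 17, 27, 22, 12, 11, 5, 3, 6, 8, 4, 2, 43],
    [0, 1, 15, 20, 10, 19, 13, 14, 8, 6, 12, 21, 29, 30, 22, 27, 28, 34, 40, 37, 31, 23, 32, 38,
     42, 39, 33, 24, 26, 36, 35, 25, 16, 18, 9, 17, 11, 5, 3, 2, 4, 7, 44, 43],
    [0, 1, 15, 24, 33, 39, 36, 26, 16, 18, 9, 17, 11, 5, 3, 2, 4, 7, 13, 19, 29, 21, 14, 8, 6,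
     12, 22, 27, 28, 34, 25, 35, 41, 40, 37, 38, 32, 23, 31, 30, 20, 10, 44, 43],
    [1, 0, 5, 3, 2, 4, 7, 13, 19, 29, 21, 14, 8, 6, 12, 11, 17, 9, 18, 16, 25, 34, 28, 27, 22,
     30, 31, 23, 32, 33, 39, 42, 38, 37, 40, 41, 35, 36, 26, 24, 15, 20, 10, 44],
    [0, 1, 15, 23, 31, 28, 34, 25, 35, 36, 39, 42, 41, 40, 37, 38, 32, 33, 24, 26, 16, 18, 9, 17,
     27, 22, 12, 11, 5, 3, 6, 8, 14, 21, 29, 30, 20, 10, 19, 13, 7, 4, 2, 43]]"

lemma cycle_certificate_45:
  "cycle_certificate 45 edges45
   [41, 40, 34, 25, 35, 42, 36, 39, 38, 37, 26, 33, 32, 24, 23, 31, 28, 18, 16, 15, 20, 27, 22,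
    30, 1, 9, 17, 29, 10, 19, 11, 21, 12, 5, 0, 43, 44, 13, 14, 3, 6, 8, 4, 2, 7]
   [33, 24, 39, 26, 36, 42, 35, 41, 32, 38, 23, 37, 40, 25, 34, 43, 31, 3, 16, 18, 28, 15, 1, 20,
    9, 27, 17, 22, 11, 0, 30, 12, 29, 21, 19, 10, 13, 4, 44, 5, 7, 8, 6, 14]
   cycles45
   [0, 1, 15, 23, 31, 28, 34, 25, 35, 36, 39, 42, 41, 40, 37, 38, 32, 33, 24, 26, 16, 18, 9, 17,
    27, 22, 12, 11, 5, 3, 6, 8, 14, 21, 29, 30, 20, 10, 19, 13, 7, 4, 2, 43, 44]
   [1, 0, 5, 3, 2, 4, 7, 13, 19, 29, 21, 14, 8, 6, 12, 11, 17, 9, 18, 16, 25, 34, 28, 27, 22, 30,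
    31, 23, 32, 33, 39, 42, 38, 37, 40, 41, 35, 36, 26, 24, 15, 20, 10, 44, 43]"
  by code_simp

lemma drawing_certificate_45: "drawing_certificate 45 edges45 points45"
  by code_simp

lemma exceptional_degree_45: "length (filter (\<lambda>u. u \<in> set (neighbours edges45 2)) [0..<45]) = 3"
  by code_simp

theorem theorem3p15:
  fixes n :: nat
  assumes "(\<exists>k::nat. n = 36 + 4 * k) \<or> n \<ge> 73"
  shows "\<exists>(V :: nat set) (E :: nat \<Rightarrow> nat \<Rightarrow> bool) w.
           simple_graph V E \<and> connected_graph V E \<and> card V = n \<and> planar V E \<and>
           almost_hypohamiltonian_exc V E w \<and> degree V E w = 3"
proof -
  \<comment> \<open>The classes 1, 2 and 3 modulo 4 start at 45, 42 and 39, all below 73.\<close>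
  have start: "(\<exists>k. n = 36 + 4 * k) \<or> (\<exists>k. n = 39 + 4 * k) \<or> (\<exists>k. n = 42 + 4 * k) \<or> (\<exists>k. n = 45 + 4 * k)"
    using assms by presburger
  then show ?thesis
    using almost_hypohamiltonian_family[OF cycle_certificate_36 drawing_certificate_36 exceptional_degree_36]
      almost_hypohamiltonian_family[OF cycle_certificate_39 drawing_certificate_39 exceptional_degree_39]
      almost_hypohamiltonian_family[OF cycle_certificate_42 drawing_certificate_42 exceptional_degree_42]
      almost_hypohamiltonian_family[OF cycle_certificate_45 drawing_certificate_45 exceptional_degree_45]
    by blast
qed

end
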